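(* Let $G$ be a group of polynomial volume growth equipped with a generating $k$-tuple $S=(s_1,\dots,s_k)$ and the associated word-length $|\cdot|$ and volume function $V$. Let $D(G)$ be the degree of polynomial volume growth of $G$. Let $\nu_2$ be a symmetric probability measure on $G$ such that $$\nu_2(g)\simeq\big((1+|g|)^2V(|g|)\big)^{-1}.$$ Then $$\nu_2^{(n)}(e)\simeq(n\log n)^{-D(G)/2}.$$ Further, $\nu_2$ is strongly $(|\cdot|,\,t\mapsto(t\log t)^{1/2})$-controlled.
   Context: Notation: $f\simeq g$ means that there are constants $0<c\le C<\infty$ with $cg\le f\le Cg$ on the relevant domain (here, for the return probability, integers $n\ge2$). A probability measure $\mu$ on $G$ is symmetric if $\mu(g)=\mu(g^{-1})$. The word length $|g|$ associated with $S$ is the least $m$ with $g=u_1\cdots u_m$, $u_i\in\{s_1^{\pm1},\dots,s_k^{\pm1}\}$ ($|e|=0$); $V(t)=\#\{g\in G:|g|\le t\}$; $G$ has polynomial volume growth of degree $D$ if $V(t)\simeq t^D$ for $t\ge1$. For a probability measure $\mu$ on $G$, $\mu^{(n)}$ is the $n$-fold convolution power, and the random walk $(X_n)_{n\ge0}$ driven by $\mu$ is $X_n=X_0\xi_1\cdots\xi_n$ with $(\xi_i)$ i.i.d. of law $\mu$; $\mathbf P_x$ is its law when $X_0=x$. A norm on $G$ is a function $\|\cdot\|:G\to[0,\infty)$ with $\|g\|=0$ iff $g=e$ and $\|gh\|\le\|g\|+\|h\|$; its volume function is $V(t)=\#\{g:\|g\|\le t\}$. The word length is a norm. Strong control: let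 $r:(0,\infty)\to(0,\infty)$ be an increasing continuous function with inverse $\rho$. A symmetric probability measure $\mu$ on $G$ is strongly $(\|\cdot\|,r)$-controlled if: (1) there exists $C\in(0,\infty)$ and, for any $\kappa>0$, there exists $c(\kappa)>0$ such that, for all $n\ge1$ and all $g$ with $\|g\|\le\kappa r(n)$, $c(\kappa)V(r(n))^{-1}\le\mu^{(2n)}(g)\le CV(r(n))^{-1}$; (2) there exist $\epsilon,\gamma_1,\gamma_2\in(0,\infty)$, $\gamma_2\ge1$, such that, for all $n,\tau$ with $\frac12\rho(\tau/\gamma_1)\le n\le\rho(\tau/\gamma_1)$, $\inf_{x:\|x\|\le\tau}\mathbf P_x\big(\sup_{0\le k\le n}\|X_k\|\le\gamma_2\tau;\ \|X_n\|\le\tau\big)\ge\epsilon$.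
   Formalization: Since (t log t)^{1/2} is undefined or zero for t ≤ 1, strong control is stated for every increasing continuous bijection r of (0,∞) that equals (t log t)^{1/2} for all large t. *)

theory Defs
  imports "HOL-Algebra.Generated_Groups" "HOL-Probability.Probability"
begin

definition comparable_on :: "'a set \<Rightarrow> ('a \<Rightarrow> real) \<Rightarrow> ('a \<Rightarrow> real) \<Rightarrow> bool" where
  "comparable_on A f g \<longleftrightarrow>
     (\<exists>c C. 0 < c \<and> c \<le> C \<and> (\<forall>x\<in>A. c * g x \<le> f x \<and> f x \<le> C * g x))"

definition word_length :: "('a, 'b) monoid_scheme \<Rightarrow> 'a list \<Rightarrow> 'a \<Rightarrow> nat" where
  "word_length G S g =
     (LEAST m. \<exists>us. length us = m \<and> set us \<subseteq> set S \<union> (\<lambda>s. inv\<^bsub>G\<^esub> s) ` set S \<and>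
        g = foldr (\<lambda>u v. u \<otimes>\<^bsub>G\<^esub> v) us \<one>\<^bsub>G\<^esub>)"

abbreviation word_norm :: "('a, 'b) monoid_scheme \<Rightarrow> 'a list \<Rightarrow> 'a \<Rightarrow> real" where
  "word_norm G S \<equiv> \<lambda>g. real (word_length G S g)"

definition group_norm :: "('a, 'b) monoid_scheme \<Rightarrow> ('a \<Rightarrow> real) \<Rightarrow> bool" where
  "group_norm G N \<longleftrightarrow>
     (\<forall>g\<in>carrier G. 0 \<le> N g \<and> (N g = 0 \<longleftrightarrow> g = \<one>\<^bsub>G\<^esub>)) \<and>
     (\<forall>g\<in>carrier G. \<forall>h\<in>carrier G. N (g \<otimes>\<^bsub>G\<^esub> h) \<le> N g + N h)"

definition volume :: "('a, 'b) monoid_scheme \<Rightarrow> ('a \<Rightarrow> real) \<Rightarrow> real \<Rightarrow> real" where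
  "volume G N t = real (card {g \<in> carrier G. N g \<le> t})"

definition polynomial_growth :: "('a, 'b) monoid_scheme \<Rightarrow> 'a list \<Rightarrow> real \<Rightarrow> bool" where
  "polynomial_growth G S D \<longleftrightarrow>
     comparable_on {1..} (volume G (word_norm G S)) (\<lambda>t. t powr D)"

text \<open>A finitely generated group is countable, so its probability measures are exactly the
  probability mass functions supported in the carrier.\<close>

definition symmetric_measure :: "('a, 'b) monoid_scheme \<Rightarrow> 'a pmf \<Rightarrow> bool" where
  "symmetric_measure G \<mu> \<longleftrightarrow>
     set_pmf \<mu> \<subseteq> carrier G \<and> (\<forall>g\<in>carrier G. pmf \<mu> (inv\<^bsub>G\<^esub> g) = pmf \<mu> g)"

definition convolution :: "('a, 'b) monoid_scheme \<Rightarrow> 'a pmf \<Rightarrow> 'a pmf \<Rightarrow> 'a pmf" where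
  "convolution G \<mu> \<nu> = map_pmf (\<lambda>(x, y). x \<otimes>\<^bsub>G\<^esub> y) (pair_pmf \<mu> \<nu>)"

primrec conv_power :: "('a, 'b) monoid_scheme \<Rightarrow> 'a pmf \<Rightarrow> nat \<Rightarrow> 'a pmf" where
  "conv_power G \<mu> 0 = return_pmf \<one>\<^bsub>G\<^esub>"
| "conv_power G \<mu> (Suc n) = convolution G (conv_power G \<mu> n) \<mu>"

text \<open>The increments are indexed from 0: the step from time \<open>n\<close> to time \<open>n + 1\<close> is \<open>\<xi> n\<close>.\<close>

primrec walk :: "('a, 'b) monoid_scheme \<Rightarrow> 'a \<Rightarrow> (nat \<Rightarrow> 'a) \<Rightarrow> nat \<Rightarrow> 'a" where
  "walk G x \<xi> 0 = x"
| "walk G x \<xi> (Suc n) = walk G x \<xi> n \<otimes>\<^bsub>G\<^esub> \<xi> n"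

text \<open>The law of an i.i.d. sequence of increments with common law \<open>\<mu>\<close>. The law \<open>\<mu>\<close> is first
  regarded as a measure on the countable set \<open>carrier G\<close>; on the whole type, which may be
  uncountable, events about the walk need not be measurable in the product space.\<close>

definition increments :: "('a, 'b) monoid_scheme \<Rightarrow> 'a pmf \<Rightarrow> (nat \<Rightarrow> 'a) measure" where
  "increments G \<mu> = PiM UNIV (\<lambda>_. restrict_space (measure_pmf \<mu>) (carrier G))"

definition scale_function :: "(real \<Rightarrow> real) \<Rightarrow> bool" where
  "scale_function r \<longleftrightarrow>
     strict_mono_on {0<..} r \<and> continuous_on {0<..} r \<and> bij_betw r {0<..} {0<..}"

definition strongly_controlled ::
    "('a, 'b) monoid_scheme \<Rightarrow> ('a \<Rightarrow> real) \<Rightarrow> (real \<Rightarrow> real) \<Rightarrow> 'a pmf \<Rightarrow> bool" where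
  "strongly_controlled G N r \<mu> \<longleftrightarrow>
     group_norm G N \<and> scale_function r \<and> symmetric_measure G \<mu> \<and>
     (\<exists>C>0. \<forall>\<kappa>>0. \<exists>c>0. \<forall>n\<ge>1. \<forall>g\<in>carrier G. N g \<le> \<kappa> * r (real n) \<longrightarrow>
        c * inverse (volume G N (r (real n))) \<le> pmf (conv_power G \<mu> (2 * n)) g \<and>
        pmf (conv_power G \<mu> (2 * n)) g \<le> C * inverse (volume G N (r (real n)))) \<and>
     (\<exists>\<epsilon> \<gamma>\<^sub>1 \<gamma>\<^sub>2. 0 < \<epsilon> \<and> 0 < \<gamma>\<^sub>1 \<and> 1 \<le> \<gamma>\<^sub>2 \<and>
        (let \<rho> = the_inv_into {0<..} r in
         \<forall>(n::nat) (\<tau>::real). 0 < \<tau> \<and> \<rho> (\<tau> / \<gamma>\<^sub>1) / 2 \<le> real n \<and> real n \<le> \<rho> (\<tau> / \<gamma>\<^sub>1) \<longrightarrow>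
           (INF x \<in> {x \<in> carrier G. N x \<le> \<tau>}.
              measure (increments G \<mu>)
                {\<xi> \<in> space (increments G \<mu>).
                   (SUP k\<in>{0..n}. N (walk G x \<xi> k)) \<le> \<gamma>\<^sub>2 * \<tau> \<and> N (walk G x \<xi> n) \<le> \<tau>})
           \<ge> \<epsilon>))"

text \<open>The function \<open>t \<mapsto> sqrt (t * ln t)\<close> is not positive on \<open>(0, 1]\<close>, so as a scale function it has
  to be modified on an initial interval. We admit every scale function that agrees with it for
  all large \<open>t\<close>.\<close>

definition sqrt_t_log_t_scale :: "(real \<Rightarrow> real) \<Rightarrow> bool" where
  "sqrt_t_log_t_scale r \<longleftrightarrow>
     scale_function r \<and> (\<forall>\<^sub>F t in at_top. r t = sqrt (t * ln t))"

lemma sqrt_t_log_t_scale_exists: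
  "sqrt_t_log_t_scale (\<lambda>t. sqrt (t * ln (max t 2)))"
proof -
  define r where "r = (\<lambda>t::real. sqrt (t * ln (max t 2)))"
  have mono: "strict_mono_on {0<..} r"
    unfolding r_def by (intro strict_mono_onI) (auto intro!: mult_less_le_imp_less)
  have cont: "continuous_on {0..} r"
    unfolding r_def by (intro continuous_intros) auto
  have "y \<in> r ` {0<..}" if y: "0 < y" for y
  proof -
    define b where "b = 2 + y\<^sup>2 / ln 2"
    have b: "b \<ge> 2" using y by (simp add: b_def)
    have "y\<^sup>2 = (y\<^sup>2 / ln 2) * ln 2" by simp
    also have "\<dots> \<le> b * ln (max b 2)"
    proof (intro mult_mono)
      show "ln 2 \<le> ln (max b 2)" using b by (subst ln_le_cancel_iff) auto
    qed (use y b in \<open>auto simp: b_def\<close>)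
    finally have "y \<le> r b"
      using y by (simp add: r_def real_le_rsqrt)
    moreover have "r 0 \<le> y" using y by (simp add: r_def)
    moreover have "continuous_on {0..b} r"
      by (rule continuous_on_subset[OF cont]) auto
    ultimately obtain x where x: "0 \<le> x" "x \<le> b" "r x = y"
      using IVT'[of r 0 y b] b by auto
    moreover from x y have "x \<noteq> 0" by (auto simp: r_def)
    ultimately show ?thesis by (intro image_eqI[of _ _ x]) auto
  qed
  moreover have "r t > 0" if "0 < t" for t
    using that by (simp add: r_def)
  ultimately have "bij_betw r {0<..} {0<..}"
    using strict_mono_on_imp_inj_on[OF mono] by (auto simp: bij_betw_def)
  moreover have "\<forall>\<^sub>F t in at_top. r t = sqrt (t * ln t)"
    using eventually_ge_at_top[of 2] by eventually_elim (simp add: r_def max_def)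
  moreover have "continuous_on {0<..} r"
    by (rule continuous_on_subset[OF cont]) auto
  ultimately show ?thesis
    using mono unfolding sqrt_t_log_t_scale_def scale_function_def r_def by blast
qed

end

theory Submission imports Defs "HOL-Real_Asymp.Real_Asymp" begin

text \<open>
  Write \<open>p\<^sub>n\<close> for the density of the walk at time \<open>n\<close>, started at the identity, \<open>V\<close> for the volume
  function and \<open>R(n) = (n log (n + 1))\<^sup>1\<^sup>/\<^sup>2\<close>. Everything follows from the two-sided estimate
  \<open>p\<^sub>n(g) \<simeq> 1 / V(R(n))\<close>, the lower bound being restricted to \<open>|g| \<le> \<kappa> R(n)\<close>, together with the
  fact that with probability close to 1 the walk stays, up to time \<open>n\<close>, within a large multiple of
  \<open>R(n)\<close> of its starting point. Polynomial growth enters as volume doubling, and the word metric as a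
  left-invariant geodesic distance.

  \<^bold>\<open>Upper bound.\<close> The defect \<open>\<psi>(g) = p\<^sub>2\<^sub>n(e) - p\<^sub>2\<^sub>n(g)\<close> is half the squared \<open>\<ell>\<^sup>2\<close> distance between \<open>p\<^sub>n\<close>
  and its translate by \<open>g\<close>; hence its square root is a length function (\<open>defect_mult\<close>), and its mean
  under the step distribution is \<open>p\<^sub>2\<^sub>n(e) - p\<^sub>2\<^sub>n\<^sub>+\<^sub>1(e)\<close> (\<open>expectation_defect\<close>). Because the step
  distribution has density of order \<open>1 / (t\<^sup>2 V(t))\<close> at distance \<open>t\<close>, the part of this mean that comes
  from distances of order \<open>t\<close> controls \<open>\<psi> / t\<^sup>2\<close> on the ball of radius \<open>t\<close>, hence \<open>\<psi> / s\<^sup>2\<close> on the ball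
  of any larger radius \<open>s\<close>. There are about \<open>log s\<close> disjoint ranges of \<open>t\<close>, in geometric progression, below \<open>s\<close>, so that
  \<open>\<psi>(g) log s \<le> C s\<^sup>2 (p\<^sub>2\<^sub>n(e) - p\<^sub>2\<^sub>n\<^sub>+\<^sub>1(e))\<close> for \<open>|g| \<le> s\<close> (\<open>pseudo_poincare\<close>). Averaging over the ball
  of radius \<open>s\<close> gives the Nash-type inequality
  \<open>p\<^sub>2\<^sub>n(e) \<le> 1 / V(s) + C (s\<^sup>2 / log s) (p\<^sub>2\<^sub>n(e) - p\<^sub>2\<^sub>n\<^sub>+\<^sub>2(e))\<close> (\<open>return_prob_nash\<close>), and summing it over
  the times from \<open>n\<close> to \<open>2n\<close> with \<open>s\<close> a small multiple of \<open>R(n)\<close> yields the upper bound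
  (\<open>return_prob_upper\<close>).

  \<^bold>\<open>Confinement.\<close> The truncated second moment \<open>E min(|\<xi>|, l)\<^sup>2\<close> of a step \<open>\<xi>\<close> grows like \<open>log l\<close>.
  Testing the walk killed outside a ball with a trapezoid function of slope \<open>1 / l\<close>, where \<open>l\<close> is a
  large multiple of \<open>R(n)\<close>, shows that the killed walk loses a small share of its mass
  before time \<open>n\<close>, provided that the shell on which the trapezoid decreases has small relative volume.
  Doubling supplies such a shell (\<open>thin_shell\<close>). The estimate concerns a starting point averaged over the
  ball; by left invariance it holds for the identity (\<open>confinement\<close>).

  \<^bold>\<open>Lower bounds.\<close> Confinement and the Cauchy--Schwarz inequality bound \<open>p\<^sub>n(e)\<close> from below
  (\<open>return_lower\<close>). The pseudo-Poincare inequality also bounds the oscillation of \<open>p\<^sub>m\<close> on the ball of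
  radius \<open>\<eta> R(m)\<close> by a small multiple of \<open>1 / V(R(m))\<close> (\<open>near_diagonal_lower\<close>), and chaining extends the
  lower bound to radii \<open>\<kappa> R(m)\<close> (\<open>p_lower_infinite\<close>). Finite groups are trivial for the density bounds,
  since there the step distribution is bounded below.

  For the second condition of strong control, the density lower bound keeps the endpoint in the ball of radius
  \<open>\<tau>\<close> with probability at least \<open>2\<epsilon>\<close>, whereas the path leaves a larger ball with probability at
  most \<open>\<epsilon>\<close>.
\<close>

section \<open>Word lengths and balls\<close>

locale word_metric = group G for G :: "('a, 'b) monoid_scheme" (structure) +
  fixes S :: "'a list"
  assumes gens_closed: "set S \<subseteq> carrier G"
    and gens_generate: "generate G (set S) = carrier G"
begin

abbreviation letters :: "'a set" where
  "letters \<equiv> set S \<union> (\<lambda>s. inv s) ` set S"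

abbreviation word_value :: "'a list \<Rightarrow> 'a" where
  "word_value us \<equiv> foldr (\<lambda>u v. u \<otimes> v) us \<one>"

abbreviation len :: "'a \<Rightarrow> nat" where
  "len \<equiv> word_length G S"

definition ball :: "nat \<Rightarrow> 'a set" where
  "ball n = {g \<in> carrier G. len g \<le> n}"

lemma letters_closed: "letters \<subseteq> carrier G"
  using gens_closed by auto

lemma inv_letters: "u \<in> letters \<Longrightarrow> inv u \<in> letters"
  using gens_closed by (auto simp: subset_iff)

lemma inv_word_letters: "set us \<subseteq> letters \<Longrightarrow> set (rev (map (\<lambda>u. inv u) us)) \<subseteq> letters"
  using inv_letters by (simp only: set_rev set_map) blast

lemma word_value_closed: "set us \<subseteq> letters \<Longrightarrow> word_value us \<in> carrier G"
  using letters_closed by (induction us) auto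

lemma word_value_append:
  assumes "set us \<subseteq> letters" "set vs \<subseteq> letters"
  shows "word_value (us @ vs) = word_value us \<otimes> word_value vs"
  using assms
proof (induction us)
  case Nil
  then show ?case using word_value_closed[of vs] by simp
next
  case (Cons u us)
  then show ?case
    using word_value_closed[of us] word_value_closed[of vs] letters_closed
    by (auto simp: m_assoc subset_iff)
qed

lemma word_value_inv:
  assumes "set us \<subseteq> letters"
  shows "inv (word_value us) = word_value (rev (map (\<lambda>u. inv u) us))"
  using assms
proof (induction us)
  case (Cons u us)
  have "u \<in> carrier G" "word_value us \<in> carrier G"
    using Cons.prems letters_closed word_value_closed[of us] by auto
  moreover have "set (rev (map (\<lambda>u. inv u) us)) \<subseteq> letters"
    using Cons.prems inv_word_letters[of us] by simp
  moreover have "set [inv u] \<subseteq> letters"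
    using Cons.prems inv_letters[of u] by auto
  ultimately have "word_value (rev (map (\<lambda>u. inv u) us) @ [inv u]) = word_value (rev (map (\<lambda>u. inv u) us)) \<otimes> word_value [inv u]"
    by (intro word_value_append)
  then show ?case
    using Cons \<open>u \<in> carrier G\<close> \<open>word_value us \<in> carrier G\<close> by (simp add: inv_mult_group del: foldr_append)
qed auto

lemma word_exists:
  assumes "g \<in> carrier G"
  shows "\<exists>us. set us \<subseteq> letters \<and> g = word_value us"
proof -
  have "g \<in> generate G (set S)" using assms gens_generate by simp
  then show ?thesis
  proof (induction rule: generate.induct)
    case one
    show ?case by (intro exI[of _ "[]"]) auto
  next
    case (incl h)
    then show ?case using gens_closed by (intro exI[of _ "[h]"]) auto
  next
    case (inv h)
    then show ?case using gens_closed by (intro exI[of _ "[inv h]"]) auto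
  next
    case (eng h1 h2)
    then obtain us vs where "set us \<subseteq> letters" "h1 = word_value us" "set vs \<subseteq> letters" "h2 = word_value vs"
      by blast
    then show ?case
      by (intro exI[of _ "us @ vs"]) (simp add: word_value_append del: foldr_append)
  qed
qed

lemma shortest_word:
  assumes "g \<in> carrier G"
  obtains us where "length us = len g" "set us \<subseteq> letters" "g = word_value us"
proof -
  from word_exists[OF assms] obtain us where us: "set us \<subseteq> letters" "g = word_value us" by blast
  let ?P = "\<lambda>m. \<exists>us. length us = m \<and> set us \<subseteq> letters \<and> g = word_value us"
  have "?P (length us)" using us by blast
  then have "?P (len g)" unfolding word_length_def by (rule LeastI)
  then show ?thesis using that by blast
qed

lemma len_word_value_le:
  assumes "set us \<subseteq> letters"
  shows "len (word_value us) \<le> length us"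
  unfolding word_length_def by (rule Least_le) (use assms in auto)

lemma len_one [simp]: "len \<one> = 0"
  using len_word_value_le[of "[]"] by simp

lemma len_eq_0_iff: "g \<in> carrier G \<Longrightarrow> len g = 0 \<longleftrightarrow> g = \<one>"
  by (metis foldr.simps(1) id_apply len_one length_0_conv shortest_word)

lemma len_mult:
  assumes "g \<in> carrier G" "h \<in> carrier G"
  shows "len (g \<otimes> h) \<le> len g + len h"
proof -
  obtain us where us: "length us = len g" "set us \<subseteq> letters" "g = word_value us"
    using shortest_word assms by blast
  obtain vs where vs: "length vs = len h" "set vs \<subseteq> letters" "h = word_value vs"
    using shortest_word assms by blast
  show ?thesis
    using len_word_value_le[of "us @ vs"] us vs by (simp add: word_value_append del: foldr_append)
qed

lemma len_inv_le: "g \<in> carrier G \<Longrightarrow> len (inv g) \<le> len g"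
proof -
  assume g: "g \<in> carrier G"
  obtain us where us: "length us = len g" "set us \<subseteq> letters" "g = word_value us"
    using shortest_word g by blast
  have "set (rev (map (\<lambda>u. inv u) us)) \<subseteq> letters" using us inv_word_letters by blast
  from len_word_value_le[OF this] show ?thesis
    using us word_value_inv[OF us(2)] by simp
qed

lemma len_inv [simp]: "g \<in> carrier G \<Longrightarrow> len (inv g) = len g"
  using len_inv_le[of g] len_inv_le[of "inv g"] by auto

lemma group_norm_len: "group_norm G (word_norm G S)"
  unfolding group_norm_def using len_eq_0_iff len_mult
  by (auto simp flip: of_nat_add)

lemma len_mult_ge:
  assumes "g \<in> carrier G" "h \<in> carrier G"
  shows "len g \<le> len (g \<otimes> h) + len h" "len h \<le> len (g \<otimes> h) + len g"
proof -
  have "g = (g \<otimes> h) \<otimes> inv h" "h = inv g \<otimes> (g \<otimes> h)"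
    using assms by (auto simp: m_assoc simp flip: m_assoc[of "inv g"])
  then show "len g \<le> len (g \<otimes> h) + len h" "len h \<le> len (g \<otimes> h) + len g"
    using len_mult[of "g \<otimes> h" "inv h"] len_mult[of "inv g" "g \<otimes> h"] assms by auto
qed

text \<open>Cutting a shortest word leaves two shortest words, so the word metric is a geodesic one.\<close>

lemma geodesic_split:
  assumes g: "g \<in> carrier G" and n: "n \<le> len g"
  obtains a b where "a \<in> carrier G" "b \<in> carrier G" "g = a \<otimes> b" "len a = n" "len b = len g - n"
proof -
  obtain us where us: "length us = len g" "set us \<subseteq> letters" "g = word_value us"
    using shortest_word g by blast
  define a b where "a = word_value (take n us)" and "b = word_value (drop n us)"
  have l: "set (take n us) \<subseteq> letters" "set (drop n us) \<subseteq> letters"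
    using us(2) set_take_subset[of n us] set_drop_subset[of n us] by blast+
  then have c: "a \<in> carrier G" "b \<in> carrier G" and ab: "g = a \<otimes> b"
    unfolding a_def b_def using word_value_closed us(3) by (auto simp flip: word_value_append)
  have "len a \<le> n" "len b \<le> len g - n"
    unfolding a_def b_def using len_word_value_le[OF l(1)] len_word_value_le[OF l(2)] us n by auto
  moreover have "len g \<le> len a + len b" using len_mult c ab by blast
  ultimately show ?thesis using that[OF c ab] n by auto
qed

lemma geodesic_split_le:
  assumes g: "g \<in> carrier G" and n: "len g \<le> m + n"
  obtains a b where "a \<in> carrier G" "b \<in> carrier G" "g = a \<otimes> b" "len a \<le> m" "len b \<le> n"
proof -
  have "min m (len g) \<le> len g" by simp
  from geodesic_split[OF g this] obtain a b
    where ab: "a \<in> carrier G" "b \<in> carrier G" "g = a \<otimes> b" "len a = min m (len g)" "len b = len g - min m (len g)"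
    by metis
  show ?thesis by (rule that[OF ab(1-3)]) (use ab(4,5) n in auto)
qed

lemma finite_ball: "finite (ball n)"
proof -
  have "ball n \<subseteq> word_value ` {us. set us \<subseteq> letters \<and> length us \<le> n}"
  proof
    fix g assume "g \<in> ball n"
    then have "g \<in> carrier G" "len g \<le> n" by (auto simp: ball_def)
    then show "g \<in> word_value ` {us. set us \<subseteq> letters \<and> length us \<le> n}"
      using shortest_word[of g] by (metis (mono_tags, lifting) image_eqI mem_Collect_eq)
  qed
  moreover have "finite {us. set us \<subseteq> letters \<and> length us \<le> n}"
    by (rule finite_lists_length_le) auto
  ultimately show ?thesis using finite_surj by blast
qed

lemma ball_subset_carrier: "ball n \<subseteq> carrier G"
  by (auto simp: ball_def)

lemma ball_mono: "m \<le> n \<Longrightarrow> ball m \<subseteq> ball n"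
  by (auto simp: ball_def)

lemma one_in_ball [simp]: "\<one> \<in> ball n"
  by (auto simp: ball_def)

lemma carrier_eq_Union_balls: "carrier G = (\<Union>n. ball n)"
  by (auto simp: ball_def)

lemma countable_carrier: "countable (carrier G)"
  unfolding carrier_eq_Union_balls using finite_ball by (auto intro: countable_finite)

lemma length_attained:
  assumes "infinite (carrier G)"
  obtains g where "g \<in> carrier G" "len g = n"
proof -
  have "\<not> carrier G \<subseteq> ball n" using assms finite_ball finite_subset by blast
  then obtain h where h: "h \<in> carrier G" "n \<le> len h" by (force simp: ball_def)
  then show ?thesis using geodesic_split that by metis
qed

abbreviation vol :: "real \<Rightarrow> real" where
  "vol \<equiv> volume G (word_norm G S)"

lemma vol_eq_card_ball: "0 \<le> t \<Longrightarrow> vol t = real (card (ball (nat \<lfloor>t\<rfloor>)))"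
  unfolding volume_def ball_def by (intro arg_cong[where f = "\<lambda>A. real (card A)"]) (auto simp: le_nat_floor le_nat_iff le_floor_iff)

lemma vol_of_nat: "vol (real n) = real (card (ball n))"
  by (simp add: vol_eq_card_ball)

lemma vol_mono: "s \<le> t \<Longrightarrow> vol s \<le> vol t"
proof (cases "0 \<le> s")
  case True
  assume "s \<le> t"
  then have "ball (nat \<lfloor>s\<rfloor>) \<subseteq> ball (nat \<lfloor>t\<rfloor>)" by (intro ball_mono) (simp add: floor_mono nat_mono)
  then show ?thesis using True \<open>s \<le> t\<close> by (simp add: vol_eq_card_ball card_mono finite_ball)
next
  case False
  then have "\<not> word_norm G S g \<le> s" for g using of_nat_0_le_iff[of "len g", where 'a = real] by linarith
  then have "vol s = 0" by (simp add: volume_def)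
  then show ?thesis by (simp add: volume_def)
qed

lemma vol_ge_1: "0 \<le> t \<Longrightarrow> 1 \<le> vol t"
proof -
  assume "0 \<le> t"
  moreover have "card (ball (nat \<lfloor>t\<rfloor>)) \<ge> 1"
    using finite_ball one_in_ball by (metis One_nat_def Suc_leI card_gt_0_iff empty_iff)
  ultimately show ?thesis by (simp add: vol_eq_card_ball)
qed

lemma vol_pos: "0 \<le> t \<Longrightarrow> 0 < vol t"
  using vol_ge_1[of t] by linarith

end

section \<open>Convolution powers and the defect of positive definiteness\<close>

lemma finite_sum_le_expectation:
  fixes f :: "'a \<Rightarrow> real"
  assumes "finite F" "\<And>x. 0 \<le> f x" "\<And>x. f x \<le> B"
  shows "(\<Sum>x\<in>F. pmf \<mu> x * f x) \<le> measure_pmf.expectation \<mu> f"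
proof -
  have "(\<Sum>x\<in>F. pmf \<mu> x * f x) = measure_pmf.expectation \<mu> (\<lambda>x. f x * indicator F x)"
    by (subst integral_measure_pmf_real[where A = F]) (use assms(1) in \<open>auto intro!: sum.cong simp: indicator_def split: if_splits\<close>)
  also have "\<dots> \<le> measure_pmf.expectation \<mu> f"
    using assms(2,3)
    by (intro integral_mono measure_pmf.integrable_const_bound[where B = B])
       (auto simp: indicator_def intro: order.trans[OF assms(2,3)])
  finally show ?thesis .
qed

locale symmetric_walk = group G for G :: "('a, 'b) monoid_scheme" (structure) +
  fixes \<nu> :: "'a pmf"
  assumes symmetric: "symmetric_measure G \<nu>"
begin

abbreviation p :: "nat \<Rightarrow> 'a \<Rightarrow> real" where
  "p n g \<equiv> pmf (conv_power G \<nu> n) g"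

lemma support: "set_pmf \<nu> \<subseteq> carrier G"
  and pmf_inv: "g \<in> carrier G \<Longrightarrow> pmf \<nu> (inv g) = pmf \<nu> g"
  using symmetric by (auto simp: symmetric_measure_def)

text \<open>Products of independent elements in monadic form; associativity and the behaviour under
  inversion then reduce to the laws of \<open>bind_pmf\<close> and to group identities on the supports.\<close>

lemma convolution_bind:
  "convolution G \<mu> \<eta> = bind_pmf \<mu> (\<lambda>x. map_pmf (\<lambda>y. x \<otimes> y) \<eta>)"
  by (simp add: convolution_def pair_pmf_def map_bind_pmf map_pmf_def bind_assoc_pmf bind_return_pmf)

lemma convolution_support:
  "set_pmf \<mu> \<subseteq> carrier G \<Longrightarrow> set_pmf \<eta> \<subseteq> carrier G \<Longrightarrow> set_pmf (convolution G \<mu> \<eta>) \<subseteq> carrier G"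
  by (auto simp: convolution_bind)

lemma conv_power_support: "set_pmf (conv_power G \<nu> n) \<subseteq> carrier G"
  by (induction n) (use convolution_support support in auto)

lemma p_outside: "g \<notin> carrier G \<Longrightarrow> p n g = 0"
  using conv_power_support[of n] by (auto simp: pmf_eq_0_set_pmf)

lemma convolution_assoc:
  assumes "set_pmf \<mu> \<subseteq> carrier G" "set_pmf \<eta> \<subseteq> carrier G" "set_pmf \<theta> \<subseteq> carrier G"
  shows "convolution G (convolution G \<mu> \<eta>) \<theta> = convolution G \<mu> (convolution G \<eta> \<theta>)"
proof -
  have "convolution G (convolution G \<mu> \<eta>) \<theta> =
      bind_pmf \<mu> (\<lambda>x. bind_pmf \<eta> (\<lambda>y. map_pmf (\<lambda>z. (x \<otimes> y) \<otimes> z) \<theta>))"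
    by (simp add: convolution_bind bind_assoc_pmf bind_map_pmf)
  also have "\<dots> = bind_pmf \<mu> (\<lambda>x. bind_pmf \<eta> (\<lambda>y. map_pmf (\<lambda>z. x \<otimes> (y \<otimes> z)) \<theta>))"
    by (intro bind_pmf_cong map_pmf_cong refl m_assoc) (use assms in auto)
  also have "\<dots> = convolution G \<mu> (convolution G \<eta> \<theta>)"
    by (simp add: convolution_bind map_bind_pmf map_pmf_comp)
  finally show ?thesis .
qed

lemma convolution_one_left:
  "set_pmf \<mu> \<subseteq> carrier G \<Longrightarrow> convolution G (return_pmf \<one>) \<mu> = \<mu>"
  using map_pmf_cong[of \<mu> \<mu> "\<lambda>y. \<one> \<otimes> y" "\<lambda>y. y"]
  by (auto simp: convolution_bind bind_return_pmf subset_iff)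

lemma convolution_one_step [simp]: "convolution G (return_pmf \<one>) \<nu> = \<nu>"
  using convolution_one_left support by blast

lemma convolution_one_right:
  "set_pmf \<mu> \<subseteq> carrier G \<Longrightarrow> convolution G \<mu> (return_pmf \<one>) = \<mu>"
  using bind_pmf_cong[of \<mu> \<mu> "\<lambda>x. return_pmf (x \<otimes> \<one>)" return_pmf]
  by (auto simp: convolution_bind bind_return_pmf' subset_iff)

lemma conv_power_add:
  "conv_power G \<nu> (m + n) = convolution G (conv_power G \<nu> m) (conv_power G \<nu> n)"
proof (induction n)
  case 0
  then show ?case using convolution_one_right conv_power_support by simp
next
  case (Suc n)
  then show ?case
    using convolution_assoc conv_power_support support by simp
qed

lemma conv_power_1: "conv_power G \<nu> 1 = \<nu>"
  using convolution_one_left support by simp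

lemma conv_power_Suc_left: "conv_power G \<nu> (Suc n) = convolution G \<nu> (conv_power G \<nu> n)"
  using conv_power_add[of 1 n] conv_power_1 by simp

lemma p_1: "p (Suc 0) g = pmf \<nu> g"
  using conv_power_1 by simp

lemma pmf_convolution:
  assumes "set_pmf \<mu> \<subseteq> carrier G" "set_pmf \<eta> \<subseteq> carrier G" "g \<in> carrier G"
  shows "pmf (convolution G \<mu> \<eta>) g = measure_pmf.expectation \<mu> (\<lambda>x. pmf \<eta> (inv x \<otimes> g))"
proof -
  have "pmf (map_pmf (\<lambda>y. x \<otimes> y) \<eta>) g = pmf \<eta> (inv x \<otimes> g)" if x: "x \<in> set_pmf \<mu>" for x
  proof -
    have xc: "x \<in> carrier G" using x assms by auto
    have inj: "inj_on (\<lambda>y. x \<otimes> y) (carrier G)" using xc by (auto intro!: inj_onI)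
    have eq: "g = x \<otimes> (inv x \<otimes> g)" using xc assms by (simp flip: m_assoc)
    show ?thesis
    proof (cases "inv x \<otimes> g \<in> set_pmf \<eta>")
      case True
      then show ?thesis
        using pmf_map_inj[of "\<lambda>y. x \<otimes> y" \<eta> "inv x \<otimes> g"] eq inj_on_subset[OF inj assms(2)] by simp
    next
      case False
      have "g \<notin> (\<lambda>y. x \<otimes> y) ` set_pmf \<eta>"
      proof
        assume "g \<in> (\<lambda>y. x \<otimes> y) ` set_pmf \<eta>"
        then obtain y where y: "y \<in> set_pmf \<eta>" "g = x \<otimes> y" by auto
        then have "inv x \<otimes> g = y" using xc assms(2) by (auto simp flip: m_assoc)
        then show False using y False by simp
      qed
      then show ?thesis using False by (simp add: pmf_map_outside pmf_eq_0_set_pmf)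
    qed
  qed
  then show ?thesis
    unfolding convolution_bind pmf_bind
    by (intro integral_cong_AE) (auto simp: AE_measure_pmf_iff)
qed

lemma p_add:
  assumes "g \<in> carrier G"
  shows "p (m + n) g = measure_pmf.expectation (conv_power G \<nu> m) (\<lambda>x. p n (inv x \<otimes> g))"
  unfolding conv_power_add using pmf_convolution conv_power_support assms by blast

lemma map_inv_convolution:
  assumes "set_pmf \<mu> \<subseteq> carrier G" "set_pmf \<eta> \<subseteq> carrier G"
  shows "map_pmf (\<lambda>x. inv x) (convolution G \<mu> \<eta>) =
         convolution G (map_pmf (\<lambda>x. inv x) \<eta>) (map_pmf (\<lambda>x. inv x) \<mu>)"
proof -
  have "map_pmf (\<lambda>x. inv x) (convolution G \<mu> \<eta>) = bind_pmf \<mu> (\<lambda>x. bind_pmf \<eta> (\<lambda>y. return_pmf (inv (x \<otimes> y))))"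
    by (simp add: convolution_bind map_bind_pmf map_pmf_comp) (simp add: map_pmf_def)
  also have "\<dots> = bind_pmf \<mu> (\<lambda>x. bind_pmf \<eta> (\<lambda>y. return_pmf (inv y \<otimes> inv x)))"
    by (intro bind_pmf_cong arg_cong[where f = return_pmf] refl inv_mult_group) (use assms in auto)
  also have "\<dots> = bind_pmf \<eta> (\<lambda>y. bind_pmf \<mu> (\<lambda>x. return_pmf (inv y \<otimes> inv x)))"
    by (rule bind_commute_pmf)
  also have "\<dots> = convolution G (map_pmf (\<lambda>x. inv x) \<eta>) (map_pmf (\<lambda>x. inv x) \<mu>)"
    by (simp add: convolution_bind bind_map_pmf map_pmf_comp) (simp add: map_pmf_def)
  finally show ?thesis .
qed

lemma pmf_map_inv:
  assumes "set_pmf \<mu> \<subseteq> carrier G" "g \<in> carrier G"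
  shows "pmf (map_pmf (\<lambda>x. inv x) \<mu>) g = pmf \<mu> (inv g)"
proof (cases "inv g \<in> set_pmf \<mu>")
  case True
  have "inj_on (\<lambda>x. inv x) (set_pmf \<mu>)" by (rule inj_on_subset[OF inv_inj assms(1)])
  from pmf_map_inj[OF this True] show ?thesis using assms by simp
next
  case False
  moreover have "inv (inv x) = x" if "x \<in> set_pmf \<mu>" for x using that assms(1) by auto
  ultimately have "g \<notin> (\<lambda>x. inv x) ` set_pmf \<mu>" by (metis imageE)
  with False show ?thesis by (simp add: pmf_map_outside pmf_eq_0_set_pmf)
qed

lemma map_inv_step: "map_pmf (\<lambda>x. inv x) \<nu> = \<nu>"
proof (rule pmf_eqI)
  fix g
  show "pmf (map_pmf (\<lambda>x. inv x) \<nu>) g = pmf \<nu> g"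
  proof (cases "g \<in> carrier G")
    case True
    then show ?thesis using pmf_map_inv[OF support] pmf_inv by simp
  next
    case False
    then have "g \<notin> (\<lambda>x. inv x) ` set_pmf \<nu>" "g \<notin> set_pmf \<nu>" using support by auto
    then show ?thesis by (simp add: pmf_map_outside pmf_eq_0_set_pmf)
  qed
qed

lemma p_inv:
  assumes "g \<in> carrier G"
  shows "p n (inv g) = p n g"
proof -
  have "map_pmf (\<lambda>x. inv x) (conv_power G \<nu> n) = conv_power G \<nu> n"
  proof (induction n)
    case (Suc n)
    have "map_pmf (\<lambda>x. inv x) (conv_power G \<nu> (Suc n)) = convolution G \<nu> (conv_power G \<nu> n)"
      by (simp only: conv_power.simps map_inv_convolution[OF conv_power_support support] Suc map_inv_step)
    then show ?case by (simp only: conv_power_Suc_left)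
  qed simp
  then show ?thesis using pmf_map_inv[OF conv_power_support assms] by metis
qed

lemma p_bounds: "0 \<le> p n g" "p n g \<le> 1"
  by (auto simp: pmf_le_1)

text \<open>Sums over the group are Bochner integrals for the counting measure on the carrier.\<close>

abbreviation cnt :: "'a measure" where
  "cnt \<equiv> count_space (carrier G)"

lemma expectation_eq_count_integral:
  fixes f :: "'a \<Rightarrow> real"
  shows "measure_pmf.expectation (conv_power G \<nu> n) f = (\<integral>x. p n x * f x \<partial>cnt)"
proof -
  have "measure_pmf.expectation (conv_power G \<nu> n) f = (\<integral>x. p n x * f x \<partial>count_space UNIV)"
    by (subst measure_pmf_eq_density, subst integral_density) auto
  also have "\<dots> = (\<integral>x. indicator (carrier G) x *\<^sub>R (p n x * f x) \<partial>count_space UNIV)"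
    by (intro Bochner_Integration.integral_cong) (auto simp: indicator_def p_outside)
  also have "\<dots> = (\<integral>x. p n x * f x \<partial>cnt)"
    by (subst integral_restrict_space[symmetric]) (auto simp: restrict_count_space)
  finally show ?thesis .
qed

lemma bij_right_mult: "g \<in> carrier G \<Longrightarrow> bij_betw (\<lambda>x. x \<otimes> g) (carrier G) (carrier G)"
  by (rule bij_betwI[where g = "\<lambda>x. x \<otimes> inv g"]) (simp_all add: m_assoc)

lemma bij_mult_inv: "z \<in> carrier G \<Longrightarrow> bij_betw (\<lambda>y. z \<otimes> inv y) (carrier G) (carrier G)"
proof (rule bij_betwI[where g = "\<lambda>x. inv x \<otimes> z"])
  assume z: "z \<in> carrier G"
  show "inv (z \<otimes> inv y) \<otimes> z = y" if "y \<in> carrier G" for y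
    using z that by (simp add: inv_mult_group m_assoc)
  show "z \<otimes> inv (inv x \<otimes> z) = x" if "x \<in> carrier G" for x
    using z that m_assoc[of z "inv z" x] by (simp add: inv_mult_group)
qed auto

lemma integrable_bounded_mult:
  fixes f h :: "'a \<Rightarrow> real"
  assumes "integrable M f" "\<And>x. \<bar>f x\<bar> \<le> 1" "h \<in> borel_measurable M" "\<And>x. \<bar>h x\<bar> \<le> 1"
  shows "integrable M (\<lambda>x. h x * f x)"
proof (rule Bochner_Integration.integrable_bound[OF assms(1)])
  show "AE x in M. norm (h x * f x) \<le> norm (f x)"
    using mult_left_le_one_le[OF abs_ge_zero abs_ge_zero assms(4)] by (simp add: abs_mult)
qed (use assms in auto)

lemma integrable_p_bij:
  assumes "bij_betw \<sigma> (carrier G) (carrier G)"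
  shows "integrable cnt (\<lambda>x. p n (\<sigma> x))"
  using integrable_bij_count_space[OF assms, of "p n"] integrable_pmf by blast

lemma integrable_p_prod:
  assumes "bij_betw \<sigma> (carrier G) (carrier G)"
  shows "integrable cnt (\<lambda>x. p n (\<tau> x) * p n (\<sigma> x))"
  using p_bounds by (intro integrable_bounded_mult integrable_p_bij assms) auto

text \<open>Substituting \<open>x = zy\<^sup>-\<^sup>1\<close> in the convolution \<open>p\<^sub>2\<^sub>n(zg) = \<Sum>\<^sub>x p\<^sub>n(x) p\<^sub>n(x\<^sup>-\<^sup>1zg)\<close> lets \<open>g\<close> act by right
  translation only; for \<open>z = \<one>\<close> symmetry turns this into the inner product of \<open>p\<^sub>n\<close> with its
  translate.\<close>

lemma autocorrelation:
  assumes "z \<in> carrier G" "g \<in> carrier G"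
  shows "p (2 * n) (z \<otimes> g) = (\<integral>y. p n (z \<otimes> inv y) * p n (y \<otimes> g) \<partial>cnt)"
proof -
  have "p (2 * n) (z \<otimes> g) = (\<integral>x. p n x * p n (inv x \<otimes> (z \<otimes> g)) \<partial>cnt)"
    using assms p_add[of "z \<otimes> g" n n] by (simp add: mult_2 expectation_eq_count_integral)
  also have "\<dots> = (\<integral>y. p n (z \<otimes> inv y) * p n (inv (z \<otimes> inv y) \<otimes> (z \<otimes> g)) \<partial>cnt)"
    by (rule integral_bij_count_space[OF bij_mult_inv[OF assms(1)], symmetric])
  also have "\<dots> = (\<integral>y. p n (z \<otimes> inv y) * p n (y \<otimes> g) \<partial>cnt)"
  proof (intro Bochner_Integration.integral_cong refl)
    fix y assume "y \<in> space cnt"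
    then have y: "y \<in> carrier G" by simp
    have "inv (z \<otimes> inv y) \<otimes> (z \<otimes> g) = y \<otimes> (inv z \<otimes> (z \<otimes> g))"
      using assms y by (simp add: inv_mult_group m_assoc)
    also have "inv z \<otimes> (z \<otimes> g) = g" using assms by (simp flip: m_assoc)
    finally show "p n (z \<otimes> inv y) * p n (inv (z \<otimes> inv y) \<otimes> (z \<otimes> g)) = p n (z \<otimes> inv y) * p n (y \<otimes> g)"
      by simp
  qed
  finally show ?thesis .
qed

lemma autocorrelation_one:
  assumes "g \<in> carrier G"
  shows "p (2 * n) g = (\<integral>y. p n y * p n (y \<otimes> g) \<partial>cnt)"
proof -
  have "p (2 * n) g = (\<integral>y. p n (\<one> \<otimes> inv y) * p n (y \<otimes> g) \<partial>cnt)"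
    using autocorrelation[of \<one> g n] assms by simp
  also have "\<dots> = (\<integral>y. p n y * p n (y \<otimes> g) \<partial>cnt)"
    by (rule Bochner_Integration.integral_cong) (simp_all add: p_inv)
  finally show ?thesis .
qed

lemma sum_of_squares_bij:
  assumes "bij_betw \<sigma> (carrier G) (carrier G)"
  shows "(\<integral>y. p n (\<sigma> y) * p n (\<sigma> y) \<partial>cnt) = p (2 * n) \<one>"
proof -
  have "(\<integral>y. p n (\<sigma> y) * p n (\<sigma> y) \<partial>cnt) = (\<integral>y. p n y * p n y \<partial>cnt)"
    by (rule integral_bij_count_space[OF assms])
  also have "\<dots> = (\<integral>y. p n y * p n (y \<otimes> \<one>) \<partial>cnt)"
    by (rule Bochner_Integration.integral_cong) simp_all
  finally show ?thesis by (simp add: autocorrelation_one)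
qed

definition defect :: "nat \<Rightarrow> 'a \<Rightarrow> real" where
  "defect n g = p (2 * n) \<one> - p (2 * n) g"

lemma bij_id: "bij_betw (\<lambda>x. x) (carrier G) (carrier G)"
  by (simp add: bij_betw_def)

lemma integrable_translate_diff:
  assumes "bij_betw \<sigma> (carrier G) (carrier G)" "bij_betw \<tau> (carrier G) (carrier G)"
  shows "integrable cnt (\<lambda>x. (p n (\<sigma> x) - p n (\<tau> x))\<^sup>2)"
proof -
  have "integrable cnt (\<lambda>x. p n (\<sigma> x) * p n (\<sigma> x) - 2 * (p n (\<sigma> x) * p n (\<tau> x)) + p n (\<tau> x) * p n (\<tau> x))"
    using integrable_p_prod[OF assms(1)] integrable_p_prod[OF assms(2)]
    by (intro Bochner_Integration.integrable_add Bochner_Integration.integrable_diff integrable_mult_right)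
  then show ?thesis by (simp add: power2_eq_square algebra_simps)
qed

text \<open>Half the squared \<open>\<ell>\<^sup>2\<close> norm of the increment of the density under right translation. This is
  where symmetry of the step distribution enters: it makes the walk operator self-adjoint.\<close>

lemma defect_eq:
  assumes "g \<in> carrier G"
  shows "2 * defect n g = (\<integral>x. (p n (x \<otimes> g) - p n x)\<^sup>2 \<partial>cnt)"
proof -
  let ?a = "\<lambda>x. p n (x \<otimes> g) * p n (x \<otimes> g)" and ?b = "\<lambda>x. p n x * p n x"
    and ?c = "\<lambda>x. p n x * p n (x \<otimes> g)"
  have i: "integrable cnt ?a" "integrable cnt ?b" "integrable cnt ?c"
    using integrable_p_prod[OF bij_right_mult[OF assms]] integrable_p_prod[OF bij_id] by auto
  have "(\<integral>x. (p n (x \<otimes> g) - p n x)\<^sup>2 \<partial>cnt) = (\<integral>x. ?a x + ?b x - 2 * ?c x \<partial>cnt)"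
    by (intro Bochner_Integration.integral_cong refl) (simp add: power2_eq_square algebra_simps)
  also have "\<dots> = p (2 * n) \<one> + p (2 * n) \<one> - 2 * p (2 * n) g"
    using i sum_of_squares_bij[OF bij_right_mult[OF assms], of n] sum_of_squares_bij[OF bij_id, of n]
      autocorrelation_one[OF assms, of n] by simp
  finally show ?thesis by (simp add: defect_def)
qed

lemma defect_nonneg: "g \<in> carrier G \<Longrightarrow> 0 \<le> defect n g"
proof -
  assume "g \<in> carrier G"
  then have "0 \<le> 2 * defect n g" by (simp only: defect_eq) (intro integral_nonneg_AE AE_I2, simp)
  then show ?thesis by simp
qed

lemma defect_one [simp]: "defect n \<one> = 0"
  by (simp add: defect_def)

text \<open>The square of the triangle inequality for the square root of the defect, in the form
  \<open>(a + b)\<^sup>2 \<le> (1 + t) a\<^sup>2 + (1 + 1/t) b\<^sup>2\<close>. Keeping the weight \<open>t\<close> free makes the defect grow no faster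
  than the square of the number of factors of a product.\<close>

lemma defect_mult:
  assumes g: "g \<in> carrier G" and h: "h \<in> carrier G" and t: "t > 0"
  shows "defect n (g \<otimes> h) \<le> (1 + t) * defect n g + (1 + 1 / t) * defect n h"
proof -
  have bij_g: "bij_betw (\<lambda>x. x \<otimes> g) (carrier G) (carrier G)" using bij_right_mult g .
  have bij_gh: "bij_betw (\<lambda>x. x \<otimes> g \<otimes> h) (carrier G) (carrier G)"
    using bij_betw_trans[OF bij_g bij_right_mult[OF h]] by (simp add: comp_def)
  have "2 * defect n (g \<otimes> h) = (\<integral>x. (p n (x \<otimes> g \<otimes> h) - p n x)\<^sup>2 \<partial>cnt)"
    unfolding defect_eq[OF m_closed[OF g h]] using g h
    by (intro Bochner_Integration.integral_cong refl) (simp add: m_assoc)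
  also have "\<dots> \<le> (\<integral>x. (1 + t) * (p n (x \<otimes> g) - p n x)\<^sup>2 +
        (1 + 1 / t) * (p n (x \<otimes> g \<otimes> h) - p n (x \<otimes> g))\<^sup>2 \<partial>cnt)"
  proof (intro integral_mono Bochner_Integration.integrable_add integrable_mult_right
      integrable_translate_diff bij_g bij_gh bij_id)
    fix x
    define a b where "a = p n (x \<otimes> g) - p n x" and "b = p n (x \<otimes> g \<otimes> h) - p n (x \<otimes> g)"
    have "0 \<le> (t * a - b)\<^sup>2 / t" using t by simp
    also have "\<dots> = t * a\<^sup>2 - 2 * a * b + b\<^sup>2 / t" using t by (simp add: power2_eq_square field_simps)
    finally have "(a + b)\<^sup>2 \<le> (1 + t) * a\<^sup>2 + (1 + 1 / t) * b\<^sup>2"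
      by (simp add: power2_eq_square algebra_simps)
    then show "(p n (x \<otimes> g \<otimes> h) - p n x)\<^sup>2 \<le> (1 + t) * (p n (x \<otimes> g) - p n x)\<^sup>2 +
        (1 + 1 / t) * (p n (x \<otimes> g \<otimes> h) - p n (x \<otimes> g))\<^sup>2"
      unfolding a_def b_def by simp
  qed
  also have "\<dots> = (1 + t) * (2 * defect n g) +
      (1 + 1 / t) * (\<integral>x. (p n (x \<otimes> g \<otimes> h) - p n (x \<otimes> g))\<^sup>2 \<partial>cnt)"
    unfolding defect_eq[OF g]
    by (subst Bochner_Integration.integral_add)
       (intro integrable_mult_right integrable_translate_diff bij_g bij_gh bij_id | simp)+
  also have "(\<integral>x. (p n (x \<otimes> g \<otimes> h) - p n (x \<otimes> g))\<^sup>2 \<partial>cnt) = 2 * defect n h"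
    unfolding defect_eq[OF h]
    by (rule integral_bij_count_space[OF bij_g, of "\<lambda>x. (p n (x \<otimes> h) - p n x)\<^sup>2"])
  finally show ?thesis by (simp add: algebra_simps)
qed

lemma p_even_le: "g \<in> carrier G \<Longrightarrow> p (2 * n) g \<le> p (2 * n) \<one>"
  using defect_nonneg[of g n] by (simp add: defect_def)

text \<open>The even-time density is largest at the identity, and convolution does not increase a
  maximum.\<close>

lemma p_le_return:
  assumes "g \<in> carrier G" "2 * n \<le> m"
  shows "p m g \<le> p (2 * n) \<one>"
proof -
  have "p m g = measure_pmf.expectation (conv_power G \<nu> (m - 2 * n)) (\<lambda>x. p (2 * n) (inv x \<otimes> g))"
    using assms p_add[of g "m - 2 * n" "2 * n"] by simp
  also have "\<dots> \<le> measure_pmf.expectation (conv_power G \<nu> (m - 2 * n)) (\<lambda>x. p (2 * n) \<one>)"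
    using conv_power_support[of "m - 2 * n"] assms(1) p_bounds
    by (intro integral_mono_AE measure_pmf.integrable_const_bound[where B = 1] AE_pmfI)
       (auto intro!: p_even_le)
  finally show ?thesis by simp
qed

text \<open>The Cauchy--Schwarz inequality in the form \<open>2ab \<le> ta\<^sup>2 + b\<^sup>2/t\<close>, applied to
  \<open>p\<^sub>2\<^sub>n(zg) - p\<^sub>2\<^sub>n(z) = \<Sum>\<^sub>y p\<^sub>n(zy\<^sup>-\<^sup>1) (p\<^sub>n(yg) - p\<^sub>n(y))\<close>. Further steps of the walk average
  this bound over \<open>z\<close>, hence do not spoil it.\<close>

lemma p_regularity_even:
  assumes z: "z \<in> carrier G" and g: "g \<in> carrier G" and t: "t > 0"
  shows "\<bar>p (2 * n) (z \<otimes> g) - p (2 * n) z\<bar> \<le> t / 2 * p (2 * n) \<one> + defect n g / t"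
proof -
  let ?a = "\<lambda>y. p n (z \<otimes> inv y)" and ?d = "\<lambda>y. p n (y \<otimes> g) - p n y"
  note bz = bij_mult_inv[OF z] and bg = bij_right_mult[OF g]
  have i1: "integrable cnt (\<lambda>y. ?a y * p n (y \<otimes> g))" and i2: "integrable cnt (\<lambda>y. ?a y * p n y)"
    using integrable_p_prod[OF bg] integrable_p_prod[OF bij_id] by auto
  have ia: "integrable cnt (\<lambda>y. ?a y * ?a y)" using integrable_p_prod[OF bz] .
  have id: "integrable cnt (\<lambda>y. (?d y)\<^sup>2)" using integrable_translate_diff[OF bg bij_id] .
  have "p (2 * n) z = (\<integral>y. ?a y * p n (y \<otimes> \<one>) \<partial>cnt)"
    using autocorrelation[OF z one_closed, of n] z by simp
  also have "\<dots> = (\<integral>y. ?a y * p n y \<partial>cnt)"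
    by (rule Bochner_Integration.integral_cong) simp_all
  finally have "p (2 * n) z = (\<integral>y. ?a y * p n y \<partial>cnt)" .
  then have "p (2 * n) (z \<otimes> g) - p (2 * n) z = (\<integral>y. ?a y * ?d y \<partial>cnt)"
    using i1 i2 unfolding autocorrelation[OF z g] by (simp add: right_diff_distrib)
  also have "\<bar>\<dots>\<bar> \<le> (\<integral>y. \<bar>?a y * ?d y\<bar> \<partial>cnt)"
    using integral_norm_bound[of cnt "\<lambda>y. ?a y * ?d y"] by simp
  also have "\<dots> \<le> (\<integral>y. t / 2 * (?a y * ?a y) + 1 / (2 * t) * (?d y)\<^sup>2 \<partial>cnt)"
  proof (intro integral_mono Bochner_Integration.integrable_add integrable_mult_right ia id integrable_abs)
    show "integrable cnt (\<lambda>y. ?a y * ?d y)" using i1 i2 by (simp add: right_diff_distrib)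
    fix y
    define a b where "a = ?a y" and "b = \<bar>?d y\<bar>"
    have "0 \<le> (t * a - b)\<^sup>2 / (2 * t)" using t by simp
    also have "\<dots> = t / 2 * (a * a) - a * b + 1 / (2 * t) * b\<^sup>2"
      using t by (simp add: power2_eq_square field_simps)
    finally show "\<bar>?a y * ?d y\<bar> \<le> t / 2 * (?a y * ?a y) + 1 / (2 * t) * (?d y)\<^sup>2"
      by (simp add: a_def b_def abs_mult)
  qed
  also have "\<dots> = t / 2 * p (2 * n) \<one> + 1 / (2 * t) * (2 * defect n g)"
    unfolding defect_eq[OF g] sum_of_squares_bij[OF bz, symmetric]
    by (subst Bochner_Integration.integral_add) (intro integrable_mult_right ia id | simp)+
  finally show ?thesis using t by simp
qed

lemma p_regularity:
  assumes g: "g \<in> carrier G" and t: "t > 0" and m: "2 * n \<le> m"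
  shows "\<bar>p m g - p m \<one>\<bar> \<le> t / 2 * p (2 * n) \<one> + defect n g / t"
proof -
  let ?\<mu> = "conv_power G \<nu> (m - 2 * n)" and ?B = "t / 2 * p (2 * n) \<one> + defect n g / t"
  have e: "p m h = measure_pmf.expectation ?\<mu> (\<lambda>x. p (2 * n) (inv x \<otimes> h))" if "h \<in> carrier G" for h
    using m p_add[OF that, of "m - 2 * n" "2 * n"] by simp
  have i: "integrable ?\<mu> (\<lambda>x. p (2 * n) (inv x \<otimes> h))" for h
    using p_bounds by (intro measure_pmf.integrable_const_bound[where B = 1]) auto
  have "p m g - p m \<one> = measure_pmf.expectation ?\<mu> (\<lambda>x. p (2 * n) (inv x \<otimes> g) - p (2 * n) (inv x \<otimes> \<one>))"
    unfolding e[OF g] e[OF one_closed] using i by simp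
  also have "\<bar>\<dots>\<bar> \<le> measure_pmf.expectation ?\<mu> (\<lambda>x. \<bar>p (2 * n) (inv x \<otimes> g) - p (2 * n) (inv x \<otimes> \<one>)\<bar>)"
    using integral_norm_bound[of ?\<mu> "\<lambda>x. p (2 * n) (inv x \<otimes> g) - p (2 * n) (inv x \<otimes> \<one>)"] by simp
  also have "\<dots> \<le> measure_pmf.expectation ?\<mu> (\<lambda>x. ?B)"
    using conv_power_support[of "m - 2 * n"] p_regularity_even[OF _ g t, of _ n] i
    by (intro integral_mono_AE integrable_abs Bochner_Integration.integrable_diff i AE_pmfI) auto
  finally show ?thesis by simp
qed

text \<open>The Dirichlet form of the walk at its own \<open>n\<close>-step density is a one-step decrement of the
  return probability.\<close>

lemma expectation_defect:
  "measure_pmf.expectation \<nu> (defect n) = p (2 * n) \<one> - p (Suc (2 * n)) \<one>"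
proof -
  have i: "integrable \<nu> (p (2 * n))"
    using p_bounds by (intro measure_pmf.integrable_const_bound[where B = 1]) auto
  have "p (Suc (2 * n)) \<one> = measure_pmf.expectation \<nu> (\<lambda>x. p (2 * n) (inv x \<otimes> \<one>))"
    unfolding conv_power_Suc_left by (rule pmf_convolution[OF support conv_power_support one_closed])
  also have "\<dots> = measure_pmf.expectation \<nu> (p (2 * n))"
    using support by (intro integral_cong_AE AE_pmfI) (auto simp: p_inv)
  finally show ?thesis unfolding defect_def using i by simp
qed

lemma finite_sum_defect_le:
  assumes "finite F" "F \<subseteq> carrier G"
  shows "(\<Sum>h\<in>F. pmf \<nu> h * defect n h) \<le> p (2 * n) \<one> - p (Suc (2 * n)) \<one>"
proof -
  let ?f = "\<lambda>h. if h \<in> carrier G then defect n h else 0"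
  have "(\<Sum>h\<in>F. pmf \<nu> h * defect n h) = (\<Sum>h\<in>F. pmf \<nu> h * ?f h)"
    using assms by (intro sum.cong) auto
  also have "\<dots> \<le> measure_pmf.expectation \<nu> ?f"
  proof (intro finite_sum_le_expectation[where B = 1] assms(1))
    fix h
    show "0 \<le> ?f h" using defect_nonneg by simp
    have "defect n h \<le> 1"
      using p_bounds[of "2 * n" \<one>] p_bounds[of "2 * n" h] unfolding defect_def by linarith
    then show "?f h \<le> 1" by simp
  qed
  also have "\<dots> = measure_pmf.expectation \<nu> (defect n)"
    using support by (intro integral_cong_AE AE_pmfI) auto
  finally show ?thesis by (simp add: expectation_defect)
qed

lemma p_add_ge_sum:
  assumes "finite F" "g \<in> carrier G"
  shows "(\<Sum>x\<in>F. p m x * p n (inv x \<otimes> g)) \<le> p (m + n) g"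
  unfolding p_add[OF assms(2)] using assms(1) p_bounds
  by (intro finite_sum_le_expectation[where B = 1]) auto

lemma p_add_ge: "g \<in> carrier G \<Longrightarrow> p m x * p n (inv x \<otimes> g) \<le> p (m + n) g"
  using p_add_ge_sum[of "{x}" g m n] by simp

text \<open>Staying put for \<open>j\<close> steps. This passes from even to odd times and from multiples of a given
  time to all later times.\<close>

lemma p_ge_lazy: "g \<in> carrier G \<Longrightarrow> pmf \<nu> \<one> ^ j * p m g \<le> p (m + j) g"
proof (induction j)
  case (Suc j)
  have "pmf \<nu> \<one> ^ Suc j * p m g \<le> pmf \<nu> \<one> * p (m + j) g"
    using mult_left_mono[OF Suc.IH[OF Suc.prems] pmf_nonneg[of \<nu> \<one>]] by (simp add: mult.assoc)
  also have "\<dots> \<le> p (1 + (m + j)) g"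
    using p_add_ge[OF Suc.prems, of 1 \<one> "m + j"] Suc.prems by (simp add: p_1)
  finally show ?case by simp
qed simp

text \<open>Two-step decrements govern the even times. A pair of steps dominates one step combined with
  staying put, so the one-step energy is controlled by the decrement between consecutive even times.\<close>

lemma two_step_decrement:
  "pmf \<nu> \<one> * (p (2 * n) \<one> - p (Suc (2 * n)) \<one>) \<le> p (2 * n) \<one> - p (2 * Suc n) \<one>"
proof -
  have i: "integrable (conv_power G \<nu> 2) (p (2 * n))"
    using p_bounds by (intro measure_pmf.integrable_const_bound[where B = 1]) auto
  have "p (2 * Suc n) \<one> = measure_pmf.expectation (conv_power G \<nu> 2) (\<lambda>x. p (2 * n) (inv x \<otimes> \<one>))"
    using p_add[OF one_closed, of 2 "2 * n"] by simp
  also have "\<dots> = measure_pmf.expectation (conv_power G \<nu> 2) (p (2 * n))"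
    using conv_power_support[of 2] by (intro integral_cong_AE AE_pmfI) (auto simp: p_inv)
  finally have "p (2 * n) \<one> - p (2 * Suc n) \<one> = measure_pmf.expectation (conv_power G \<nu> 2) (defect n)"
    unfolding defect_def using i by simp
  also have "\<dots> = (\<integral>x. p 2 x * defect n x \<partial>cnt)"
    by (rule expectation_eq_count_integral)
  also have "\<dots> \<ge> (\<integral>x. pmf \<nu> \<one> * (p 1 x * defect n x) \<partial>cnt)"
  proof (intro integral_mono)
    have "\<bar>defect n x\<bar> \<le> 1" for x using p_bounds[of "2 * n"] unfolding defect_def by (smt (verit))
    then have i: "integrable cnt (\<lambda>x. defect n x * p k x)" for k
      using p_bounds integrable_pmf by (intro integrable_bounded_mult) auto
    show "integrable cnt (\<lambda>x. p 2 x * defect n x)" "integrable cnt (\<lambda>x. pmf \<nu> \<one> * (p 1 x * defect n x))"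
      using i[of 2] i[of 1] by (auto simp: mult.commute)
    fix x assume "x \<in> space cnt"
    then have x: "x \<in> carrier G" by simp
    have "pmf \<nu> \<one> * p 1 x \<le> p 2 x"
      using p_ge_lazy[OF x, of 1 1] by (simp add: numeral_2_eq_2)
    from mult_right_mono[OF this defect_nonneg[OF x, of n]]
    show "pmf \<nu> \<one> * (p 1 x * defect n x) \<le> p 2 x * defect n x"
      by (simp add: mult.assoc)
  qed
  also have "(\<integral>x. pmf \<nu> \<one> * (p 1 x * defect n x) \<partial>cnt) = pmf \<nu> \<one> * measure_pmf.expectation \<nu> (defect n)"
    using expectation_eq_count_integral[of 1 "defect n"] by (simp only: conv_power_1 integral_mult_right_zero)
  finally show ?thesis by (simp add: expectation_defect)
qed

lemma sum_p_le_1: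
  assumes "finite F"
  shows "(\<Sum>x\<in>F. p n x) \<le> 1"
  using assms sum_pmf_eq_1 by (metis measure_measure_pmf_finite measure_pmf.prob_le_1)

end

section \<open>The path measure of the walk\<close>

locale word_walk = word_metric G S + symmetric_walk G \<nu>
  for G :: "('a, 'b) monoid_scheme" (structure) and S :: "'a list" and \<nu> :: "'a pmf"
begin

abbreviation step :: "'a measure" where
  "step \<equiv> restrict_space (measure_pmf \<nu>) (carrier G)"

abbreviation paths :: "(nat \<Rightarrow> 'a) measure" where
  "paths \<equiv> increments G \<nu>"

lemma space_step: "space step = carrier G"
  by (simp add: space_restrict_space)

lemma sets_step: "sets step = sets (count_space (carrier G))"
  by (auto simp: sets_restrict_space)

lemma emeasure_carrier: "emeasure (measure_pmf \<nu>) (carrier G) = 1"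
proof -
  have "AE h in measure_pmf \<nu>. h \<in> carrier G" using support by (auto intro: AE_pmfI)
  then show ?thesis using measure_pmf.emeasure_eq_1_AE[of "carrier G" \<nu>] by simp
qed

lemma prob_space_step: "prob_space step"
proof (rule prob_spaceI)
  have "emeasure step (carrier G) = emeasure (measure_pmf \<nu>) (carrier G)"
    by (rule emeasure_restrict_space) auto
  then show "emeasure step (space step) = 1"
    unfolding space_step emeasure_carrier .
qed

sublocale incr: sequence_space step
proof -
  interpret prob_space step by (rule prob_space_step)
  show "sequence_space step" by unfold_locales
qed

lemma paths_eq: "paths = PiM UNIV (\<lambda>_. step)"
  by (simp add: increments_def)

sublocale paths: prob_space paths
  unfolding paths_eq by (rule incr.prob_space_axioms)

lemma space_paths: "\<xi> \<in> space paths \<longleftrightarrow> (\<forall>n. \<xi> n \<in> carrier G)"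
  by (auto simp: paths_eq space_PiM space_step)

lemma walk_closed: "x \<in> carrier G \<Longrightarrow> \<xi> \<in> space paths \<Longrightarrow> walk G x \<xi> n \<in> carrier G"
  by (induction n) (auto simp: space_paths)

lemma walk_translate: "x \<in> carrier G \<Longrightarrow> \<xi> \<in> space paths \<Longrightarrow> walk G x \<xi> n = x \<otimes> walk G \<one> \<xi> n"
proof (induction n)
  case (Suc n)
  moreover have "\<xi> n \<in> carrier G" using Suc.prems by (simp add: space_paths)
  ultimately show ?case by (simp add: m_assoc walk_closed)
qed simp

lemma walk_shift: "walk G x (case_nat h \<xi>) (Suc n) = walk G (x \<otimes> h) \<xi> n"
  by (induction n) auto

text \<open>The group is countable, so a product of two measurable group-valued functions can be
  assembled from countably many pieces.\<close>

lemma walk_measurable: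
  assumes "x \<in> carrier G"
  shows "(\<lambda>\<xi>. walk G x \<xi> n) \<in> measurable paths (count_space (carrier G))"
proof (induction n)
  case 0
  then show ?case using assms by simp
next
  case (Suc n)
  have "(\<lambda>\<xi>. y \<otimes> \<xi> n) \<in> measurable paths (count_space (carrier G))" if y: "y \<in> carrier G" for y
  proof -
    have 1: "(\<lambda>\<xi>. \<xi> n) \<in> measurable paths step"
      unfolding paths_eq by (rule measurable_component_singleton) simp
    have "(\<lambda>h. y \<otimes> h) \<in> measurable (count_space (carrier G)) (count_space (carrier G))"
      using y by auto
    then have 2: "(\<lambda>h. y \<otimes> h) \<in> measurable step (count_space (carrier G))"
      by (subst measurable_cong_sets[OF sets_step refl])
    show ?thesis by (rule measurable_compose[OF 1 2])
  qed
  then have "(\<lambda>\<xi>. walk G x \<xi> n \<otimes> \<xi> n) \<in> measurable paths (count_space (carrier G))"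
    by (rule measurable_compose_countable'[OF _ Suc countable_carrier])
  then show ?case by simp
qed

text \<open>Time-dependent constraints cover both events needed below: remaining in a ball, with all sets
  equal, and the position at time \<open>n\<close>, with all sets but the last equal to the carrier.\<close>

definition stay_paths :: "nat \<Rightarrow> (nat \<Rightarrow> 'a set) \<Rightarrow> 'a \<Rightarrow> (nat \<Rightarrow> 'a) set" where
  "stay_paths n A x = {\<xi> \<in> space paths. \<forall>k\<le>n. walk G x \<xi> k \<in> A k}"

lemma stay_paths_sets: "x \<in> carrier G \<Longrightarrow> stay_paths n A x \<in> sets paths"
proof -
  assume x: "x \<in> carrier G"
  have "{\<xi> \<in> space paths. walk G x \<xi> k \<in> A k} \<in> sets paths" for k
  proof -
    have "{\<xi> \<in> space paths. walk G x \<xi> k \<in> A k} =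
        (\<lambda>\<xi>. walk G x \<xi> k) -` (A k \<inter> carrier G) \<inter> space paths"
      using walk_closed[OF x] by auto
    also have "\<dots> \<in> sets paths"
      by (rule measurable_sets[OF walk_measurable[OF x]]) simp
    finally show ?thesis .
  qed
  then have "(\<Inter>k\<in>{..n}. {\<xi> \<in> space paths. walk G x \<xi> k \<in> A k}) \<in> sets paths"
    by (intro sets.finite_INT) auto
  also have "(\<Inter>k\<in>{..n}. {\<xi> \<in> space paths. walk G x \<xi> k \<in> A k}) = stay_paths n A x"
    by (auto simp: stay_paths_def)
  finally show ?thesis .
qed

definition stay_prob :: "nat \<Rightarrow> (nat \<Rightarrow> 'a set) \<Rightarrow> 'a \<Rightarrow> real" where
  "stay_prob n A x = measure paths (stay_paths n A x)"

lemma stay_prob_bounds: "0 \<le> stay_prob n A x" "stay_prob n A x \<le> 1"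
  by (auto simp: stay_prob_def)

lemma stay_prob_0: "stay_prob 0 A x = indicator (A 0) x"
proof (cases "x \<in> A 0")
  case True
  then have "stay_paths 0 A x = space paths" by (auto simp: stay_paths_def)
  with True show ?thesis by (simp add: stay_prob_def paths.prob_space)
next
  case False
  then have "stay_paths 0 A x = {}" by (auto simp: stay_paths_def)
  with False show ?thesis by (simp add: stay_prob_def)
qed

lemma stay_prob_eq_0: "x \<notin> A 0 \<Longrightarrow> stay_prob n A x = 0"
proof -
  assume "x \<notin> A 0"
  then have "stay_paths n A x = {}" by (auto simp: stay_paths_def)
  then show ?thesis by (simp add: stay_prob_def)
qed

text \<open>Conditioning on the first increment; the remaining increments form a sequence with the
  same law.\<close>

lemma stay_prob_Suc:
  assumes x: "x \<in> carrier G" "x \<in> A 0"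
  shows "stay_prob (Suc n) A x = measure_pmf.expectation \<nu> (\<lambda>h. stay_prob n (\<lambda>k. A (Suc k)) (x \<otimes> h))"
proof -
  let ?A = "\<lambda>k. A (Suc k)" and ?c = "\<lambda>(h, \<xi>). case_nat h \<xi>"
  have meas: "?c \<in> measurable (step \<Otimes>\<^sub>M paths) paths"
    unfolding paths_eq
  proof (rule measurable_PiM_single')
    fix i :: nat
    show "(\<lambda>\<omega>. ?c \<omega> i) \<in> measurable (step \<Otimes>\<^sub>M PiM UNIV (\<lambda>_. step)) step"
      by (cases i) (simp_all add: split_beta')
  qed (auto simp: space_pair_measure space_PiM PiE_iff split: nat.split)
  have slice: "Pair h -` (?c -` stay_paths (Suc n) A x \<inter> space (step \<Otimes>\<^sub>M paths)) = stay_paths n ?A (x \<otimes> h)"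
    if h: "h \<in> carrier G" for h
  proof -
    have "case_nat h \<xi> \<in> stay_paths (Suc n) A x \<longleftrightarrow> \<xi> \<in> stay_paths n ?A (x \<otimes> h)" if "\<xi> \<in> space paths" for \<xi>
    proof -
      have "case_nat h \<xi> \<in> space paths"
        using that h by (auto simp: space_paths split: nat.split)
      moreover have "(\<forall>k\<le>Suc n. walk G x (case_nat h \<xi>) k \<in> A k) \<longleftrightarrow>
          (\<forall>k\<le>n. walk G x (case_nat h \<xi>) (Suc k) \<in> A (Suc k))"
        using x by (metis Suc_le_mono not0_implies_Suc walk.simps(1))
      ultimately show ?thesis
        using that by (simp only: stay_paths_def mem_Collect_eq walk_shift simp_thms)
    qed
    then show ?thesis using h by (auto simp: space_pair_measure space_step stay_paths_def[of n])
  qed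
  have "emeasure paths (stay_paths (Suc n) A x) = emeasure (distr (step \<Otimes>\<^sub>M paths) paths ?c) (stay_paths (Suc n) A x)"
    unfolding paths_eq incr.PiM_iter ..
  also have "\<dots> = emeasure (step \<Otimes>\<^sub>M paths) (?c -` stay_paths (Suc n) A x \<inter> space (step \<Otimes>\<^sub>M paths))"
    using stay_paths_sets x by (intro emeasure_distr[OF meas])
  also have "\<dots> = (\<integral>\<^sup>+h. emeasure paths (Pair h -` (?c -` stay_paths (Suc n) A x \<inter> space (step \<Otimes>\<^sub>M paths))) \<partial>step)"
    using meas stay_paths_sets x by (intro paths.emeasure_pair_measure_alt measurable_sets) auto
  also have "\<dots> = (\<integral>\<^sup>+h. ennreal (stay_prob n ?A (x \<otimes> h)) \<partial>step)"
    by (intro nn_integral_cong) (simp only: space_step slice stay_prob_def paths.emeasure_eq_measure)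
  also have "\<dots> = (\<integral>\<^sup>+h. ennreal (stay_prob n ?A (x \<otimes> h)) * indicator (carrier G) h \<partial>\<nu>)"
    by (subst nn_integral_restrict_space) auto
  also have "\<dots> = (\<integral>\<^sup>+h. ennreal (stay_prob n ?A (x \<otimes> h)) \<partial>\<nu>)"
    using support by (intro nn_integral_cong_AE AE_pmfI) auto
  also have "\<dots> = ennreal (measure_pmf.expectation \<nu> (\<lambda>h. stay_prob n ?A (x \<otimes> h)))"
    using stay_prob_bounds by (intro nn_integral_eq_integral measure_pmf.integrable_const_bound[where B = 1]) auto
  finally have "ennreal (stay_prob (Suc n) A x) = ennreal (measure_pmf.expectation \<nu> (\<lambda>h. stay_prob n ?A (x \<otimes> h)))"
    by (simp add: stay_prob_def paths.emeasure_eq_measure)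
  then show ?thesis
    using stay_prob_bounds by (subst (asm) ennreal_inj) (auto intro!: integral_nonneg_AE)
qed

text \<open>A function supported in a finite set turns the expectation over one step into a finite sum
  with the kernel \<open>\<nu>(x\<^sup>-\<^sup>1y)\<close>.\<close>

lemma expectation_shift:
  fixes f :: "'a \<Rightarrow> real"
  assumes "finite B" "B \<subseteq> carrier G" "x \<in> carrier G" "\<And>y. y \<in> carrier G \<Longrightarrow> y \<notin> B \<Longrightarrow> f y = 0"
  shows "measure_pmf.expectation \<nu> (\<lambda>h. f (x \<otimes> h)) = (\<Sum>y\<in>B. pmf \<nu> (inv x \<otimes> y) * f y)"
proof -
  have inj: "inj_on (\<lambda>y. inv x \<otimes> y) B"
    using assms by (auto intro!: inj_onI simp: subset_iff)
  have "measure_pmf.expectation \<nu> (\<lambda>h. f (x \<otimes> h)) =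
      (\<Sum>h\<in>(\<lambda>y. inv x \<otimes> y) ` B. f (x \<otimes> h) * pmf \<nu> h)"
  proof (rule integral_measure_pmf_real)
    fix h assume h: "h \<in> set_pmf \<nu>" "f (x \<otimes> h) \<noteq> 0"
    then have hc: "h \<in> carrier G" using support by auto
    then have "x \<otimes> h \<in> B" using assms h by blast
    moreover have "h = inv x \<otimes> (x \<otimes> h)" using hc assms by (simp flip: m_assoc)
    ultimately show "h \<in> (\<lambda>y. inv x \<otimes> y) ` B" by blast
  qed (use assms in auto)
  also have "\<dots> = (\<Sum>y\<in>B. f (x \<otimes> (inv x \<otimes> y)) * pmf \<nu> (inv x \<otimes> y))"
    by (simp add: sum.reindex[OF inj])
  also have "\<dots> = (\<Sum>y\<in>B. pmf \<nu> (inv x \<otimes> y) * f y)"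
  proof (intro sum.cong refl)
    fix y assume "y \<in> B"
    then have "x \<otimes> (inv x \<otimes> y) = y" using assms by (auto simp flip: m_assoc)
    then show "f (x \<otimes> (inv x \<otimes> y)) * pmf \<nu> (inv x \<otimes> y) = pmf \<nu> (inv x \<otimes> y) * f y" by simp
  qed
  finally show ?thesis .
qed

lemma stay_prob_const_Suc:
  assumes "finite B" "B \<subseteq> carrier G" "x \<in> B"
  shows "stay_prob (Suc n) (\<lambda>_. B) x = (\<Sum>y\<in>B. pmf \<nu> (inv x \<otimes> y) * stay_prob n (\<lambda>_. B) y)"
  using assms by (subst stay_prob_Suc) (auto intro!: expectation_shift stay_prob_eq_0)

lemma law_of_walk:
  assumes "finite F" "F \<subseteq> carrier G" "x \<in> carrier G"
  shows "stay_prob n (\<lambda>k. if k = n then F else carrier G) x = (\<Sum>y\<in>F. p n (inv x \<otimes> y))"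
  using assms(3)
proof (induction n arbitrary: x)
  case 0
  have "p 0 (inv x \<otimes> y) = (if y = x then 1 else 0)" if "y \<in> F" for y
  proof -
    have "\<one> = inv x \<otimes> y \<longleftrightarrow> y = x"
      using that assms 0 by (metis inv_closed inv_equality inv_inv l_inv subsetD)
    then show ?thesis by (simp only: conv_power.simps pmf_return indicator_def singleton_iff of_bool_def if_distrib) auto
  qed
  then have "(\<Sum>y\<in>F. p 0 (inv x \<otimes> y)) = (\<Sum>y\<in>F. if y = x then 1 else 0)"
    by (intro sum.cong) auto
  then show ?case using assms(1) by (simp add: stay_prob_0 indicator_def)
next
  case (Suc n)
  have "stay_prob (Suc n) (\<lambda>k. if k = Suc n then F else carrier G) x =
      measure_pmf.expectation \<nu> (\<lambda>h. stay_prob n (\<lambda>k. if k = n then F else carrier G) (x \<otimes> h))"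
    using Suc.prems by (subst stay_prob_Suc) auto
  also have "\<dots> = measure_pmf.expectation \<nu> (\<lambda>h. \<Sum>y\<in>F. p n (inv h \<otimes> (inv x \<otimes> y)))"
  proof (intro integral_cong_AE AE_pmfI)
    fix h assume "h \<in> set_pmf \<nu>"
    then have h: "h \<in> carrier G" using support by auto
    have "inv (x \<otimes> h) \<otimes> y = inv h \<otimes> (inv x \<otimes> y)" if "y \<in> F" for y
      using h Suc.prems that assms by (auto simp: inv_mult_group m_assoc)
    then show "stay_prob n (\<lambda>k. if k = n then F else carrier G) (x \<otimes> h) = (\<Sum>y\<in>F. p n (inv h \<otimes> (inv x \<otimes> y)))"
      using Suc.IH[of "x \<otimes> h"] h Suc.prems by simp
  qed auto
  also have "\<dots> = (\<Sum>y\<in>F. measure_pmf.expectation \<nu> (\<lambda>h. p n (inv h \<otimes> (inv x \<otimes> y))))"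
    using p_bounds by (intro Bochner_Integration.integral_sum measure_pmf.integrable_const_bound[where B = 1]) auto
  also have "\<dots> = (\<Sum>y\<in>F. p (Suc n) (inv x \<otimes> y))"
    unfolding conv_power_Suc_left using assms(2) Suc.prems
    by (intro sum.cong pmf_convolution[symmetric] support conv_power_support) auto
  finally show ?case .
qed

text \<open>By left invariance the distance covered from the starting point has the same law for
  every starting point.\<close>

lemma stay_near_start:
  assumes x: "x \<in> carrier G"
  shows "stay_paths n (\<lambda>_. {y \<in> carrier G. len (inv x \<otimes> y) \<le> R}) x = stay_paths n (\<lambda>_. ball R) \<one>"
proof -
  have "inv x \<otimes> walk G x \<xi> k = walk G \<one> \<xi> k" if "\<xi> \<in> space paths" for \<xi> k
    using walk_translate[OF x that] walk_closed[OF one_closed that] x by (simp flip: m_assoc)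
  then show ?thesis using walk_closed[OF x] walk_closed[OF one_closed]
    by (auto simp: stay_paths_def ball_def)
qed

text \<open>A path from \<open>x\<close> that remains in a ball containing \<open>x\<close> stays within its diameter of \<open>x\<close>.\<close>

lemma stay_prob_ball_one_ge:
  assumes x: "x \<in> ball R"
  shows "stay_prob n (\<lambda>_. ball R) x \<le> stay_prob n (\<lambda>_. ball (2 * R)) \<one>"
proof -
  have xc: "x \<in> carrier G" "len x \<le> R" using x by (auto simp: ball_def)
  have "len (inv x \<otimes> y) \<le> 2 * R" if "y \<in> ball R" for y
    using that xc len_mult[of "inv x" y] by (auto simp: ball_def)
  then have "stay_paths n (\<lambda>_. ball R) x \<subseteq> stay_paths n (\<lambda>_. {y \<in> carrier G. len (inv x \<otimes> y) \<le> 2 * R}) x"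
    by (auto simp: stay_paths_def ball_def)
  then show ?thesis
    unfolding stay_prob_def stay_near_start[OF xc(1)]
    by (intro paths.finite_measure_mono stay_paths_sets one_closed)
qed

lemma stay_prob_ball_le_sum:
  "stay_prob n (\<lambda>_. ball R) \<one> \<le> (\<Sum>y\<in>ball R. p n y)"
proof -
  have "stay_prob n (\<lambda>_. ball R) \<one> \<le> stay_prob n (\<lambda>k. if k = n then ball R else carrier G) \<one>"
    unfolding stay_prob_def using walk_closed
    by (intro paths.finite_measure_mono stay_paths_sets) (auto simp: stay_paths_def ball_def)
  also have "\<dots> = (\<Sum>y\<in>ball R. p n (inv \<one> \<otimes> y))"
    by (intro law_of_walk finite_ball ball_subset_carrier) auto
  also have "\<dots> = (\<Sum>y\<in>ball R. p n y)"
    by (intro sum.cong refl) (simp add: ball_def)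
  finally show ?thesis .
qed

text \<open>The probability of an intersection is at least the sum of the two probabilities minus 1; the first event
  bounds the endpoint, the second keeps the path near its starting point.\<close>

lemma controlled_event_ge:
  assumes x: "x \<in> carrier G" "real (len x) \<le> \<tau>" and R: "\<tau> + real R \<le> c * \<tau>"
  shows "(\<Sum>y\<in>ball (nat \<lfloor>\<tau>\<rfloor>). p n (inv x \<otimes> y)) + stay_prob n (\<lambda>_. ball R) \<one> - 1 \<le>
    measure paths {\<xi> \<in> space paths.
      (SUP k\<in>{0..n}. word_norm G S (walk G x \<xi> k)) \<le> c * \<tau> \<and> word_norm G S (walk G x \<xi> n) \<le> \<tau>}"
proof -
  let ?F = "ball (nat \<lfloor>\<tau>\<rfloor>)"
  define E where "E = stay_paths n (\<lambda>k. if k = n then ?F else carrier G) x"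
  define H where "H = stay_paths n (\<lambda>_. {y \<in> carrier G. len (inv x \<otimes> y) \<le> R}) x"
  define T where "T = {\<xi> \<in> space paths.
      (SUP k\<in>{0..n}. word_norm G S (walk G x \<xi> k)) \<le> c * \<tau> \<and> word_norm G S (walk G x \<xi> n) \<le> \<tau>}"
  have \<tau>: "0 \<le> \<tau>" using x(2) of_nat_0_le_iff[of "len x", where 'a = real] by linarith
  have sets: "E \<in> sets paths" "H \<in> sets paths" unfolding E_def H_def using stay_paths_sets x by auto
  have sup_iff: "(SUP k\<in>{0..n}. word_norm G S (walk G x \<xi> k)) \<le> c * \<tau> \<longleftrightarrow>
      (\<forall>k\<le>n. word_norm G S (walk G x \<xi> k) \<le> c * \<tau>)" for \<xi>
    by (subst cSUP_le_iff) (auto intro: bdd_above_finite)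
  have T_eq: "T = stay_paths n (\<lambda>k. {y. word_norm G S y \<le> c * \<tau> \<and> (k = n \<longrightarrow> word_norm G S y \<le> \<tau>)}) x"
    unfolding T_def sup_iff stay_paths_def by auto
  have "E \<inter> H \<subseteq> T"
  proof
    fix \<xi> assume a: "\<xi> \<in> E \<inter> H"
    then have \<xi>: "\<xi> \<in> space paths" by (auto simp: E_def stay_paths_def)
    have "len (walk G x \<xi> n) \<le> nat \<lfloor>\<tau>\<rfloor>" using a by (auto simp: E_def stay_paths_def ball_def)
    then have fin: "word_norm G S (walk G x \<xi> n) \<le> \<tau>"
      using \<tau> by (simp add: le_nat_iff le_floor_iff)
    have "word_norm G S (walk G x \<xi> k) \<le> c * \<tau>" if "k \<le> n" for k
    proof -
      let ?y = "walk G x \<xi> k"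
      have y: "?y \<in> carrier G" "len (inv x \<otimes> ?y) \<le> R" using a that by (auto simp: H_def stay_paths_def)
      have "?y = x \<otimes> (inv x \<otimes> ?y)" using x y by (simp flip: m_assoc)
      then have "len ?y \<le> len x + len (inv x \<otimes> ?y)" using len_mult[of x "inv x \<otimes> ?y"] x y by simp
      then show ?thesis using y(2) x(2) R by linarith
    qed
    then show "\<xi> \<in> T" unfolding T_def sup_iff using \<xi> fin by simp
  qed
  then have "measure paths (E \<inter> H) \<le> measure paths T"
    unfolding T_eq by (intro paths.finite_measure_mono stay_paths_sets x)
  moreover have "measure paths E + measure paths H \<le> measure paths (E \<inter> H) + 1"
    using paths.finite_measure_Union'[OF sets] paths.prob_le_1[of "E \<union> H"]
      paths.finite_measure_Diff'[of H E] sets by (simp add: Int_commute)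
  moreover have "measure paths E = (\<Sum>y\<in>?F. p n (inv x \<otimes> y))"
    unfolding E_def stay_prob_def[symmetric] by (intro law_of_walk finite_ball ball_subset_carrier x)
  moreover have "measure paths H = stay_prob n (\<lambda>_. ball R) \<one>"
    unfolding H_def stay_near_start[OF x(1)] stay_prob_def ..
  ultimately show ?thesis unfolding T_def by simp
qed

end

section \<open>Powers of a symmetric kernel on a finite set\<close>

locale symmetric_kernel =
  fixes B :: "'a set" and k :: "'a \<Rightarrow> 'a \<Rightarrow> real"
  assumes sym_kernel: "\<And>x y. x \<in> B \<Longrightarrow> y \<in> B \<Longrightarrow> k x y = k y x"
begin

definition kernel_op :: "('a \<Rightarrow> real) \<Rightarrow> 'a \<Rightarrow> real" where
  "kernel_op u x = (\<Sum>y\<in>B. k x y * u y)"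

definition inner_B :: "('a \<Rightarrow> real) \<Rightarrow> ('a \<Rightarrow> real) \<Rightarrow> real" where
  "inner_B u v = (\<Sum>x\<in>B. u x * v x)"

lemma kernel_op_selfadjoint: "inner_B (kernel_op u) v = inner_B u (kernel_op v)"
proof -
  have "inner_B (kernel_op u) v = (\<Sum>x\<in>B. \<Sum>y\<in>B. k x y * u y * v x)"
    by (simp add: inner_B_def kernel_op_def sum_distrib_right)
  also have "\<dots> = (\<Sum>y\<in>B. \<Sum>x\<in>B. k x y * u y * v x)"
    by (rule sum.swap)
  also have "\<dots> = (\<Sum>y\<in>B. \<Sum>x\<in>B. u y * (k y x * v x))"
    by (intro sum.cong refl) (simp add: sym_kernel mult_ac)
  also have "\<dots> = inner_B u (kernel_op v)"
    by (simp add: inner_B_def kernel_op_def sum_distrib_left)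
  finally show ?thesis .
qed

lemma kernel_op_power_selfadjoint: "inner_B ((kernel_op ^^ n) u) v = inner_B u ((kernel_op ^^ n) v)"
proof (induction n arbitrary: v)
  case (Suc n)
  have "inner_B ((kernel_op ^^ Suc n) u) v = inner_B u ((kernel_op ^^ n) (kernel_op v))"
    using Suc.IH[of "kernel_op v"] by (simp add: kernel_op_selfadjoint)
  then show ?case by (simp add: funpow_swap1)
qed simp

text \<open>Self-adjointness splits \<open>\<langle>u, k\<^sup>2\<^sup>nu\<rangle>\<close> as \<open>\<langle>k\<^sup>nu, k\<^sup>nu\<rangle>\<close>.\<close>

lemma inner_power_square_le:
  "(inner_B u ((kernel_op ^^ n) u))\<^sup>2 \<le> inner_B u u * inner_B u ((kernel_op ^^ (2 * n)) u)"
proof -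
  have "inner_B u ((kernel_op ^^ (2 * n)) u) = inner_B ((kernel_op ^^ n) u) ((kernel_op ^^ n) u)"
    by (simp add: kernel_op_power_selfadjoint mult_2 funpow_add)
  then show ?thesis
    unfolding inner_B_def using Cauchy_Schwarz_ineq_sum[of u "(kernel_op ^^ n) u" B]
    by (simp add: power2_eq_square)
qed

text \<open>For powers of two this form of Jensen's inequality for the spectral measure of \<open>u\<close> follows
  from the Cauchy--Schwarz inequality alone.\<close>

lemma inner_power_lower_bound:
  assumes pos: "inner_B u u > 0" and nonneg: "inner_B u (kernel_op u) \<ge> 0"
  shows "inner_B u u * (inner_B u (kernel_op u) / inner_B u u) ^ (2 ^ j) \<le> inner_B u ((kernel_op ^^ (2 ^ j)) u)"
proof (induction j)
  case 0
  then show ?case using pos by simp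
next
  case (Suc j)
  let ?a = "inner_B u u" and ?q = "inner_B u (kernel_op u) / inner_B u u"
  have q: "0 \<le> ?q" using assms by simp
  have "(?a * ?q ^ (2 ^ j))\<^sup>2 \<le> (inner_B u ((kernel_op ^^ (2 ^ j)) u))\<^sup>2"
    using pos q Suc by (intro power_mono) auto
  also have "\<dots> \<le> ?a * inner_B u ((kernel_op ^^ (2 * 2 ^ j)) u)"
    by (rule inner_power_square_le)
  finally have "?a * (?a * (?q ^ (2 ^ j))\<^sup>2) \<le> ?a * inner_B u ((kernel_op ^^ (2 * 2 ^ j)) u)"
    by (simp add: power2_eq_square mult_ac)
  then have "?a * (?q ^ (2 ^ j))\<^sup>2 \<le> inner_B u ((kernel_op ^^ (2 * 2 ^ j)) u)"
    using pos by (rule mult_left_le_imp_le)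
  then show ?case by (simp add: power_mult[symmetric] mult.commute)
qed

lemma kernel_op_power_mono:
  assumes "\<And>x y. x \<in> B \<Longrightarrow> y \<in> B \<Longrightarrow> k x y \<ge> 0" "\<And>x. x \<in> B \<Longrightarrow> u x \<le> h 0 x"
    and "\<And>n x. x \<in> B \<Longrightarrow> (\<Sum>y\<in>B. k x y * h n y) \<le> h (Suc n) x" "x \<in> B"
  shows "(kernel_op ^^ n) u x \<le> h n x"
  using assms(4)
proof (induction n arbitrary: x)
  case (Suc n)
  have "(kernel_op ^^ Suc n) u x = (\<Sum>y\<in>B. k x y * (kernel_op ^^ n) u y)"
    unfolding funpow.simps comp_apply by (rule kernel_op_def)
  also have "\<dots> \<le> (\<Sum>y\<in>B. k x y * h n y)"
    using Suc assms(1) by (intro sum_mono mult_left_mono) auto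
  finally have "(kernel_op ^^ Suc n) u x \<le> (\<Sum>y\<in>B. k x y * h n y)" .
  with assms(3)[OF Suc.prems, of n] show ?case by linarith
qed (use assms in auto)

end

section \<open>Truncated second moment and confinement\<close>

lemma harm_le: "n \<ge> 1 \<Longrightarrow> harm n \<le> 1 + ln (real n)"
  using decseqD[OF decseq_harm_diff_ln, of 0 "n - 1"] by (simp add: harm_expand(2))

text \<open>Polynomial growth enters as doubling with an explicit exponent; finite groups are the case
  \<open>D = 0\<close>.\<close>

locale critical_walk = word_walk +
  fixes D K cN CN :: real
  assumes D_nonneg: "0 \<le> D" and K_ge_1: "1 \<le> K"
    and doubling: "\<And>\<kappa> t. 1 \<le> \<kappa> \<Longrightarrow> 0 \<le> t \<Longrightarrow> vol (\<kappa> * t) \<le> K * \<kappa> powr D * vol t"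
    and cN_pos: "0 < cN" and CN_pos: "0 < CN"
    and step_lower: "\<And>g. g \<in> carrier G \<Longrightarrow>
          cN / ((1 + real (len g))\<^sup>2 * vol (len g)) \<le> pmf \<nu> g"
    and step_upper: "\<And>g. g \<in> carrier G \<Longrightarrow>
          pmf \<nu> g \<le> CN / ((1 + real (len g))\<^sup>2 * vol (len g))"
begin

definition tail :: "nat \<Rightarrow> real" where
  "tail t = measure_pmf.prob \<nu> {h \<in> carrier G. t \<le> len h}"

text \<open>Steps of length between \<open>t\<close> and \<open>2t\<close>: there are at most \<open>V(2t)\<close> of them, each of probability
  at most \<open>CN / (t\<^sup>2 V(t))\<close>. Iterating over \<open>t, 2t, 4t, \<dots>\<close> gives a geometric series.\<close>

lemma tail_step:
  assumes t: "t \<ge> 1"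
  shows "tail t \<le> CN * K * 2 powr D / (real t)\<^sup>2 + tail (2 * t)"
proof -
  let ?L = "{h \<in> ball (2 * t). t \<le> len h}"
  have fin: "finite ?L" using finite_ball by simp
  have "tail t \<le> measure_pmf.prob \<nu> (?L \<union> {h \<in> carrier G. 2 * t \<le> len h})"
    unfolding tail_def by (intro measure_pmf.finite_measure_mono) (auto simp: ball_def)
  also have "\<dots> \<le> measure_pmf.prob \<nu> ?L + tail (2 * t)"
    unfolding tail_def by (intro measure_subadditive) auto
  also have "measure_pmf.prob \<nu> ?L = (\<Sum>h\<in>?L. pmf \<nu> h)"
    using fin by (simp add: measure_measure_pmf_finite)
  also have "\<dots> \<le> (\<Sum>h\<in>?L. CN / ((real t)\<^sup>2 * vol t))"
  proof (rule sum_mono)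
    fix h assume "h \<in> ?L"
    then have h: "h \<in> carrier G" "t \<le> len h" by (auto simp: ball_def)
    have "(real t)\<^sup>2 * vol t \<le> (1 + real (len h))\<^sup>2 * vol (len h)"
      using h vol_ge_1[of t] by (intro mult_mono power_mono vol_mono) auto
    then have "CN / ((1 + real (len h))\<^sup>2 * vol (len h)) \<le> CN / ((real t)\<^sup>2 * vol t)"
      using t CN_pos vol_pos[of t] vol_pos[of "len h"] by (intro divide_left_mono mult_pos_pos) auto
    then show "pmf \<nu> h \<le> CN / ((real t)\<^sup>2 * vol t)" using step_upper[OF h(1)] by linarith
  qed
  also have "\<dots> = real (card ?L) * (CN / ((real t)\<^sup>2 * vol t))" by simp
  also have "\<dots> \<le> (K * 2 powr D * vol t) * (CN / ((real t)\<^sup>2 * vol t))"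
  proof (intro mult_right_mono)
    have "real (card ?L) \<le> real (card (ball (2 * t)))"
      using finite_ball by (intro of_nat_mono card_mono) auto
    also have "\<dots> = vol (2 * real t)" using vol_of_nat[of "2 * t"] by simp
    also have "\<dots> \<le> K * 2 powr D * vol t" using doubling[of 2 t] by simp
    finally show "real (card ?L) \<le> K * 2 powr D * vol t" .
  qed (use CN_pos vol_pos[of t] in auto)
  also have "\<dots> = CN * K * 2 powr D / (real t)\<^sup>2"
    using vol_pos[of t] by (simp add: field_simps)
  finally show ?thesis by linarith
qed

lemma tail_iterate:
  "t \<ge> 1 \<Longrightarrow> tail t \<le> 4 / 3 * (CN * K * 2 powr D) / (real t)\<^sup>2 + tail (2 ^ n * t)"
proof (induction n arbitrary: t)
  case 0
  then show ?case using CN_pos K_ge_1 by simp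
next
  case (Suc n)
  let ?C = "CN * K * 2 powr D"
  have "tail t \<le> ?C / (real t)\<^sup>2 + (4 / 3 * ?C / (real (2 * t))\<^sup>2 + tail (2 ^ n * (2 * t)))"
    using tail_step[OF Suc.prems] Suc.IH[of "2 * t"] Suc.prems by linarith
  also have "?C / (real t)\<^sup>2 + (4 / 3 * ?C / (real (2 * t))\<^sup>2 + tail (2 ^ n * (2 * t))) =
      4 / 3 * ?C / (real t)\<^sup>2 + tail (2 ^ Suc n * t)"
    using Suc.prems by (simp add: power2_eq_square field_simps)
  finally show ?case .
qed

lemma tail_tendsto_0: "tail \<longlonglongrightarrow> 0"
proof -
  have "(\<lambda>t. measure_pmf.prob \<nu> {h \<in> carrier G. t \<le> len h}) \<longlonglongrightarrow>
      measure_pmf.prob \<nu> (\<Inter>t. {h \<in> carrier G. t \<le> len h})"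
    by (intro measure_pmf.finite_Lim_measure_decseq) (auto simp: decseq_def)
  moreover have "h \<notin> (\<Inter>t. {h \<in> carrier G. t \<le> len h})" for h
    using not_less_eq_eq[of "len h" "len h"] by blast
  then have "(\<Inter>t. {h \<in> carrier G. t \<le> len h}) = {}" by blast
  ultimately show ?thesis by (simp add: tail_def[abs_def])
qed

definition tail_const :: real where
  "tail_const = 4 / 3 * (CN * K * 2 powr D)"

lemma tail_const_pos: "0 < tail_const"
  using CN_pos K_ge_1 by (simp add: tail_const_def)

lemma tail_le:
  assumes t: "t \<ge> 1"
  shows "tail t \<le> tail_const / (real t)\<^sup>2"
proof -
  have "strict_mono (\<lambda>n. 2 ^ n * t)"
    using t by (auto intro!: strict_monoI)
  from LIMSEQ_subseq_LIMSEQ[OF tail_tendsto_0 this]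
  have "(\<lambda>n. tail_const / (real t)\<^sup>2 + tail (2 ^ n * t)) \<longlonglongrightarrow> tail_const / (real t)\<^sup>2 + 0"
    by (intro tendsto_add tendsto_const) (simp add: comp_def)
  moreover have "tail t \<le> tail_const / (real t)\<^sup>2 + tail (2 ^ n * t)" for n
    using tail_iterate[OF t, of n] by (simp add: tail_const_def)
  ultimately show ?thesis by (intro LIMSEQ_le_const) auto
qed

definition truncated_moment :: "nat \<Rightarrow> real" where
  "truncated_moment l = measure_pmf.expectation \<nu> (\<lambda>h. (real (min l (len h)))\<^sup>2)"

text \<open>The tail \<open>t\<^sup>-\<^sup>2\<close> sits exactly at the border of finite variance: the truncated second moment
  grows logarithmically, which is the source of the factor \<open>log n\<close> in the scale of the walk.\<close>

lemma truncated_moment_le: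
  assumes l: "l \<ge> 1"
  shows "truncated_moment l \<le> 2 * tail_const * (1 + ln (real l))"
proof -
  \<comment> \<open>The square of \<open>n\<close> is the sum of the first \<open>n\<close> odd numbers.\<close>
  have layer: "(real (min l (len h)))\<^sup>2 = (\<Sum>m<l. (2 * real m + 1) * indicator {h \<in> carrier G. Suc m \<le> len h} h)"
    if h: "h \<in> carrier G" for h
  proof -
    have sq: "(\<Sum>m<n. 2 * real m + 1) = (real n)\<^sup>2" for n
      by (induction n) (auto simp: power2_eq_square algebra_simps)
    have "(\<Sum>m<l. (2 * real m + 1) * indicator {h \<in> carrier G. Suc m \<le> len h} h) =
        (\<Sum>m\<in>{..<min l (len h)}. 2 * real m + 1)"
      using h by (intro sum.mono_neutral_cong_right) (auto simp: indicator_def)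
    then show ?thesis using sq by simp
  qed
  have "truncated_moment l = measure_pmf.expectation \<nu>
      (\<lambda>h. \<Sum>m<l. (2 * real m + 1) * indicator {h \<in> carrier G. Suc m \<le> len h} h)"
    unfolding truncated_moment_def using support layer by (intro integral_cong_AE AE_pmfI) auto
  also have "\<dots> = (\<Sum>m<l. (2 * real m + 1) * tail (Suc m))"
    unfolding tail_def
    by (subst Bochner_Integration.integral_sum)
       (auto intro!: integrable_mult_right measure_pmf.integrable_const_bound[where B = 1])
  also have "\<dots> \<le> (\<Sum>m<l. 2 * tail_const * inverse (real (Suc m)))"
  proof (rule sum_mono)
    fix m
    have "(2 * real m + 1) * tail (Suc m) \<le> (2 * real (Suc m)) * (tail_const / (real (Suc m))\<^sup>2)"
      using tail_le[of "Suc m"] tail_const_pos by (intro mult_mono) (auto simp: tail_def)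
    also have "\<dots> = 2 * tail_const * inverse (real (Suc m))"
      by (simp add: power2_eq_square field_simps del: of_nat_Suc)
    finally show "(2 * real m + 1) * tail (Suc m) \<le> 2 * tail_const * inverse (real (Suc m))" .
  qed
  also have "\<dots> = 2 * tail_const * harm l"
    by (simp add: harm_altdef sum_distrib_left)
  also have "\<dots> \<le> 2 * tail_const * (1 + ln (real l))"
    using harm_le[OF l] tail_const_pos by (intro mult_left_mono) auto
  finally show ?thesis .
qed

text \<open>A trapezoid in the distance to the identity with slope \<open>1 / l\<close>; its
  energy is controlled by the truncated second moment at the level \<open>l\<close>.\<close>

definition trapezoid :: "nat \<Rightarrow> nat \<Rightarrow> 'a \<Rightarrow> real" where
  "trapezoid l m x = max 0 (min 1 (real (Suc m) - real (len x) / real l))"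

lemma trapezoid_bounds: "0 \<le> trapezoid l m x" "trapezoid l m x \<le> 1"
  by (auto simp: trapezoid_def)

lemma trapezoid_eq_0: "l \<ge> 1 \<Longrightarrow> x \<in> carrier G \<Longrightarrow> x \<notin> ball (Suc m * l) \<Longrightarrow> trapezoid l m x = 0"
proof -
  assume l: "l \<ge> 1" and "x \<in> carrier G" "x \<notin> ball (Suc m * l)"
  then have "Suc m * l \<le> len x" by (auto simp: ball_def)
  then have "real (Suc m) * real l \<le> real (len x)" by (metis of_nat_le_iff of_nat_mult)
  then have "real (Suc m) \<le> real (len x) / real l" using l by (simp add: pos_le_divide_eq)
  then show ?thesis by (simp add: trapezoid_def)
qed

lemma trapezoid_eq_1: "l \<ge> 1 \<Longrightarrow> x \<in> ball (m * l) \<Longrightarrow> trapezoid l m x = 1"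
proof -
  assume l: "l \<ge> 1" and "x \<in> ball (m * l)"
  then have "len x \<le> m * l" by (auto simp: ball_def)
  then have "real (len x) \<le> real m * real l" by (metis of_nat_le_iff of_nat_mult)
  then have "real (len x) / real l \<le> real m" using l by (simp add: pos_divide_le_eq)
  then show ?thesis by (simp add: trapezoid_def)
qed

lemma trapezoid_diff:
  assumes l: "l \<ge> 1" and x: "x \<in> carrier G" and h: "h \<in> carrier G"
  shows "(trapezoid l m (x \<otimes> h) - trapezoid l m x)\<^sup>2 \<le> (real (min l (len h)))\<^sup>2 / (real l)\<^sup>2"
proof -
  let ?f = "trapezoid l m"
  have "\<bar>real (len (x \<otimes> h)) - real (len x)\<bar> \<le> real (len h)"
    using len_mult[OF x h] len_mult_ge(1)[OF x h] by linarith
  then have "\<bar>real (len (x \<otimes> h)) / real l - real (len x) / real l\<bar> \<le> real (len h) / real l"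
    using l by (simp add: field_simps flip: diff_divide_distrib abs_div_pos)
  then have "\<bar>?f (x \<otimes> h) - ?f x\<bar> \<le> real (len h) / real l"
    unfolding trapezoid_def by linarith
  moreover have "\<bar>?f (x \<otimes> h) - ?f x\<bar> \<le> real l / real l"
    using trapezoid_bounds[of l m x] trapezoid_bounds[of l m "x \<otimes> h"] l by auto
  ultimately have "\<bar>?f (x \<otimes> h) - ?f x\<bar> \<le> real (min l (len h)) / real l"
    by (simp add: min_def)
  then have "\<bar>?f (x \<otimes> h) - ?f x\<bar>\<^sup>2 \<le> (real (min l (len h)) / real l)\<^sup>2"
    by (intro power_mono) auto
  then show ?thesis by (simp add: power_divide)
qed

text \<open>Twice the left-hand side is the sum of \<open>(f(xh) - f(x))\<^sup>2\<close>, since translation preserves the sum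
  of squares. The sum runs over the at most \<open>2|B|\<close> points \<open>x\<close> with \<open>x\<close> or \<open>xh\<close> in \<open>B\<close>.\<close>

lemma trapezoid_energy:
  fixes l m :: nat
  assumes l: "l \<ge> 1" and h: "h \<in> carrier G"
  defines "B \<equiv> ball (Suc m * l)" and "f \<equiv> trapezoid l m"
  shows "(\<Sum>x\<in>B. f x * f x) - (\<Sum>x\<in>B. f x * f (x \<otimes> h)) \<le>
    real (card B) * ((real (min l (len h)))\<^sup>2 / (real l)\<^sup>2)"
proof -
  define B' where "B' = B \<union> (\<lambda>y. y \<otimes> inv h) ` B"
  have B: "finite B" "B \<subseteq> carrier G" unfolding B_def using finite_ball ball_subset_carrier by auto
  have B': "finite B'" "B' \<subseteq> carrier G" "B \<subseteq> B'" using B h by (auto simp: B'_def)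
  have zero: "f x = 0" if "x \<in> carrier G" "x \<notin> B" for x
    using that trapezoid_eq_0[OF l] unfolding B_def f_def by auto
  have card: "card B' \<le> 2 * card B"
    using card_Un_le[of B "(\<lambda>y. y \<otimes> inv h) ` B"] card_image_le[OF B(1), of "\<lambda>y. y \<otimes> inv h"]
    unfolding B'_def by linarith
  have s1: "(\<Sum>x\<in>B'. f x * f x) = (\<Sum>x\<in>B. f x * f x)"
    using B' zero by (intro sum.mono_neutral_right) auto
  have s2: "(\<Sum>x\<in>B'. f x * f (x \<otimes> h)) = (\<Sum>x\<in>B. f x * f (x \<otimes> h))"
    using B' zero by (intro sum.mono_neutral_right) auto
  have "inj_on (\<lambda>x. x \<otimes> h) B'" using B' h by (auto intro!: inj_onI simp: subset_iff)
  then have "(\<Sum>x\<in>B'. f (x \<otimes> h) * f (x \<otimes> h)) = (\<Sum>y\<in>(\<lambda>x. x \<otimes> h) ` B'. f y * f y)"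
    by (simp add: sum.reindex)
  also have "\<dots> = (\<Sum>x\<in>B. f x * f x)"
  proof (intro sum.mono_neutral_right)
    show "B \<subseteq> (\<lambda>x. x \<otimes> h) ` B'"
    proof
      fix y assume y: "y \<in> B"
      then have "y = (y \<otimes> inv h) \<otimes> h" using B h by (auto simp: m_assoc)
      then show "y \<in> (\<lambda>x. x \<otimes> h) ` B'" using y unfolding B'_def by blast
    qed
  qed (use B' h zero in auto)
  finally have s3: "(\<Sum>x\<in>B'. f (x \<otimes> h) * f (x \<otimes> h)) = (\<Sum>x\<in>B. f x * f x)" .
  have "(\<Sum>x\<in>B'. (f (x \<otimes> h) - f x)\<^sup>2) =
      (\<Sum>x\<in>B'. f (x \<otimes> h) * f (x \<otimes> h)) + (\<Sum>x\<in>B'. f x * f x) - 2 * (\<Sum>x\<in>B'. f x * f (x \<otimes> h))"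
    by (simp add: power2_eq_square algebra_simps sum.distrib sum_subtractf sum_distrib_left)
  then have "2 * ((\<Sum>x\<in>B. f x * f x) - (\<Sum>x\<in>B. f x * f (x \<otimes> h))) = (\<Sum>x\<in>B'. (f (x \<otimes> h) - f x)\<^sup>2)"
    unfolding s1 s2 s3 by simp
  also have "\<dots> \<le> (\<Sum>x\<in>B'. (real (min l (len h)))\<^sup>2 / (real l)\<^sup>2)"
    using B' h by (intro sum_mono) (auto simp: f_def intro!: trapezoid_diff[OF l])
  also have "\<dots> = real (card B') * ((real (min l (len h)))\<^sup>2 / (real l)\<^sup>2)" by simp
  also have "\<dots> \<le> (2 * real (card B)) * ((real (min l (len h)))\<^sup>2 / (real l)\<^sup>2)"
    using card by (intro mult_right_mono) auto
  finally show ?thesis by simp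
qed

lemma stay_prob_antimono: "m \<le> n \<Longrightarrow> x \<in> carrier G \<Longrightarrow> stay_prob n (\<lambda>_. B) x \<le> stay_prob m (\<lambda>_. B) x"
  unfolding stay_prob_def by (intro paths.finite_measure_mono stay_paths_sets) (auto simp: stay_paths_def)

lemma pmf_step_sym:
  assumes "x \<in> carrier G" "y \<in> carrier G"
  shows "pmf \<nu> (inv x \<otimes> y) = pmf \<nu> (inv y \<otimes> x)"
proof -
  have "inv (inv x \<otimes> y) = inv y \<otimes> x" using assms by (simp add: inv_mult_group)
  then show ?thesis using pmf_inv[of "inv x \<otimes> y"] assms by simp
qed

text \<open>The probability of staying in a ball, averaged over the starting point, dominates a
  quadratic form in powers of the killed walk. By left invariance no starting point
  does better than the identity does in the ball of twice the radius.\<close>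

lemma confinement_step:
  fixes l m n :: nat and \<delta> :: real
  defines "\<theta> \<equiv> truncated_moment l / (real l)\<^sup>2"
  assumes l: "l \<ge> 1" and n: "n \<ge> 1" and \<delta>: "0 < \<delta>" "\<delta> \<le> 1 / 2"
    and vol: "(1 - \<delta>) * real (card (ball (Suc m * l))) \<le> real (card (ball (m * l)))"
    and small: "4 * real n * \<theta> \<le> 1"
  shows "(1 - \<delta>) * (1 - 4 * real n * \<theta>) \<le> stay_prob n (\<lambda>_. ball (2 * (Suc m * l))) \<one>"
proof -
  define B where "B = ball (Suc m * l)"
  define f where "f = trapezoid l m"
  define b where "b = real (card B)"
  have B: "finite B" "B \<subseteq> carrier G" unfolding B_def using finite_ball ball_subset_carrier by auto
  have "B \<noteq> {}" unfolding B_def using one_in_ball by blast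
  then have b: "b > 0" using B by (simp add: b_def card_gt_0_iff)
  have zero: "f x = 0" if "x \<in> carrier G" "x \<notin> B" for x
    using that trapezoid_eq_0[OF l] unfolding B_def f_def by auto
  have f01: "0 \<le> f x" "f x \<le> 1" for x unfolding f_def by (rule trapezoid_bounds)+
  interpret symmetric_kernel B "\<lambda>x y. pmf \<nu> (inv x \<otimes> y)"
    by unfold_locales (use B pmf_step_sym in auto)
  let ?a0 = "inner_B f f" and ?a1 = "inner_B f (kernel_op f)"
  have \<theta>: "0 \<le> \<theta>" unfolding \<theta>_def truncated_moment_def by simp
  have "kernel_op f x = measure_pmf.expectation \<nu> (\<lambda>h. f (x \<otimes> h))" if "x \<in> B" for x
    using expectation_shift[OF B, of x f] that B zero by (auto simp: kernel_op_def)
  then have "?a1 = (\<Sum>x\<in>B. f x * measure_pmf.expectation \<nu> (\<lambda>h. f (x \<otimes> h)))"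
    by (simp add: inner_B_def)
  moreover have int: "integrable \<nu> (\<lambda>h. f (x \<otimes> h))" for x
    using f01 by (intro measure_pmf.integrable_const_bound[where B = 1]) auto
  ultimately have "?a1 = measure_pmf.expectation \<nu> (\<lambda>h. \<Sum>x\<in>B. f x * f (x \<otimes> h))"
    by (subst Bochner_Integration.integral_sum) (auto intro: integrable_mult_right)
  moreover have "?a0 = (\<Sum>x\<in>B. f x * f x)" by (simp add: inner_B_def)
  ultimately have "?a0 - ?a1 = measure_pmf.expectation \<nu> (\<lambda>h. (\<Sum>x\<in>B. f x * f x) - (\<Sum>x\<in>B. f x * f (x \<otimes> h)))"
    using int by (subst Bochner_Integration.integral_diff) (auto intro!: integrable_mult_right)
  also have "\<dots> \<le> measure_pmf.expectation \<nu> (\<lambda>h. b * ((real (min l (len h)))\<^sup>2 / (real l)\<^sup>2))"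
  proof (intro integral_mono_AE AE_pmfI)
    show "integrable \<nu> (\<lambda>h. (\<Sum>x\<in>B. f x * f x) - (\<Sum>x\<in>B. f x * f (x \<otimes> h)))"
      using int by (auto intro!: integrable_mult_right)
    have "(real (min l k))\<^sup>2 / (real l)\<^sup>2 \<le> 1" for k
      using l by (auto simp: divide_le_eq_1 intro!: power_mono)
    then have "integrable \<nu> (\<lambda>h. (real (min l (len h)))\<^sup>2 / (real l)\<^sup>2)"
      by (intro measure_pmf.integrable_const_bound[where B = 1]) auto
    then show "integrable \<nu> (\<lambda>h. b * ((real (min l (len h)))\<^sup>2 / (real l)\<^sup>2))"
      by (rule integrable_mult_right)
    fix h assume "h \<in> set_pmf \<nu>"
    then have "h \<in> carrier G" using support by auto
    from trapezoid_energy[OF l this, of m]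
    show "(\<Sum>x\<in>B. f x * f x) - (\<Sum>x\<in>B. f x * f (x \<otimes> h)) \<le> b * ((real (min l (len h)))\<^sup>2 / (real l)\<^sup>2)"
      unfolding B_def f_def b_def .
  qed
  also have "\<dots> = b * \<theta>" unfolding \<theta>_def truncated_moment_def by simp
  finally have energy: "?a0 - ?a1 \<le> b * \<theta>" .
  have "(1 - \<delta>) * b \<le> (\<Sum>x\<in>ball (m * l). f x * f x)"
    using vol trapezoid_eq_1[OF l] by (simp add: b_def B_def f_def)
  also have "\<dots> \<le> ?a0"
    unfolding inner_B_def using B f01 ball_mono[of "m * l" "Suc m * l"]
    by (intro sum_mono2) (auto simp: B_def)
  finally have a0: "(1 - \<delta>) * b \<le> ?a0" .
  then have a0_half: "b / 2 \<le> ?a0" using \<delta> b mult_right_mono[of "1/2" "1 - \<delta>" b] by linarith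
  have a0_pos: "?a0 > 0" using a0_half b by linarith
  have a1: "0 \<le> ?a1"
    unfolding inner_B_def kernel_op_def using f01 by (intro sum_nonneg mult_nonneg_nonneg) auto
  have "1 - 2 * \<theta> \<le> ?a1 / ?a0"
  proof -
    have "?a0 * (1 - 2 * \<theta>) \<le> ?a0 - b * \<theta>"
      using mult_right_mono[OF a0_half \<theta>] by (simp add: algebra_simps)
    also have "\<dots> \<le> ?a1" using energy by linarith
    finally show ?thesis using a0_pos by (simp add: pos_le_divide_eq mult.commute)
  qed
  \<comment> \<open>Staying longer is less likely, so \<open>n\<close> may be rounded up to a power of two.\<close>
  obtain j where j: "n \<le> 2 ^ j" "2 ^ j \<le> 2 * n"
  proof -
    define j where "j = (LEAST j. n \<le> 2 ^ j)"
    have "n \<le> 2 ^ j" unfolding j_def by (rule LeastI[of _ n]) (simp add: less_imp_le)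
    moreover have "2 ^ j \<le> 2 * n"
    proof (cases j)
      case 0
      then show ?thesis using n by simp
    next
      case (Suc i)
      then have "\<not> n \<le> 2 ^ i" unfolding j_def by (metis lessI not_less_Least)
      then show ?thesis using Suc by simp
    qed
    ultimately show ?thesis using that by blast
  qed
  have N: "real (2 ^ j) \<le> 2 * real n" using j(2) by (metis of_nat_le_iff of_nat_mult of_nat_numeral)
  have \<theta>2: "2 * \<theta> \<le> 1" using small \<theta> n mult_right_mono[of 1 "real n" \<theta>] by linarith
  have "1 - 4 * real n * \<theta> \<le> 1 + real (2 ^ j) * (- 2 * \<theta>)"
    using mult_right_mono[OF N \<theta>] by linarith
  also have "\<dots> \<le> (1 + (- 2 * \<theta>)) ^ (2 ^ j)"
    using \<theta>2 by (intro Bernoulli_inequality) simp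
  also have "\<dots> \<le> (?a1 / ?a0) ^ (2 ^ j)"
    using \<theta>2 \<open>1 - 2 * \<theta> \<le> ?a1 / ?a0\<close> by (intro power_mono) auto
  finally have q: "1 - 4 * real n * \<theta> \<le> (?a1 / ?a0) ^ (2 ^ j)" .
  have "(1 - \<delta>) * b * (1 - 4 * real n * \<theta>) \<le> ?a0 * (?a1 / ?a0) ^ (2 ^ j)"
    using a0 q small a0_pos by (intro mult_mono) auto
  also have "\<dots> \<le> inner_B f ((kernel_op ^^ (2 ^ j)) f)"
    by (rule inner_power_lower_bound[OF a0_pos a1])
  also have "\<dots> \<le> (\<Sum>x\<in>B. stay_prob n (\<lambda>_. ball (2 * (Suc m * l))) \<one>)"
    unfolding inner_B_def
  proof (rule sum_mono)
    fix x assume x: "x \<in> B"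
    have "(kernel_op ^^ (2 ^ j)) f x \<le> stay_prob (2 ^ j) (\<lambda>_. B) x"
    proof (rule kernel_op_power_mono[where h = "\<lambda>n. stay_prob n (\<lambda>_. B)"])
      show "f x \<le> stay_prob 0 (\<lambda>_. B) x" if "x \<in> B" for x using that f01 by (simp add: stay_prob_0)
      show "(\<Sum>y\<in>B. pmf \<nu> (inv x \<otimes> y) * stay_prob n (\<lambda>_. B) y) \<le> stay_prob (Suc n) (\<lambda>_. B) x" if "x \<in> B" for n x
        using stay_prob_const_Suc[OF B that] by simp
    qed (use x in auto)
    then have "f x * (kernel_op ^^ (2 ^ j)) f x \<le> 1 * stay_prob (2 ^ j) (\<lambda>_. B) x"
      using f01 stay_prob_bounds by (smt (verit) mult_left_le_one_le mult_left_mono mult_1)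
    also have "\<dots> \<le> stay_prob n (\<lambda>_. B) x" using stay_prob_antimono[OF j(1)] x B by auto
    also have "\<dots> \<le> stay_prob n (\<lambda>_. ball (2 * (Suc m * l))) \<one>"
      unfolding B_def using x by (intro stay_prob_ball_one_ge) (simp add: B_def)
    finally show "f x * (kernel_op ^^ (2 ^ j)) f x \<le> stay_prob n (\<lambda>_. ball (2 * (Suc m * l))) \<one>" .
  qed
  also have "\<dots> = b * stay_prob n (\<lambda>_. ball (2 * (Suc m * l))) \<one>" by (simp add: b_def)
  finally have "b * ((1 - \<delta>) * (1 - 4 * real n * \<theta>)) \<le> b * stay_prob n (\<lambda>_. ball (2 * (Suc m * l))) \<one>"
    by (simp add: mult_ac)
  then show ?thesis using b by (rule mult_left_le_imp_le)
qed

text \<open>Doubling forces a shell of small relative volume at a bounded multiple of every scale: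
  otherwise the volume would grow exponentially in the number of shells.\<close>

lemma thin_shell:
  assumes \<delta>: "0 < \<delta>" "\<delta> \<le> 1 / 2"
  obtains M where "\<And>l. l \<ge> 1 \<Longrightarrow> \<exists>m<M. (1 - \<delta>) * real (card (ball (Suc m * l))) \<le> real (card (ball (m * l)))"
proof -
  define q where "q = 1 / (1 - \<delta>)"
  have q: "q > 1" using \<delta> by (simp add: q_def)
  have "((\<lambda>n::nat. K * (real n + 1) powr D / q ^ n) \<longlongrightarrow> 0) sequentially"
    using q by real_asymp
  then have "\<forall>\<^sub>F n in sequentially. K * (real n + 1) powr D / q ^ n < 1"
    by (rule order_tendstoD) simp
  then obtain N where N: "K * (real N + 1) powr D / q ^ N < 1"
    by (auto simp: eventually_sequentially)
  have "\<exists>m<Suc N. (1 - \<delta>) * real (card (ball (Suc m * l))) \<le> real (card (ball (m * l)))"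
    if l: "l \<ge> 1" for l
  proof (rule ccontr)
    assume no: "\<not> ?thesis"
    have grow: "q * real (card (ball (m * l))) \<le> real (card (ball (Suc m * l)))" if "m < Suc N" for m
    proof -
      have "real (card (ball (m * l))) < (1 - \<delta>) * real (card (ball (Suc m * l)))"
        using no that by force
      then show ?thesis unfolding q_def using \<delta> by (simp add: pos_divide_le_eq mult.commute)
    qed
    have "q ^ k * real (card (ball l)) \<le> real (card (ball (Suc k * l)))" if "k \<le> N" for k
      using that
    proof (induction k)
      case (Suc k)
      have "q ^ Suc k * real (card (ball l)) \<le> q * real (card (ball (Suc k * l)))"
        using Suc q by (simp add: mult.assoc)
      also have "\<dots> \<le> real (card (ball (Suc (Suc k) * l)))"
        using grow[of "Suc k"] Suc.prems by simp
      finally show ?case .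
    qed simp
    from this[of N] have "q ^ N * vol l \<le> vol (Suc N * l)" by (simp only: vol_of_nat order.refl)
    also have "vol (Suc N * l) \<le> K * (real N + 1) powr D * vol l"
      using doubling[of "real (Suc N)" l] unfolding of_nat_mult of_nat_Suc by (simp add: add.commute)
    finally have "q ^ N \<le> K * (real N + 1) powr D"
      using vol_pos[of l] by (simp add: mult_le_cancel_right)
    then show False using N q by (simp add: pos_divide_less_eq)
  qed
  then show ?thesis by (rule that)
qed

end

text \<open>Adding 1 inside the logarithm keeps the scale positive at \<open>n = 1\<close>.\<close>

definition rate :: "nat \<Rightarrow> real" where
  "rate n = sqrt (real n * ln (real n + 1))"

lemma ln_Suc_bounds: "n \<ge> 1 \<Longrightarrow> 1 / 2 \<le> ln (real n + 1)" "ln (real n + 1) \<le> real n"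
proof -
  show "ln (real n + 1) \<le> real n" using ln_add_one_self_le_self[of "real n"] by (simp add: add.commute)
  assume "n \<ge> 1"
  then have "ln 2 \<le> ln (real n + 1)" by simp
  then show "1 / 2 \<le> ln (real n + 1)" using ln2_ge_two_thirds by linarith
qed

lemma rate_nonneg: "0 \<le> rate n"
  by (simp add: rate_def)

lemma rate_sq: "(rate n)\<^sup>2 = real n * ln (real n + 1)"
  by (simp add: rate_def)

lemma rate_ge: "n \<ge> 1 \<Longrightarrow> 1 / 2 \<le> rate n"
proof -
  assume n: "n \<ge> 1"
  have "(1 / 2)\<^sup>2 \<le> 1 * (1 / 2 :: real)" by (simp add: power2_eq_square)
  also have "\<dots> \<le> real n * ln (real n + 1)" using n ln_Suc_bounds by (intro mult_mono) auto
  finally show ?thesis unfolding rate_def by (rule real_le_rsqrt)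
qed

lemma rate_le: "rate n \<le> real n"
proof -
  have "real n * ln (real n + 1) \<le> real n * real n"
    using ln_Suc_bounds(2) by (intro mult_left_mono) auto
  then show ?thesis unfolding rate_def by (intro real_le_lsqrt) (auto simp: power2_eq_square)
qed

lemma rate_mono: "m \<le> n \<Longrightarrow> rate m \<le> rate n"
  unfolding rate_def by (auto intro!: real_sqrt_le_mono mult_mono)

context critical_walk
begin

text \<open>With \<open>l \<approx> L R(n)\<close> the loss \<open>n E min(|\<xi>|, l)\<^sup>2 / l\<^sup>2\<close> is of order \<open>n log l / (L\<^sup>2 n log n)\<close>, which
  is small for large \<open>L\<close>, uniformly in \<open>n\<close>.\<close>

theorem confinement:
  fixes \<delta> :: real
  assumes \<delta>: "0 < \<delta>"
  obtains A where "A > 0"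
    and "\<And>n. n \<ge> 1 \<Longrightarrow> \<exists>R. real R \<le> A * rate n \<and> 1 - \<delta> \<le> stay_prob n (\<lambda>_. ball R) \<one>"
proof -
  define d where "d = min (\<delta> / 2) (1 / 2)"
  have d: "0 < d" "d \<le> 1 / 2" "2 * d \<le> \<delta>" using \<delta> by (auto simp: d_def)
  obtain M where M: "\<And>l. l \<ge> 1 \<Longrightarrow> \<exists>m<M. (1 - d) * real (card (ball (Suc m * l))) \<le> real (card (ball (m * l)))"
    using thin_shell d by blast
  define L where "L = 1 + 40 * tail_const / d"
  have L: "1 \<le> L" "40 * tail_const \<le> d * L"
    using tail_const_pos d by (auto simp: L_def field_simps)
  define A where "A = 2 * real M * (L + 2) + 1"
  have "\<exists>R. real R \<le> A * rate n \<and> 1 - \<delta> \<le> stay_prob n (\<lambda>_. ball R) \<one>" if n: "n \<ge> 1" for n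
  proof -
    define l where "l = nat \<lceil>L * rate n\<rceil>"
    have pos: "0 < L * rate n" using L rate_ge[OF n] by (intro mult_pos_pos) auto
    have l: "L * rate n \<le> real l" "real l \<le> L * rate n + 1" "l \<ge> 1"
      using pos unfolding l_def by linarith+
    define g where "g = ln (real n + 1)"
    have g: "1 / 2 \<le> g" using ln_Suc_bounds n by (simp add: g_def)
    have "real l \<le> (1 + L) * (real n + 1)"
    proof -
      have "L * rate n \<le> L * real n" using L rate_le by (intro mult_left_mono) auto
      moreover have "(1 + L) * (real n + 1) = L * real n + real n + L + 1" by (simp add: algebra_simps)
      ultimately show ?thesis using l(2) L by linarith
    qed
    then have "ln (real l) \<le> ln ((1 + L) * (real n + 1))" using l(3) L by simp
    also have "\<dots> = ln (1 + L) + g" using L by (simp add: ln_mult g_def)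
    also have "ln (1 + L) \<le> L" using L by (intro ln_add_one_self_le_self) auto
    finally have "1 + ln (real l) \<le> 2 * g + (2 * g * L + g)"
      using g L mult_right_mono[of 1 "2 * g" L] by linarith
    also have "\<dots> \<le> 5 * L * g" using g L mult_left_mono[of 1 L "3 * g"] by (simp add: algebra_simps)
    finally have log: "1 + ln (real l) \<le> 5 * L * g" .
    define \<theta> where "\<theta> = truncated_moment l / (real l)\<^sup>2"
    have "truncated_moment l \<le> 2 * tail_const * (5 * L * g)"
      using truncated_moment_le[OF l(3)] log mult_left_mono[OF log, of "2 * tail_const"] tail_const_pos
      by linarith
    moreover have "L\<^sup>2 * (real n * g) \<le> (real l)\<^sup>2"
      using l(1) pos rate_sq[of n] power_mono[OF l(1), of 2] by (simp add: power_mult_distrib g_def)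
    ultimately have "\<theta> \<le> (2 * tail_const * (5 * L * g)) / (L\<^sup>2 * (real n * g))"
      unfolding \<theta>_def using L n g tail_const_pos by (intro frac_le) auto
    also have "\<dots> = 10 * tail_const / (L * real n)"
      using L n g by (simp add: field_simps power2_eq_square)
    finally have "4 * real n * \<theta> \<le> 4 * real n * (10 * tail_const / (L * real n))"
      by (intro mult_left_mono) auto
    also have "\<dots> = 40 * tail_const / L" using L n by (simp add: field_simps)
    also have "\<dots> \<le> d" using L by (simp add: pos_divide_le_eq)
    finally have small: "4 * real n * \<theta> \<le> d" .
    obtain m where m: "m < M" "(1 - d) * real (card (ball (Suc m * l))) \<le> real (card (ball (m * l)))"
      using M[OF l(3)] by blast
    have "(1 - d) * (1 - d) \<le> (1 - d) * (1 - 4 * real n * \<theta>)"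
      using small d by (intro mult_left_mono) auto
    also have "\<dots> \<le> stay_prob n (\<lambda>_. ball (2 * (Suc m * l))) \<one>"
      unfolding \<theta>_def using small d by (intro confinement_step l n m) (auto simp: \<theta>_def)
    finally have "(1 - d) * (1 - d) \<le> stay_prob n (\<lambda>_. ball (2 * (Suc m * l))) \<one>" .
    moreover have "1 - \<delta> \<le> (1 - d) * (1 - d)" using d zero_le_square[of d] by (simp add: algebra_simps add_increasing2)
    moreover have "real (2 * (Suc m * l)) \<le> A * rate n"
    proof -
      have "real (2 * (Suc m * l)) \<le> 2 * (real M * (L * rate n + 1))"
        unfolding of_nat_mult using m(1) l by (intro mult_mono) auto
      also have "\<dots> \<le> 2 * (real M * (L * rate n + 2 * rate n))"
        using rate_ge[OF n] by (intro mult_left_mono) auto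
      also have "\<dots> \<le> A * rate n"
        using rate_nonneg[of n] by (simp add: A_def algebra_simps)
      finally show ?thesis .
    qed
    ultimately show ?thesis by (intro exI[of _ "2 * (Suc m * l)"]) auto
  qed
  moreover have "A > 0" using L by (simp add: A_def add_nonneg_pos)
  ultimately show ?thesis using that by blast
qed

end

section \<open>The pseudo-Poincare inequality\<close>

context critical_walk
begin

lemma nu_one_pos: "0 < pmf \<nu> \<one>"
proof -
  have "0 < cN / ((1 + real (len \<one>))\<^sup>2 * vol (len \<one>))"
    using cN_pos vol_pos[of 0] by simp
  then show ?thesis using step_lower[OF one_closed] by linarith
qed

text \<open>Adding a factor to a product of \<open>j\<close> factors with the weight \<open>1 / j\<close> in \<open>defect_mult\<close> turns the
  bound \<open>j\<^sup>2M\<close> into exactly \<open>(j + 1)\<^sup>2M\<close>.\<close>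

lemma defect_dilate:
  assumes M: "\<And>h. h \<in> ball t \<Longrightarrow> defect n h \<le> M"
    and g: "g \<in> ball (j * t)"
  shows "defect n g \<le> (real j)\<^sup>2 * M"
  using g
proof (induction j arbitrary: g)
  case 0
  then have "g = \<one>" using len_eq_0_iff by (auto simp: ball_def)
  then show ?case by simp
next
  case (Suc j)
  show ?case
  proof (cases "j = 0")
    case True
    then show ?thesis using M Suc.prems by simp
  next
    case False
    have "g \<in> carrier G" "len g \<le> j * t + t" using Suc.prems by (auto simp: ball_def)
    then obtain a b where ab: "a \<in> carrier G" "b \<in> carrier G" "g = a \<otimes> b" "len a \<le> j * t" "len b \<le> t"
      using geodesic_split_le by metis
    have "defect n g \<le> (1 + 1 / real j) * defect n a + (1 + 1 / (1 / real j)) * defect n b"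
      unfolding ab(3) using ab(1,2) False by (intro defect_mult) auto
    also have "\<dots> \<le> (1 + 1 / real j) * ((real j)\<^sup>2 * M) + (1 + 1 / (1 / real j)) * M"
      using Suc.IH[of a] M[of b] ab by (intro add_mono mult_left_mono) (auto simp: ball_def)
    also have "\<dots> = (real (Suc j))\<^sup>2 * M"
      using False by (simp add: power2_eq_square field_simps)
    finally show ?thesis .
  qed
qed

definition shell :: "nat \<Rightarrow> 'a set" where
  "shell t = {k \<in> ball (5 * t). t \<le> len k}"

text \<open>Translating the ball of radius \<open>t\<close> to a centre at distance \<open>3t\<close> puts it into the shell; every
  \<open>h\<close> of length at most \<open>t\<close> is a quotient of two elements of the shell in as many ways as the ball
  has elements.\<close>

lemma defect_shell_average:
  assumes inf: "infinite (carrier G)" and h: "h \<in> ball t"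
  shows "vol t * defect n h \<le> 4 * (\<Sum>k\<in>shell t. defect n k)"
proof -
  obtain w where w: "w \<in> carrier G" "len w = 3 * t" using length_attained[OF inf] by blast
  have hc: "h \<in> carrier G" "len h \<le> t" using h by (auto simp: ball_def)
  let ?k = "\<lambda>z. w \<otimes> z" and ?k' = "\<lambda>z. h \<otimes> inv (w \<otimes> z)"
  have fin: "finite (shell t)" unfolding shell_def using finite_ball by simp
  have zc: "z \<in> carrier G" "len z \<le> t" if "z \<in> ball t" for z using that by (auto simp: ball_def)
  have k: "?k z \<in> carrier G" "2 * t \<le> len (?k z)" "len (?k z) \<le> 4 * t" if "z \<in> ball t" for z
    using zc[OF that] w len_mult[of w z] len_mult_ge(1)[of w z] by auto
  have k': "?k' z \<in> shell t" if "z \<in> ball t" for z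
    using k[OF that] hc len_mult[of h "inv (?k z)"] len_mult_ge(2)[of h "inv (?k z)"]
    by (auto simp: shell_def ball_def)
  have inj: "inj_on ?k (ball t)" using w zc by (auto intro!: inj_onI)
  have inj': "inj_on ?k' (ball t)"
  proof (rule inj_onI)
    fix y z assume yz: "y \<in> ball t" "z \<in> ball t" and eq: "h \<otimes> inv (w \<otimes> y) = h \<otimes> inv (w \<otimes> z)"
    then have "inv (w \<otimes> y) = inv (w \<otimes> z)" using hc k(1) by simp
    then have "w \<otimes> y = w \<otimes> z" using inj_onD[OF inv_inj] k(1) yz by blast
    then show "y = z" using w zc yz by simp
  qed
  have "vol t * defect n h = (\<Sum>z\<in>ball t. defect n h)" by (simp add: vol_of_nat)
  also have "\<dots> \<le> (\<Sum>z\<in>ball t. 2 * defect n (?k' z) + 2 * defect n (?k z))"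
  proof (rule sum_mono)
    fix z assume z: "z \<in> ball t"
    have "h = ?k' z \<otimes> ?k z" using k(1)[OF z] hc by (simp add: m_assoc)
    then show "defect n h \<le> 2 * defect n (?k' z) + 2 * defect n (?k z)"
      using defect_mult[of "?k' z" "?k z" 1 n] k(1)[OF z] hc by simp
  qed
  also have "\<dots> = 2 * (\<Sum>k\<in>?k' ` ball t. defect n k) + 2 * (\<Sum>k\<in>?k ` ball t. defect n k)"
    by (simp add: sum.reindex[OF inj] sum.reindex[OF inj'] sum.distrib sum_distrib_left)
  also have "\<dots> \<le> 2 * (\<Sum>k\<in>shell t. defect n k) + 2 * (\<Sum>k\<in>shell t. defect n k)"
  proof (intro add_mono mult_left_mono sum_mono2 fin)
    show "?k' ` ball t \<subseteq> shell t" using k' by blast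
    show "?k ` ball t \<subseteq> shell t"
    proof
      fix x assume "x \<in> ?k ` ball t"
      then obtain z where "z \<in> ball t" "x = ?k z" by blast
      then show "x \<in> shell t" using k[of z] by (simp add: shell_def ball_def)
    qed
  qed (auto simp: shell_def ball_def defect_nonneg)
  finally show ?thesis by simp
qed

definition pp_const :: real where
  "pp_const = 144 * K * 5 powr D / cN"

lemma pp_const_pos: "0 < pp_const"
  using K_ge_1 cN_pos by (simp add: pp_const_def)

text \<open>On the shell the step distribution is at least of order \<open>1 / (t\<^sup>2 V(t))\<close>, so the unweighted average of
  the defect is at most of order \<open>t\<^sup>2\<close> times its \<open>\<nu>\<close>-weighted sum.\<close>

lemma defect_shell:
  assumes inf: "infinite (carrier G)" and t: "t \<ge> 1" and h: "h \<in> ball t"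
  shows "defect n h \<le> pp_const * (real t)\<^sup>2 * (\<Sum>k\<in>shell t. pmf \<nu> k * defect n k)"
proof -
  define c where "c = 36 * (real t)\<^sup>2 * (K * 5 powr D * vol t) / cN"
  have v: "0 < vol t" by (simp add: vol_pos)
  have c: "0 < c" using t v K_ge_1 cN_pos by (simp add: c_def)
  have "defect n k \<le> c * (pmf \<nu> k * defect n k)" if k: "k \<in> shell t" for k
  proof -
    have kc: "k \<in> carrier G" "t \<le> len k" "len k \<le> 5 * t" using k by (auto simp: shell_def ball_def)
    have "vol (len k) \<le> vol (5 * real t)" using kc by (intro vol_mono) linarith
    also have "\<dots> \<le> K * 5 powr D * vol t" using doubling[of 5 t] by simp
    finally have "(1 + real (len k))\<^sup>2 * vol (len k) \<le> (6 * real t)\<^sup>2 * (K * 5 powr D * vol t)"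
      using kc t vol_pos[of "len k"] by (intro mult_mono power_mono) auto
    then have "cN / ((6 * real t)\<^sup>2 * (K * 5 powr D * vol t)) \<le> cN / ((1 + real (len k))\<^sup>2 * vol (len k))"
      using cN_pos vol_pos[of "len k"] v K_ge_1 t by (intro divide_left_mono mult_pos_pos) auto
    then have "1 / c \<le> pmf \<nu> k"
      using step_lower[OF kc(1)] by (simp add: c_def power_mult_distrib)
    then have "1 / c * defect n k \<le> pmf \<nu> k * defect n k"
      using defect_nonneg[OF kc(1)] by (intro mult_right_mono) auto
    then show ?thesis using c by (simp add: field_simps)
  qed
  then have "(\<Sum>k\<in>shell t. defect n k) \<le> c * (\<Sum>k\<in>shell t. pmf \<nu> k * defect n k)"
    unfolding sum_distrib_left by (rule sum_mono)
  then have "vol t * defect n h \<le> 4 * (c * (\<Sum>k\<in>shell t. pmf \<nu> k * defect n k))"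
    using defect_shell_average[OF inf h, of n] by linarith
  also have "\<dots> = vol t * (pp_const * (real t)\<^sup>2 * (\<Sum>k\<in>shell t. pmf \<nu> k * defect n k))"
    by (simp add: c_def pp_const_def)
  finally show ?thesis using v by simp
qed

abbreviation energy :: "nat \<Rightarrow> real" where
  "energy n \<equiv> p (2 * n) \<one> - p (Suc (2 * n)) \<one>"

lemma energy_nonneg: "0 \<le> energy n"
  using finite_sum_defect_le[of "{}" n] by simp

text \<open>Each of the disjoint shells at the scales \<open>6\<^sup>i \<le> s\<close> alone yields the bound \<open>s\<^sup>2\<close> times its share
  of the energy; adding up gains the number of scales, that is a logarithm.\<close>

lemma pseudo_poincare_scales:
  assumes inf: "infinite (carrier G)" and I: "6 ^ I \<le> s" and g: "g \<in> ball s"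
  shows "real (Suc I) * defect n g \<le> 4 * pp_const * (real s)\<^sup>2 * energy n"
proof -
  let ?S = "\<lambda>t. \<Sum>k\<in>shell t. pmf \<nu> k * defect n k"
  have S_nonneg: "0 \<le> ?S t" for t
    by (intro sum_nonneg mult_nonneg_nonneg defect_nonneg) (auto simp: shell_def ball_def)
  have one: "defect n g \<le> 4 * pp_const * (real s)\<^sup>2 * ?S (6 ^ i)" if i: "i \<le> I" for i
  proof -
    define t where "t = (6::nat) ^ i"
    have t: "t \<ge> 1" by (simp add: t_def)
    have "6 ^ i \<le> (6 :: nat) ^ I" using i by (intro power_increasing) auto
    with I have ts: "t \<le> s" unfolding t_def by linarith
    define j where "j = s div t + 1"
    have "s < j * t" unfolding j_def using t
dividend_less_div_times[of t s] by simp
    then have g': "g \<in> ball (j * t)" using g ball_mono[of s "j * t"] by auto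
    have "j * t \<le> 2 * s"
      unfolding j_def add_mult_distrib using ts div_times_less_eq_dividend[of s t] by linarith
    then have "real (j * t) \<le> real (2 * s)" by (rule of_nat_mono)
    then have jt: "real j * real t \<le> 2 * real s" by simp
    have "defect n g \<le> (real j)\<^sup>2 * (pp_const * (real t)\<^sup>2 * ?S t)"
      by (rule defect_dilate[OF defect_shell[OF inf t] g'])
    also have "\<dots> = (real j * real t)\<^sup>2 * (pp_const * ?S t)"
      by (simp add: power_mult_distrib)
    also have "\<dots> \<le> (2 * real s)\<^sup>2 * (pp_const * ?S t)"
      using jt pp_const_pos S_nonneg by (intro mult_right_mono power_mono) auto
    finally show ?thesis by (simp add: power_mult_distrib t_def mult_ac)
  qed
  \<comment> \<open>The ratio 6 exceeds the ratio 5 between the radii of a shell.\<close>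
  have disj: "shell (6 ^ i) \<inter> shell (6 ^ j) = {}" if "i < j" for i j :: nat
  proof -
    have "5 * (6::nat) ^ i < 6 ^ j"
    proof -
      have "5 * (6::nat) ^ i < 6 ^ Suc i" by simp
      also have "\<dots> \<le> 6 ^ j" using that by (intro power_increasing) auto
      finally show ?thesis .
    qed
    then show ?thesis by (auto simp: shell_def ball_def)
  qed
  have "real (Suc I) * defect n g = (\<Sum>i\<in>{..I}. defect n g)" by simp
  also have "\<dots> \<le> (\<Sum>i\<in>{..I}. 4 * pp_const * (real s)\<^sup>2 * ?S (6 ^ i))"
    using one by (intro sum_mono) auto
  also have "\<dots> = 4 * pp_const * (real s)\<^sup>2 * (\<Sum>i\<in>{..I}. ?S (6 ^ i))"
    by (simp add: sum_distrib_left)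
  also have "(\<Sum>i\<in>{..I}. ?S (6 ^ i)) = (\<Sum>k\<in>(\<Union>i\<in>{..I}. shell (6 ^ i)). pmf \<nu> k * defect n k)"
  proof (rule sum.UNION_disjoint[symmetric])
    show "\<forall>i\<in>{..I}. \<forall>j\<in>{..I}. i \<noteq> j \<longrightarrow> shell (6 ^ i) \<inter> shell (6 ^ j) = {}"
      using disj by (metis inf_commute linorder_neqE_nat)
  qed (auto simp: shell_def finite_ball)
  also have "\<dots> \<le> energy n"
    by (rule finite_sum_defect_le) (auto simp: shell_def ball_def intro!: finite_subset[OF _ finite_ball])
  finally show ?thesis using pp_const_pos by (simp add: mult_left_mono)
qed

lemma pseudo_poincare:
  assumes inf: "infinite (carrier G)" and s: "1 \<le> s" and g: "g \<in> carrier G" "real (len g) \<le> s"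
  shows "ln s * defect n g \<le> 20 * pp_const * s\<^sup>2 * energy n"
proof -
  define s' where "s' = nat \<lfloor>s\<rfloor>"
  have s': "1 \<le> s'" "real s' \<le> s" "s < real s' + 1" "len g \<le> s'"
    using s g by (auto simp: s'_def le_nat_iff le_floor_iff)
  obtain I where I: "6 ^ I \<le> s'" "s' < 6 ^ (I + 1)"
    using ex_power_ivl1[of 6 s'] s'(1) by auto
  have "s' + 1 \<le> 6 ^ Suc I" using I(2) by simp
  then have "real s' + 1 \<le> 6 ^ Suc I" using of_nat_mono[of "s' + 1" "6 ^ Suc I", where 'a = real] by simp
  then have "s \<le> 6 ^ Suc I" using s'(3) by linarith
  then have "ln s \<le> ln (6 ^ Suc I)" using s by simp
  also have "\<dots> = real (Suc I) * ln 6" by (simp add: ln_realpow del: power_Suc)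
  \<comment> \<open>The crude bound \<open>ln 6 \<le> 5\<close> is the source of the factor 5 between the constants.\<close>
  also have "\<dots> \<le> real (Suc I) * 5" using ln_le_minus_one[of "6::real"] by (intro mult_left_mono) auto
  finally have "ln s * defect n g \<le> (real (Suc I) * 5) * defect n g"
    using defect_nonneg[OF g(1)] by (intro mult_right_mono) auto
  also have "\<dots> \<le> 5 * (4 * pp_const * (real s')\<^sup>2 * energy n)"
  proof -
    have "real (Suc I) * defect n g \<le> 4 * pp_const * (real s')\<^sup>2 * energy n"
      using s' g by (intro pseudo_poincare_scales[OF inf I(1)]) (simp add: ball_def)
    then show ?thesis by linarith
  qed
  also have "\<dots> \<le> 5 * (4 * pp_const * s\<^sup>2 * energy n)"
    using pp_const_pos energy_nonneg[of n] s'
    by (intro mult_left_mono mult_right_mono power_mono) auto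
  finally show ?thesis by simp
qed

end

section \<open>The upper bound on the return probability\<close>

text \<open>Bernoulli's inequality \<open>1 + jn \<le> (1 + n)\<^sup>j\<close> bounds the logarithm at time \<open>jn\<close>.\<close>

lemma rate_mult: "j \<ge> 1 \<Longrightarrow> rate (j * n) \<le> real j * rate n"
proof -
  assume j: "j \<ge> 1"
  have "1 + real j * real n \<le> (1 + real n) ^ j" by (rule Bernoulli_inequality) simp
  then have "ln (1 + real j * real n) \<le> ln ((1 + real n) ^ j)"
    by (subst ln_le_cancel_iff) (auto simp: add_pos_nonneg)
  also have "\<dots> = real j * ln (1 + real n)" by (simp add: ln_realpow)
  finally have "(real j * real n) * ln (real j * real n + 1) \<le> (real j * real n) * (real j * ln (real n + 1))"
    by (intro mult_left_mono) (auto simp: add.commute)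
  then have "(rate (j * n))\<^sup>2 \<le> (real j * rate n)\<^sup>2"
    unfolding power_mult_distrib rate_sq by (simp add: power2_eq_square mult_ac)
  then show ?thesis by (rule power2_le_imp_le) (simp add: rate_nonneg)
qed

text \<open>Up to lower order terms \<open>ln (d R(n))\<close> is half of \<open>ln n\<close>, so any constant below one half would do
  in place of one quarter.\<close>

lemma eventually_ln_rate:
  assumes "d > 0"
  shows "\<forall>\<^sub>F n in sequentially. 2 \<le> d * rate n \<and> ln (real n + 1) / 4 \<le> ln (d * rate n)"
proof (rule eventually_conj)
  show "\<forall>\<^sub>F n in sequentially. 2 \<le> d * rate n"
    unfolding rate_def using assms by real_asymp
  show "\<forall>\<^sub>F n in sequentially. ln (real n + 1) / 4 \<le> ln (d * rate n)"
    unfolding rate_def using assms by real_asymp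
qed

context critical_walk
begin

abbreviation return_prob :: "nat \<Rightarrow> real" where
  "return_prob n \<equiv> p (2 * n) \<one>"

lemma return_prob_antimono: "m \<le> n \<Longrightarrow> return_prob n \<le> return_prob m"
  by (intro p_le_return) auto

lemma energy_le: "energy n \<le> (return_prob n - return_prob (Suc n)) / pmf \<nu> \<one>"
  using two_step_decrement[of n] nu_one_pos by (simp add: pos_le_divide_eq mult.commute)

definition nash_const :: real where
  "nash_const = 20 * pp_const / pmf \<nu> \<one>"

lemma nash_const_pos: "0 < nash_const"
  using pp_const_pos nu_one_pos by (simp add: nash_const_def)

lemma defect_decrement:
  assumes inf: "infinite (carrier G)" and s: "1 \<le> s" and g: "g \<in> carrier G" "real (len g) \<le> s"
  shows "ln s * defect n g \<le> nash_const * s\<^sup>2 * (return_prob n - return_prob (Suc n))"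
proof -
  have "ln s * defect n g \<le> 20 * pp_const * s\<^sup>2 * energy n"
    by (rule pseudo_poincare[OF assms])
  also have "\<dots> \<le> 20 * pp_const * s\<^sup>2 * ((return_prob n - return_prob (Suc n)) / pmf \<nu> \<one>)"
    using energy_le pp_const_pos by (intro mult_left_mono) auto
  finally show ?thesis by (simp add: nash_const_def)
qed

text \<open>Averaging the defect over a ball of radius \<open>s\<close>, on which the density has total mass at most 1,
  turns the pseudo-Poincare inequality into a Nash inequality for the return probability.\<close>

lemma return_prob_nash:
  assumes inf: "infinite (carrier G)" and s: "2 \<le> s"
  shows "return_prob n \<le> 1 / vol s + nash_const * (s\<^sup>2 / ln s) * (return_prob n - return_prob (Suc n))"
proof -
  let ?B = "ball (nat \<lfloor>s\<rfloor>)" and ?X = "nash_const * (s\<^sup>2 / ln s) * (return_prob n - return_prob (Suc n))"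
  have v: "vol s = real (card ?B)" "0 < vol s" using s vol_pos[of s] by (simp_all add: vol_eq_card_ball)
  have ln: "0 < ln s" using s by simp
  have "vol s * return_prob n - (\<Sum>g\<in>?B. p (2 * n) g) = (\<Sum>g\<in>?B. defect n g)"
    by (simp add: defect_def sum_subtractf v(1))
  also have "\<dots> \<le> (\<Sum>g\<in>?B. ?X)"
  proof (rule sum_mono)
    fix g assume "g \<in> ?B"
    then have "g \<in> carrier G" "real (len g) \<le> s" using s by (auto simp: ball_def le_nat_iff le_floor_iff)
    then have "ln s * defect n g \<le> nash_const * s\<^sup>2 * (return_prob n - return_prob (Suc n))"
      using s by (intro defect_decrement[OF inf]) auto
    then show "defect n g \<le> ?X" using ln by (simp add: field_simps)
  qed
  also have "\<dots> = vol s * ?X" by (simp add: v(1))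
  finally have "vol s * return_prob n \<le> 1 + vol s * ?X"
    using sum_p_le_1[OF finite_ball, of "2 * n" "nat \<lfloor>s\<rfloor>"] by linarith
  then have "return_prob n \<le> (1 + vol s * ?X) / vol s"
    using v(2) by (simp add: pos_le_divide_eq mult.commute)
  then show ?thesis using v(2) by (simp add: add_divide_distrib)
qed

text \<open>Summing Nash's inequality over the times from \<open>n\<close> to \<open>2n\<close>. With \<open>s\<close> a small multiple of the
  scale at time \<open>n\<close>, the factor in front of the return probability at time \<open>n\<close> is small.\<close>

lemma return_prob_double:
  assumes inf: "infinite (carrier G)" and n: "n \<ge> 1" and d: "d > 0"
    and s: "2 \<le> d * rate n" "ln (real n + 1) / 4 \<le> ln (d * rate n)"
  shows "return_prob (2 * n) \<le> 1 / vol (d * rate n) + 4 * nash_const * d\<^sup>2 * return_prob n"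
proof -
  define s where "s = d * rate n"
  define X where "X = nash_const * (s\<^sup>2 / ln s)"
  have lnpos: "0 < ln (real n + 1)" using ln_Suc_bounds(1)[OF n] by linarith
  have s2: "2 \<le> s" "ln (real n + 1) / 4 \<le> ln s" using assms by (auto simp: s_def)
  have "s\<^sup>2 / ln s \<le> s\<^sup>2 / (ln (real n + 1) / 4)"
    using s2 lnpos by (intro divide_left_mono) auto
  also have "\<dots> = 4 * d\<^sup>2 * real n" using lnpos by (simp add: s_def power_mult_distrib rate_sq)
  finally have X: "0 \<le> X" "X \<le> 4 * nash_const * d\<^sup>2 * real n"
    using nash_const_pos s2 mult_left_mono[of "s\<^sup>2 / ln s" "4 * d\<^sup>2 * real n" nash_const] by (auto simp: X_def)
  have "real n * return_prob (2 * n) = (\<Sum>k\<in>{n..<2 * n}. return_prob (2 * n))" by simp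
  also have "\<dots> \<le> (\<Sum>k\<in>{n..<2 * n}. return_prob k)"
    by (intro sum_mono return_prob_antimono) auto
  also have "\<dots> \<le> (\<Sum>k\<in>{n..<2 * n}. 1 / vol s + X * (return_prob k - return_prob (Suc k)))"
    unfolding X_def by (intro sum_mono return_prob_nash inf s2)
  also have "\<dots> = real n * (1 / vol s) + X * (\<Sum>k\<in>{n..<2 * n}. return_prob k - return_prob (Suc k))"
    by (simp add: sum.distrib sum_distrib_left)
  also have "(\<Sum>k\<in>{n..<2 * n}. return_prob k - return_prob (Suc k)) = return_prob n - return_prob (2 * n)"
    using sum_Suc_diff'[of n "2 * n" "\<lambda>k. - return_prob k"] by simp
  also have "real n * (1 / vol s) + X * (return_prob n - return_prob (2 * n)) \<le>
      real n * (1 / vol s) + (4 * nash_const * d\<^sup>2 * real n) * return_prob n"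
    using X p_bounds(1)[of "2 * (2 * n)" \<one>] return_prob_antimono[of n "2 * n"]
    by (intro add_left_mono mult_mono) linarith+
  also have "\<dots> = real n * (1 / vol s + 4 * nash_const * d\<^sup>2 * return_prob n)"
    by (simp add: algebra_simps)
  finally show ?thesis using n by (simp add: s_def)
qed

text \<open>The product \<open>w(n) = p\<^sub>2\<^sub>n(e) V(R(n))\<close> satisfies \<open>w(m) \<le> C + w(n) / 2\<close> for \<open>m = 2n\<close> and \<open>m = 2n + 1\<close>,
  hence is bounded. The volume at time \<open>4n\<close> in the recursion is there to cover both values of \<open>m\<close>.\<close>

theorem return_prob_upper:
  assumes inf: "infinite (carrier G)"
  obtains W where "W > 0" "\<And>n. n \<ge> 1 \<Longrightarrow> return_prob n * vol (rate n) \<le> W"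
proof -
  \<comment> \<open>\<open>Q\<close> pays for passing from time \<open>4n\<close> to time \<open>n\<close> in the volume; \<open>d\<close> is chosen such that, with
    this loss, the recursion still contracts by one half.\<close>
  define Q where "Q = K * 4 powr D"
  have Q: "1 \<le> Q" using K_ge_1 D_nonneg ge_one_powr_ge_zero[of 4 D] mult_mono[of 1 K 1 "4 powr D"] by (simp add: Q_def)
  define q where "q = sqrt (1 + 8 * nash_const * Q)"
  define d where "d = 1 / q"
  have pos: "1 \<le> 1 + 8 * nash_const * Q" using nash_const_pos Q by simp
  then have "1 \<le> q" unfolding q_def by (subst real_sqrt_ge_1_iff)
  then have d: "0 < d" "d \<le> 1" by (auto simp: d_def divide_le_eq_1)
  have d2: "4 * nash_const * d\<^sup>2 * Q \<le> 1 / 2"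
  proof -
    define x where "x = 8 * nash_const * Q"
    have x: "0 \<le> x" using pos by (simp add: x_def)
    then have "d\<^sup>2 = 1 / (1 + x)" by (simp add: d_def q_def x_def power_divide)
    then have "4 * nash_const * d\<^sup>2 * Q = (x / 2) / (1 + x)" by (simp add: x_def)
    also have "\<dots> \<le> 1 / 2" using x by (simp add: pos_divide_le_eq)
    finally show ?thesis .
  qed
  obtain N where N: "\<And>n. n \<ge> N \<Longrightarrow> 2 \<le> d * rate n \<and> ln (real n + 1) / 4 \<le> ln (d * rate n)"
    using eventually_ln_rate[OF d(1)] by (auto simp: eventually_sequentially)
  define C where "C = max (Q * (K * (1 / d) powr D)) (vol (4 * real N))"
  have C: "0 < C" unfolding C_def using vol_pos[of "4 * real N"] by (auto simp: less_max_iff_disj)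
  have step: "return_prob (2 * n) * vol (rate (4 * n)) \<le> C + 1 / 2 * (return_prob n * vol (rate n))"
    if n: "n \<ge> 1" for n
  proof (cases "n \<ge> N")
    case True
    have v: "0 < vol (rate n)" "0 < vol (d * rate n)" using vol_pos rate_nonneg d by auto
    have "vol (rate (4 * n)) \<le> vol (4 * rate n)" using rate_mult[of 4 n] by (intro vol_mono) auto
    also have "\<dots> \<le> Q * vol (rate n)" using doubling[of 4 "rate n"] rate_nonneg by (simp add: Q_def)
    finally have v4: "vol (rate (4 * n)) \<le> Q * vol (rate n)" .
    have "vol (rate n) \<le> K * (1 / d) powr D * vol (d * rate n)"
      using doubling[of "1 / d" "d * rate n"] d rate_nonneg by simp
    then have vd: "vol (rate n) / vol (d * rate n) \<le> K * (1 / d) powr D"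
      using v by (simp add: pos_divide_le_eq)
    have "return_prob (2 * n) * vol (rate (4 * n)) \<le>
        (1 / vol (d * rate n) + 4 * nash_const * d\<^sup>2 * return_prob n) * (Q * vol (rate n))"
      using return_prob_double[OF inf n d(1)] N[OF True] v4 nash_const_pos v vol_pos[OF rate_nonneg]
      by (intro mult_mono add_nonneg_nonneg) (auto simp: less_imp_le)
    also have "\<dots> = Q * (vol (rate n) / vol (d * rate n)) +
        (4 * nash_const * d\<^sup>2 * Q) * (return_prob n * vol (rate n))"
      by (simp add: algebra_simps)
    also have "\<dots> \<le> Q * (K * (1 / d) powr D) + 1 / 2 * (return_prob n * vol (rate n))"
      using vd d2 Q v by (intro add_mono mult_left_mono mult_right_mono) auto
    finally show ?thesis by (simp add: C_def)
  next
    case False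
    have "rate (4 * n) \<le> 4 * real N" using rate_le[of "4 * n"] False by simp
    then have "vol (rate (4 * n)) \<le> vol (4 * real N)" by (rule vol_mono)
    then have "return_prob (2 * n) * vol (rate (4 * n)) \<le> 1 * vol (4 * real N)"
      using p_bounds vol_pos[OF rate_nonneg, of "4 * n"] by (intro mult_mono) auto
    then have "return_prob (2 * n) * vol (rate (4 * n)) \<le> C" by (simp add: C_def)
    then show ?thesis using vol_pos[OF rate_nonneg, of n] by (simp add: add_increasing2)
  qed
  define W where "W = max (2 * C) (return_prob 1 * vol (rate 1))"
  have "return_prob n * vol (rate n) \<le> W" if "n \<ge> 1" for n
    using that
  proof (induction n rule: less_induct)
    case (less n)
    show ?case
    proof (cases "n = 1")
      case True
      then show ?thesis by (simp add: W_def)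
    next
      case False
      define m where "m = n div 2"
      have m: "m \<ge> 1" "m < n" "2 * m \<le> n" "n \<le> 4 * m" using False less.prems by (auto simp: m_def)
      have "return_prob n * vol (rate n) \<le> return_prob (2 * m) * vol (rate (4 * m))"
        using m vol_pos[OF rate_nonneg, of n] by (intro mult_mono return_prob_antimono vol_mono rate_mono) auto
      also have "\<dots> \<le> C + 1 / 2 * W" using step[OF m(1)] less.IH[OF m(2,1)] by linarith
      also have "\<dots> \<le> W" by (simp add: W_def)
      finally show ?thesis .
    qed
  qed
  moreover have "W > 0" using C by (simp add: W_def less_max_iff_disj)
  ultimately show ?thesis using that by blast
qed

end

section \<open>Two-sided bounds at the scale of the walk\<close>

context critical_walk
begin

lemma vol_scale:
  assumes "0 < a" "0 \<le> s" "0 \<le> t" "s \<le> a * t"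
  shows "vol s \<le> K * (max 1 a) powr D * vol t"
proof -
  have "s \<le> max 1 a * t" using assms mult_right_mono[of a "max 1 a" t] by linarith
  then have "vol s \<le> vol (max 1 a * t)" by (rule vol_mono)
  also have "\<dots> \<le> K * (max 1 a) powr D * vol t" using assms by (intro doubling) auto
  finally show ?thesis .
qed

lemma doubling_const_pos: "0 < K * (max 1 a) powr D"
  using K_ge_1 by (auto simp: less_max_iff_disj)

text \<open>At least half of the mass lies in a ball of radius comparable with \<open>R(n)\<close>; by the
  Cauchy--Schwarz inequality the sum \<open>p\<^sub>2\<^sub>n(e)\<close> of the squares is at least a quarter of the inverse of
  its volume. A lazy step reaches the odd times.\<close>

theorem return_lower:
  obtains c where "c > 0" "\<And>m. m \<ge> 1 \<Longrightarrow> c \<le> p m \<one> * vol (rate m)"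
proof -
  obtain A where A: "A > 0"
    "\<And>n. n \<ge> 1 \<Longrightarrow> \<exists>R. real R \<le> A * rate n \<and> 1 - 1 / 2 \<le> stay_prob n (\<lambda>_. ball R) \<one>"
    using confinement[of "1 / 2"] by (metis half_gt_zero zero_less_one)
  define Q where "Q = K * (max 1 A) powr D"
  have Q: "0 < Q" unfolding Q_def by (rule doubling_const_pos)
  have even: "1 / (4 * Q) \<le> return_prob n * vol (rate n)" if n: "n \<ge> 1" for n
  proof -
    obtain R where R: "real R \<le> A * rate n" "1 / 2 \<le> stay_prob n (\<lambda>_. ball R) \<one>" using A(2)[OF n] by auto
    have "(1 / 2)\<^sup>2 \<le> (\<Sum>y\<in>ball R. 1 * p n y)\<^sup>2"
      using R(2) stay_prob_ball_le_sum[of n R] by (intro power_mono) auto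
    also have "\<dots> \<le> (\<Sum>y\<in>ball R. 1\<^sup>2) * (\<Sum>y\<in>ball R. (p n y)\<^sup>2)"
      by (rule Cauchy_Schwarz_ineq_sum)
    also have "(\<Sum>y\<in>ball R. (p n y)\<^sup>2) = (\<Sum>y\<in>ball R. p n y * p n (inv y \<otimes> \<one>))"
      by (intro sum.cong refl) (auto simp: power2_eq_square ball_def p_inv)
    also have "(\<Sum>y\<in>ball R. 1\<^sup>2) * \<dots> \<le> vol R * return_prob n"
      using p_add_ge_sum[OF finite_ball one_closed, where m = n and n = n]
      by (simp add: vol_of_nat mult_2 mult_left_mono)
    also have "\<dots> \<le> Q * vol (rate n) * return_prob n"
      unfolding Q_def using R A rate_nonneg p_bounds by (intro mult_right_mono vol_scale) auto
    finally show ?thesis using Q by (simp add: field_simps power2_eq_square)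
  qed
  define c where "c = pmf \<nu> \<one> * min 1 (1 / (4 * Q))"
  have nu: "0 < pmf \<nu> \<one>" "pmf \<nu> \<one> \<le> 1" using nu_one_pos pmf_le_1 by auto
  have "c \<le> p m \<one> * vol (rate m)" if m: "m \<ge> 1" for m
  proof (cases "m = 1")
    case True
    have "c \<le> pmf \<nu> \<one> * 1" unfolding c_def using nu by (intro mult_left_mono) auto
    also have "\<dots> \<le> pmf \<nu> \<one> * vol (rate m)" using nu vol_ge_1[OF rate_nonneg] by (intro mult_left_mono) auto
    finally show ?thesis using True by (simp add: p_1)
  next
    case False
    define n where "n = m div 2"
    have n: "n \<ge> 1" using False m by (auto simp: n_def)
    have mn: "m = 2 * n + m mod 2" by (simp add: n_def)
    have "c \<le> pmf \<nu> \<one> * (return_prob n * vol (rate n))"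
      unfolding c_def using nu even[OF n] by (intro mult_left_mono) auto
    also have "\<dots> \<le> pmf \<nu> \<one> ^ (m mod 2) * (return_prob n * vol (rate m))"
    proof (intro mult_mono vol_mono rate_mono)
      show "pmf \<nu> \<one> \<le> pmf \<nu> \<one> ^ (m mod 2)"
        using nu power_decreasing[of "m mod 2" 1 "pmf \<nu> \<one>"] by simp
    qed (use nu p_bounds vol_pos[OF rate_nonneg] mn in \<open>auto simp: less_imp_le\<close>)
    also have "\<dots> = (pmf \<nu> \<one> ^ (m mod 2) * return_prob n) * vol (rate m)" by simp
    also have "\<dots> \<le> p (2 * n + m mod 2) \<one> * vol (rate m)"
      using vol_pos[OF rate_nonneg] by (intro mult_right_mono p_ge_lazy) (auto simp: less_imp_le)
    finally show ?thesis using mn by simp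
  qed
  moreover have "c > 0" using nu Q by (simp add: c_def)
  ultimately show ?thesis using that by blast
qed

lemma p_upper_infinite:
  assumes inf: "infinite (carrier G)"
  obtains C where "C > 0" "\<And>m g. m \<ge> 1 \<Longrightarrow> g \<in> carrier G \<Longrightarrow> p m g * vol (rate m) \<le> C"
proof -
  obtain W where W: "W > 0" "\<And>n. n \<ge> 1 \<Longrightarrow> return_prob n * vol (rate n) \<le> W"
    using return_prob_upper[OF inf] by blast
  define C where "C = max (vol (rate 1)) (K * (max 1 4) powr D * W)"
  have "p m g * vol (rate m) \<le> C" if m: "m \<ge> 1" and g: "g \<in> carrier G" for m g
  proof (cases "m = 1")
    case True
    have "p m g * vol (rate m) \<le> 1 * vol (rate m)"
      using p_bounds vol_pos[OF rate_nonneg, of m] by (intro mult_right_mono) auto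
    then show ?thesis using True by (simp add: C_def)
  next
    case False
    define n where "n = m div 2"
    have n: "n \<ge> 1" "2 * n \<le> m" "m \<le> 4 * n" using False m by (auto simp: n_def)
    have "rate m \<le> 4 * rate n" using rate_mono[OF n(3)] rate_mult[of 4 n] by simp
    then have "vol (rate m) \<le> K * (max 1 4) powr D * vol (rate n)"
      by (intro vol_scale) (auto simp: rate_nonneg)
    then have "p m g * vol (rate m) \<le> return_prob n * (K * (max 1 4) powr D * vol (rate n))"
      using p_le_return[OF g n(2)] p_bounds vol_pos[OF rate_nonneg, of m] by (intro mult_mono) auto
    also have "\<dots> = K * (max 1 4) powr D * (return_prob n * vol (rate n))" by simp
    also have "\<dots> \<le> K * (max 1 4) powr D * W"
      using W(2)[OF n(1)] doubling_const_pos[of 4] by (intro mult_left_mono) auto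
    finally show ?thesis by (simp add: C_def)
  qed
  moreover have "C > 0" using vol_pos[OF rate_nonneg, of 1] by (simp add: C_def less_max_iff_disj)
  ultimately show ?thesis using that by blast
qed

text \<open>At some time between \<open>m / 4\<close> and \<open>m / 2\<close> the return probability decreases no faster than on
  average; there the defect, and hence the oscillation of the density at time \<open>m\<close>, is small
  compared with the return probability.\<close>

lemma near_diagonal_lower:
  assumes inf: "infinite (carrier G)"
  obtains \<eta> c m0 where "\<eta> > 0" "c > 0"
    "\<And>m g. m \<ge> m0 \<Longrightarrow> g \<in> carrier G \<Longrightarrow> real (len g) \<le> \<eta> * rate m \<Longrightarrow> c \<le> p m g * vol (rate m)"
proof -
  obtain W where W: "W > 0" "\<And>n. n \<ge> 1 \<Longrightarrow> return_prob n * vol (rate n) \<le> W"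
    using return_prob_upper[OF inf] by blast
  obtain c where c: "c > 0" "\<And>m. m \<ge> 1 \<Longrightarrow> c \<le> p m \<one> * vol (rate m)"
    using return_lower by blast
  define Q where "Q = K * (max 1 8) powr D * W"
  have Q: "Q > 0" unfolding Q_def by (rule mult_pos_pos[OF doubling_const_pos W(1)])
  define B where "B = 32 * nash_const"
  have B: "B > 0" using nash_const_pos by (simp add: B_def)
  define \<eta> where "\<eta> = c / (2 * ((1 + B) * Q))"
  have \<eta>: "\<eta> > 0" using c B Q by (simp add: \<eta>_def)
  obtain N where N: "\<And>n. n \<ge> N \<Longrightarrow> 2 \<le> \<eta> * rate n \<and> ln (real n + 1) / 4 \<le> ln (\<eta> * rate n)"
    using eventually_ln_rate[OF \<eta>] by (auto simp: eventually_sequentially)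
  have "c / 2 \<le> p m g * vol (rate m)"
    if m: "m \<ge> max N 4" and g: "g \<in> carrier G" "real (len g) \<le> \<eta> * rate m" for m g
  proof -
    define q where "q = m div 4"
    have q: "q \<ge> 1" "4 * q \<le> m" "m \<le> 8 * q" using m unfolding q_def max.bounded_iff by presburger+
    \<comment> \<open>The \<open>q\<close> decrements telescope to at most the return probability at time \<open>2q\<close>.\<close>
    have "\<exists>k\<in>{q..<2 * q}. return_prob k - return_prob (Suc k) \<le> return_prob q / real q"
    proof (rule ccontr)
      assume no: "\<not> ?thesis"
      have "return_prob q / real q < return_prob k - return_prob (Suc k)" if "k \<in> {q..<2 * q}" for k
        using no that by (meson not_le)
      then have "(\<Sum>k\<in>{q..<2 * q}. return_prob q / real q) < (\<Sum>k\<in>{q..<2 * q}. return_prob k - return_prob (Suc k))"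
        using q(1) by (intro sum_strict_mono) auto
      also have "\<dots> = return_prob q - return_prob (2 * q)"
        using sum_Suc_diff'[of q "2 * q" "\<lambda>k. - return_prob k"] by simp
      also have "\<dots> \<le> return_prob q" using p_bounds by simp
      finally show False using q by simp
    qed
    then obtain k where k: "q \<le> k" "k < 2 * q" "return_prob k - return_prob (Suc k) \<le> return_prob q / real q"
      by auto
    define s where "s = \<eta> * rate m"
    define L where "L = ln (real m + 1)"
    have L: "L > 0" using ln_Suc_bounds(1)[of m] m by (simp add: L_def)
    have s: "2 \<le> s" "L / 4 \<le> ln s" using N m by (auto simp: s_def L_def)
    have "L / 4 * defect k g \<le> ln s * defect k g"
      using s defect_nonneg[OF g(1)] by (intro mult_right_mono) auto
    also have "\<dots> \<le> nash_const * s\<^sup>2 * (return_prob k - return_prob (Suc k))"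
      using s g by (intro defect_decrement[OF inf]) (auto simp: s_def)
    also have "\<dots> \<le> nash_const * s\<^sup>2 * (return_prob q / real q)"
      using k nash_const_pos by (intro mult_left_mono) auto
    also have "s\<^sup>2 = \<eta>\<^sup>2 * real m * L" by (simp add: s_def power_mult_distrib rate_sq L_def)
    also have "nash_const * (\<eta>\<^sup>2 * real m * L) * (return_prob q / real q) =
        L / 4 * (4 * nash_const * \<eta>\<^sup>2 * (real m / real q) * return_prob q)" by simp
    finally have "defect k g \<le> 4 * nash_const * \<eta>\<^sup>2 * (real m / real q) * return_prob q"
      by (rule mult_left_le_imp_le) (use L in simp)
    also have "\<dots> \<le> 4 * nash_const * \<eta>\<^sup>2 * 8 * return_prob q"
    proof (intro mult_right_mono mult_left_mono)
      have "real m \<le> 8 * real q" using q(3) by linarith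
      then show "real m / real q \<le> 8" using q(1) by (simp add: pos_divide_le_eq)
    qed (use nash_const_pos p_bounds in auto)
    finally have dk: "defect k g \<le> B * \<eta>\<^sup>2 * return_prob q" by (simp add: B_def)
    have "\<bar>p m g - p m \<one>\<bar> \<le> \<eta> / 2 * return_prob k + defect k g / \<eta>"
      using k q by (intro p_regularity g \<eta>) auto
    also have "\<dots> \<le> \<eta> * return_prob q + B * \<eta> * return_prob q"
    proof (intro add_mono)
      show "\<eta> / 2 * return_prob k \<le> \<eta> * return_prob q"
        using return_prob_antimono[OF k(1)] \<eta> p_bounds by (intro mult_mono) auto
      show "defect k g / \<eta> \<le> B * \<eta> * return_prob q"
        using dk \<eta> by (simp add: pos_divide_le_eq power2_eq_square mult_ac)
    qed
    also have "\<dots> = \<eta> * (1 + B) * return_prob q" by (simp add: algebra_simps)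
    finally have osc: "\<bar>p m g - p m \<one>\<bar> \<le> \<eta> * (1 + B) * return_prob q" .
    have "rate m \<le> 8 * rate q" using rate_mono[OF q(3)] rate_mult[of 8 q] by simp
    then have "vol (rate m) \<le> K * (max 1 8) powr D * vol (rate q)"
      by (intro vol_scale) (auto simp: rate_nonneg)
    then have "return_prob q * vol (rate m) \<le> return_prob q * (K * (max 1 8) powr D * vol (rate q))"
      using p_bounds by (intro mult_left_mono) auto
    also have "\<dots> = K * (max 1 8) powr D * (return_prob q * vol (rate q))" by simp
    also have "\<dots> \<le> Q"
      unfolding Q_def using W(2)[OF q(1)] doubling_const_pos[of 8] by (intro mult_left_mono) auto
    finally have Qb: "return_prob q * vol (rate m) \<le> Q" .
    have v: "0 < vol (rate m)" using vol_pos rate_nonneg by blast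
    have "(p m \<one> - p m g) * vol (rate m) \<le> \<eta> * (1 + B) * return_prob q * vol (rate m)"
      using osc v by (intro mult_right_mono) linarith+
    also have "\<dots> \<le> \<eta> * (1 + B) * Q"
      using mult_left_mono[OF Qb, of "\<eta> * (1 + B)"] \<eta> B by (simp add: mult.assoc)
    also have "\<dots> = \<eta> * ((1 + B) * Q)" by simp
    also have "\<dots> = c / 2"
    proof -
      have "Q \<noteq> 0" "1 + B \<noteq> 0" using B Q by auto
      then show ?thesis unfolding \<eta>_def by simp
    qed
    finally show ?thesis using c(2)[of m] m by (simp add: left_diff_distrib)
  qed
  then show ?thesis using that[OF \<eta>, of "c / 2" "max N 4"] c by auto
qed

text \<open>Chaining along a geodesic: \<open>j + 1\<close> steps of length \<open>m\<close> in time reach the distance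
  \<open>(j + 1)s\<close>, each intermediate point ranging over a ball of radius \<open>s\<close>.\<close>

lemma chaining:
  assumes near: "\<And>g. g \<in> ball (3 * s) \<Longrightarrow> b \<le> p m g" and b: "0 \<le> b"
    and g: "g \<in> ball (Suc j * s)"
  shows "b * (vol s * b) ^ j \<le> p (Suc j * m) g"
  using g
proof (induction j arbitrary: g)
  case 0
  then show ?case using near[of g] ball_mono[of s "3 * s"] by auto
next
  case (Suc j)
  have "g \<in> carrier G" "len g \<le> j * s + 2 * s" using Suc.prems by (auto simp: ball_def)
  then obtain a h where ah: "a \<in> carrier G" "h \<in> carrier G" "g = a \<otimes> h" "len a \<le> j * s" "len h \<le> 2 * s"
    using geodesic_split_le by metis
  have zc: "z \<in> carrier G" "len z \<le> s" if "z \<in> ball s" for z using that by (auto simp: ball_def)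
  have inj: "inj_on (\<lambda>z. a \<otimes> z) (ball s)" using ah zc by (auto intro!: inj_onI)
  have "b * (vol s * b) ^ Suc j = (\<Sum>z\<in>ball s. b * (vol s * b) ^ j * b)"
    by (simp add: vol_of_nat mult_ac)
  also have "\<dots> \<le> (\<Sum>z\<in>ball s. p (Suc j * m) (a \<otimes> z) * p m (inv (a \<otimes> z) \<otimes> g))"
  proof (rule sum_mono)
    fix z assume z: "z \<in> ball s"
    have "a \<otimes> z \<in> ball (Suc j * s)"
      using len_mult[OF ah(1) zc(1)[OF z]] zc[OF z] ah by (auto simp: ball_def)
    then have 1: "b * (vol s * b) ^ j \<le> p (Suc j * m) (a \<otimes> z)" by (rule Suc.IH)
    have "inv (a \<otimes> z) \<otimes> g = inv z \<otimes> (inv a \<otimes> (a \<otimes> h))"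
      using ah zc[OF z] by (simp add: inv_mult_group m_assoc)
    also have "inv a \<otimes> (a \<otimes> h) = h" using ah by (simp flip: m_assoc)
    finally have "inv (a \<otimes> z) \<otimes> g = inv z \<otimes> h" .
    moreover have "inv z \<otimes> h \<in> ball (3 * s)"
      using len_mult[of "inv z" h] zc[OF z] ah by (auto simp: ball_def)
    ultimately have 2: "b \<le> p m (inv (a \<otimes> z) \<otimes> g)" using near by simp
    show "b * (vol s * b) ^ j * b \<le> p (Suc j * m) (a \<otimes> z) * p m (inv (a \<otimes> z) \<otimes> g)"
      using 1 2 b p_bounds by (intro mult_mono) auto
  qed
  also have "\<dots> = (\<Sum>y\<in>(\<lambda>z. a \<otimes> z) ` ball s. p (Suc j * m) y * p m (inv y \<otimes> g))"
    by (simp add: sum.reindex[OF inj])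
  also have "\<dots> \<le> p (Suc j * m + m) g"
    using finite_ball ah by (intro p_add_ge_sum) auto
  finally show ?case by (simp add: add.commute)
qed

lemma step_lower_ball:
  assumes "g \<in> carrier G" "real (len g) \<le> t"
  shows "cN / ((1 + t)\<^sup>2 * vol t) \<le> pmf \<nu> g"
proof -
  have "0 \<le> t" using assms(2) of_nat_0_le_iff[of "len g", where 'a = real] by linarith
  have "(1 + real (len g))\<^sup>2 * vol (len g) \<le> (1 + t)\<^sup>2 * vol t"
    using assms vol_pos[of "len g"] by (intro mult_mono power_mono vol_mono) auto
  then have "cN / ((1 + t)\<^sup>2 * vol t) \<le> cN / ((1 + real (len g))\<^sup>2 * vol (len g))"
    using cN_pos vol_pos[of "len g"] vol_pos[OF \<open>0 \<le> t\<close>] \<open>0 \<le> t\<close>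
    by (intro divide_left_mono mult_pos_pos) auto
  then show ?thesis using step_lower[OF assms(1)] by linarith
qed

text \<open>Time \<open>M\<close> is cut into \<open>J\<close> stretches of length \<open>m\<close>. The scale at time \<open>M\<close> is about \<open>\<surd>J\<close>
  times the scale at time \<open>m\<close>, whereas chaining covers a distance proportional to \<open>J\<close>; hence a large
  \<open>J\<close> reaches every multiple \<open>\<kappa>\<close> of the scale. For the finitely many remaining times the walk can
  stay put and jump once.\<close>

lemma p_lower_infinite:
  assumes inf: "infinite (carrier G)" and \<kappa>: "\<kappa> > 0"
  obtains c where "c > 0"
    "\<And>m g. m \<ge> 1 \<Longrightarrow> g \<in> carrier G \<Longrightarrow> real (len g) \<le> \<kappa> * rate m \<Longrightarrow> c \<le> p m g * vol (rate m)"
proof -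
  obtain \<eta> c m0 where \<eta>: "\<eta> > 0" and c: "c > 0"
    and near: "\<And>m g. m \<ge> m0 \<Longrightarrow> g \<in> carrier G \<Longrightarrow> real (len g) \<le> \<eta> * rate m \<Longrightarrow> c \<le> p m g * vol (rate m)"
    using near_diagonal_lower[OF inf] by metis
  \<comment> \<open>The distance to be covered is at most \<open>2\<kappa>\<surd>J R(m)\<close>, and each of the \<open>J\<close> stretches contributes
    \<open>s \<ge> \<eta> R(m) / 6\<close>.\<close>
  define j where "j = nat \<lceil>(12 * \<kappa> / \<eta>)\<^sup>2\<rceil>"
  define J where "J = Suc j"
  have J: "12 * \<kappa> / \<eta> \<le> sqrt (real J)"
  proof (rule real_le_rsqrt)
    show "(12 * \<kappa> / \<eta>)\<^sup>2 \<le> real J" unfolding J_def j_def by linarith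
  qed
  define \<beta> where "\<beta> = c / (K * (max 1 (3 / \<eta>)) powr D)"
  have \<beta>: "\<beta> > 0" unfolding \<beta>_def using c doubling_const_pos by (intro divide_pos_pos) auto
  have "\<forall>\<^sub>F n in sequentially. 6 \<le> \<eta> * rate n"
    unfolding rate_def using \<eta> by real_asymp
  then obtain N1 where N1: "\<And>n. n \<ge> N1 \<Longrightarrow> 6 \<le> \<eta> * rate n" by (auto simp: eventually_sequentially)
  define m1 where "m1 = max (max m0 N1) (2 * J)"
  define N where "N = J * m1"
  have nu: "0 < pmf \<nu> \<one>" "pmf \<nu> \<one> \<le> 1" using nu_one_pos pmf_le_1 by auto
  define c1 where "c1 = pmf \<nu> \<one> ^ J * (c * \<beta> ^ j)"
  define t where "t = \<kappa> * real N"
  define c2 where "c2 = pmf \<nu> \<one> ^ N * (cN / ((1 + t)\<^sup>2 * vol t))"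
  have t: "0 \<le> t" using \<kappa> by (simp add: t_def)
  have large: "c1 \<le> p M g * vol (rate M)"
    if M: "M \<ge> N" and g: "g \<in> carrier G" "real (len g) \<le> \<kappa> * rate M" for M g
  proof -
    define m where "m = M div J"
    have m: "m \<ge> m1" using M by (simp add: m_def N_def J_def less_eq_div_iff_mult_less_eq mult.commute)
    have m': "m \<ge> m0" "m \<ge> N1" "m \<ge> 2 * J" using m by (auto simp: m1_def)
    have mJ: "J * m \<le> M" "M - J * m \<le> J" "M \<le> 2 * J * m"
    proof -
      have e: "M = J * m + M mod J" by (simp add: m_def)
      have "M mod J < J" by (simp add: J_def)
      moreover have "J \<le> J * m" using m'(3) by (simp add: J_def)
      ultimately have "J * m \<le> M" "M - J * m \<le> J" "M \<le> J * m + J * m" using e by linarith+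
      then show "J * m \<le> M" "M - J * m \<le> J" "M \<le> 2 * J * m" by (simp_all add: mult_2 add_mult_distrib)
    qed
    define v where "v = vol (rate m)"
    have v: "0 < v" unfolding v_def by (rule vol_pos[OF rate_nonneg])
    define s where "s = nat \<lfloor>\<eta> * rate m / 3\<rfloor>"
    have r: "6 \<le> \<eta> * rate m" using N1 m' by blast
    have s: "real s \<le> \<eta> * rate m / 3" "\<eta> * rate m / 6 \<le> real s"
      using r unfolding s_def by linarith+
    have near': "c / v \<le> p m h" if "h \<in> ball (3 * s)" for h
    proof -
      have "real (len h) \<le> \<eta> * rate m" using that s(1) by (auto simp: ball_def)
      then show ?thesis using near[OF m'(1), of h] that v by (simp add: v_def ball_def pos_divide_le_eq)
    qed
    have rateM: "rate M \<le> 2 * sqrt (real J) * rate m"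
    proof -
      have "real (2 * J * m + 1) \<le> (real m + 1)\<^sup>2"
      proof -
        have "2 * J * m \<le> m * m" using m'(3) by (intro mult_right_mono) auto
        then have "real (2 * J * m) \<le> real m * real m" by (metis of_nat_le_iff of_nat_mult)
        moreover have "(real m + 1)\<^sup>2 = real m * real m + 2 * real m + 1" by (simp add: power2_eq_square algebra_simps)
        moreover have "real (2 * J * m + 1) = real (2 * J * m) + 1" by simp
        ultimately show ?thesis by linarith
      qed
      then have "ln (real (2 * J * m) + 1) \<le> ln ((real m + 1)\<^sup>2)"
        by (subst ln_le_cancel_iff) (auto simp: add_nonneg_pos)
      then have "ln (real (2 * J * m) + 1) \<le> 2 * ln (real m + 1)"
        by (simp add: ln_realpow)
      then have "(rate (2 * J * m))\<^sup>2 \<le> real (2 * J * m) * (2 * ln (real m + 1))"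
        unfolding rate_sq by (intro mult_left_mono) auto
      also have "\<dots> = (2 * sqrt (real J) * rate m)\<^sup>2"
        by (simp add: power_mult_distrib rate_sq)
      finally have "rate (2 * J * m) \<le> 2 * sqrt (real J) * rate m"
        by (rule power2_le_imp_le) (simp add: rate_nonneg)
      then show ?thesis using rate_mono[OF mJ(3)] by linarith
    qed
    have "\<kappa> * rate M \<le> \<kappa> * (2 * sqrt (real J) * rate m)"
      using rateM \<kappa> by (intro mult_left_mono) auto
    also have "\<dots> = (12 * \<kappa> / \<eta>) * (sqrt (real J) * (\<eta> * rate m / 6))" using \<eta> by simp
    also have "\<dots> \<le> sqrt (real J) * (sqrt (real J) * (\<eta> * rate m / 6))"
      using J \<eta> rate_nonneg by (intro mult_right_mono) auto
    also have "\<dots> = real J * (\<eta> * rate m / 6)" by (simp flip: mult.assoc)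
    also have "\<dots> \<le> real J * real s" using s by (intro mult_left_mono) auto
    finally have "real (len g) \<le> real (J * s)" using g(2) by simp
    then have g': "g \<in> ball (Suc j * s)" using g(1) unfolding ball_def J_def by (simp only: of_nat_le_iff) simp
    have "rate m \<le> 3 / \<eta> * (\<eta> * rate m / 3)" using \<eta> by simp
    then have "v \<le> K * (max 1 (3 / \<eta>)) powr D * vol (\<eta> * rate m / 3)"
      unfolding v_def using \<eta> rate_nonneg by (intro vol_scale) auto
    also have "vol (\<eta> * rate m / 3) = vol s"
      using r by (simp add: vol_eq_card_ball s_def)
    finally have \<beta>_le: "\<beta> \<le> vol s * (c / v)"
      using v c doubling_const_pos[of "3 / \<eta>"] by (simp add: \<beta>_def field_simps)
    have "c1 \<le> pmf \<nu> \<one> ^ (M - J * m) * (c * (vol s * (c / v)) ^ j)"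
      unfolding c1_def using nu c \<beta> \<beta>_le mJ
      by (intro mult_mono power_mono power_decreasing mult_left_mono) (auto simp: less_imp_le)
    also have "\<dots> = pmf \<nu> \<one> ^ (M - J * m) * (c / v * (vol s * (c / v)) ^ j) * v"
      using v by simp
    also have "\<dots> \<le> pmf \<nu> \<one> ^ (M - J * m) * p (J * m) g * v"
      using chaining[OF near' _ g'] c v nu unfolding J_def
      by (intro mult_right_mono mult_left_mono) auto
    also have "\<dots> \<le> p (J * m + (M - J * m)) g * v"
      using p_ge_lazy[OF g(1)] v by (intro mult_right_mono) auto
    also have "\<dots> \<le> p M g * vol (rate M)"
    proof -
      have "m \<le> J * m" by (simp add: J_def)
      then have "m \<le> M" using mJ by linarith
      then show ?thesis
        unfolding v_def using mJ p_bounds by (intro mult_mono vol_mono rate_mono) (auto simp: less_imp_le vol_pos rate_nonneg)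
    qed
    finally show ?thesis .
  qed
  have small: "c2 \<le> p M g * vol (rate M)"
    if M: "1 \<le> M" "M \<le> N" and g: "g \<in> carrier G" "real (len g) \<le> \<kappa> * rate M" for M g
  proof -
    have "\<kappa> * rate M \<le> t"
      unfolding t_def using \<kappa> rate_le[of M] M by (intro mult_left_mono) linarith+
    then have "cN / ((1 + t)\<^sup>2 * vol t) \<le> pmf \<nu> g"
      using g by (intro step_lower_ball) auto
    then have "c2 \<le> pmf \<nu> \<one> ^ (M - 1) * p 1 g"
      unfolding c2_def p_1 One_nat_def[symmetric] conv_power_1 using nu M vol_pos[OF t] t cN_pos
      by (intro mult_mono power_decreasing) auto
    also have "\<dots> \<le> p (1 + (M - 1)) g" by (rule p_ge_lazy[OF g(1)])
    also have "\<dots> = p M g * 1" using M by simp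
    also have "\<dots> \<le> p M g * vol (rate M)"
      using vol_ge_1[OF rate_nonneg] p_bounds by (intro mult_left_mono) auto
    finally show ?thesis .
  qed
  have "c1 > 0" unfolding c1_def using nu c \<beta> by simp
  moreover have "c2 > 0" unfolding c2_def using nu cN_pos t vol_pos[OF t] by simp
  moreover have "min c1 c2 \<le> p M g * vol (rate M)"
    if "1 \<le> M" "g \<in> carrier G" "real (len g) \<le> \<kappa> * rate M" for M g
    using that large[of M g] small[of M g] by (cases "N \<le> M") (auto simp: min_le_iff_disj)
  ultimately show ?thesis using that[of "min c1 c2"] by auto
qed

text \<open>The last step alone already spreads the walk over the whole group.\<close>

lemma p_lower_finite:
  assumes fin: "finite (carrier G)"
  obtains c where "c > 0" "\<And>m g. m \<ge> 1 \<Longrightarrow> g \<in> carrier G \<Longrightarrow> c \<le> p m g * vol (rate m)"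
proof -
  define t where "t = real (Max (len ` carrier G))"
  define c where "c = cN / ((1 + t)\<^sup>2 * vol t)"
  have c: "c > 0" unfolding c_def t_def using cN_pos vol_pos by (intro divide_pos_pos mult_pos_pos) auto
  have len_t: "real (len g) \<le> t" if "g \<in> carrier G" for g
    unfolding t_def using that fin by (intro of_nat_mono Max_ge) auto
  have "c \<le> p m g * vol (rate m)" if m: "m \<ge> 1" and g: "g \<in> carrier G" for m g
  proof -
    obtain n where n: "m = n + 1" using m by (metis add.commute le_Suc_ex)
    have "c = measure_pmf.expectation (conv_power G \<nu> n) (\<lambda>x. c)" by simp
    also have "\<dots> \<le> measure_pmf.expectation (conv_power G \<nu> n) (\<lambda>x. p 1 (inv x \<otimes> g))"
    proof (intro integral_mono_AE AE_pmfI)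
      show "integrable (conv_power G \<nu> n) (\<lambda>x. p 1 (inv x \<otimes> g))"
        by (intro measure_pmf.integrable_const_bound[where B = 1]) (auto simp: pmf_le_1)
      fix x assume "x \<in> set_pmf (conv_power G \<nu> n)"
      then have "inv x \<otimes> g \<in> carrier G" using conv_power_support[of n] g by auto
      then show "c \<le> p 1 (inv x \<otimes> g)"
        unfolding c_def conv_power_1 by (intro step_lower_ball len_t)
    qed simp
    also have "\<dots> = p m g" unfolding n by (rule p_add[OF g, symmetric])
    also have "\<dots> = p m g * 1" by simp
    also have "\<dots> \<le> p m g * vol (rate m)"
      using vol_ge_1[OF rate_nonneg] p_bounds by (intro mult_left_mono) auto
    finally show ?thesis .
  qed
  with c show ?thesis using that by blast
qed

theorem p_upper:
  obtains C where "C > 0" "\<And>m g. m \<ge> 1 \<Longrightarrow> g \<in> carrier G \<Longrightarrow> p m g * vol (rate m) \<le> C"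
proof (cases "finite (carrier G)")
  case True
  have "p m g * vol (rate m) \<le> real (card (carrier G))" if "g \<in> carrier G" for m g
  proof -
    have "vol (rate m) \<le> real (card (carrier G))"
      unfolding volume_def using True by (intro of_nat_mono card_mono) auto
    then have "p m g * vol (rate m) \<le> 1 * real (card (carrier G))"
      using p_bounds vol_pos[OF rate_nonneg, of m] by (intro mult_mono) auto
    then show ?thesis by simp
  qed
  moreover have "0 < card (carrier G)" using True one_closed card_gt_0_iff by blast
  ultimately show ?thesis using that[of "real (card (carrier G))"] by simp
qed (use p_upper_infinite that in blast)

theorem p_lower:
  assumes "\<kappa> > 0"
  obtains c where "c > 0"
    "\<And>m g. m \<ge> 1 \<Longrightarrow> g \<in> carrier G \<Longrightarrow> real (len g) \<le> \<kappa> * rate m \<Longrightarrow> c \<le> p m g * vol (rate m)"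
proof (cases "finite (carrier G)")
  case True
  then show ?thesis using p_lower_finite that by metis
next
  case False
  then show ?thesis using p_lower_infinite[OF _ assms] that by metis
qed

end

section \<open>Polynomial growth, scale functions and strong control\<close>

text \<open>Replacing \<open>t\<close> by \<open>1 + t\<close> in the power extends the growth bounds to all \<open>t \<ge> 0\<close>, where \<open>V(t) = 1\<close>
  for \<open>t < 1\<close>. The degree is nonnegative because the volume is at least 1.\<close>

lemma polynomial_growth_doubling:
  assumes "word_metric G S" "polynomial_growth G S D"
  obtains K c C where "0 \<le> D" "1 \<le> K" "0 < c" "c \<le> C"
    "\<And>\<kappa> t. 1 \<le> \<kappa> \<Longrightarrow> 0 \<le> t \<Longrightarrow>
      volume G (word_norm G S) (\<kappa> * t) \<le> K * \<kappa> powr D * volume G (word_norm G S) t"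
    "\<And>t. 1 \<le> t \<Longrightarrow> c * t powr D \<le> volume G (word_norm G S) t \<and> volume G (word_norm G S) t \<le> C * t powr D"
proof -
  interpret word_metric G S by fact
  obtain c C where c: "0 < c" "c \<le> C"
    and growth: "\<And>t. 1 \<le> t \<Longrightarrow> c * t powr D \<le> vol t \<and> vol t \<le> C * t powr D"
    using assms(2) unfolding polynomial_growth_def comparable_on_def by auto
  have D: "0 \<le> D"
  proof (rule ccontr)
    assume "\<not> 0 \<le> D"
    then have "D < 0" by simp
    then have "((\<lambda>t. C * t powr D) \<longlongrightarrow> 0) at_top" by real_asymp
    then have "\<forall>\<^sub>F t in at_top. C * t powr D < 1" by (rule order_tendstoD) simp
    then have "\<forall>\<^sub>F t in at_top. C * t powr D < 1 \<and> 1 \<le> t"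
      using eventually_ge_at_top[of "1 :: real"] by eventually_elim auto
    then obtain t where "C * t powr D < 1" "1 \<le> t"
      using eventually_happens by fastforce
    then show False using growth[of t] vol_ge_1[of t] by linarith
  qed
  define c' where "c' = min 1 c / 2 powr D"
  have c': "0 < c'" using c by (simp add: c'_def)
  have bounds: "c' * (1 + t) powr D \<le> vol t \<and> vol t \<le> C * (1 + t) powr D" if t: "0 \<le> t" for t
  proof (cases "1 \<le> t")
    case True
    have "(1 + t) powr D \<le> (2 * t) powr D" using True D by (intro powr_mono2) auto
    also have "\<dots> = 2 powr D * t powr D" using True by (simp add: powr_mult)
    finally have "c' * (1 + t) powr D \<le> c' * (2 powr D * t powr D)"
      using c' by (intro mult_left_mono) auto
    also have "\<dots> = min 1 c * t powr D" by (simp add: c'_def)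
    also have "\<dots> \<le> c * t powr D" by (intro mult_right_mono) auto
    also have "\<dots> \<le> vol t" using growth True by blast
    finally have lower: "c' * (1 + t) powr D \<le> vol t" .
    have "vol t \<le> C * t powr D" using growth True by blast
    also have "\<dots> \<le> C * (1 + t) powr D"
      using c True D by (intro mult_left_mono powr_mono2) auto
    finally show ?thesis using lower by blast
  next
    case False
    have "(1 + t) powr D \<le> 2 powr D" using False t D by (intro powr_mono2) auto
    then have "c' * (1 + t) powr D \<le> c' * 2 powr D" using c' by (intro mult_left_mono) auto
    also have "\<dots> \<le> 1" by (simp add: c'_def)
    also have "\<dots> \<le> vol t" using vol_ge_1 t by blast
    finally have lower: "c' * (1 + t) powr D \<le> vol t" .
    have "vol t \<le> vol 1" using False by (intro vol_mono) auto
    also have "\<dots> \<le> C * 1" using growth[of 1] by simp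
    also have "\<dots> \<le> C * (1 + t) powr D"
      using c t D by (intro mult_left_mono ge_one_powr_ge_zero) auto
    finally show ?thesis using lower by blast
  qed
  define K where "K = max 1 (C / c')"
  have "vol (\<kappa> * t) \<le> K * \<kappa> powr D * vol t" if \<kappa>: "1 \<le> \<kappa>" and t: "0 \<le> t" for \<kappa> t
  proof -
    have "vol (\<kappa> * t) \<le> C * (1 + \<kappa> * t) powr D" using bounds[of "\<kappa> * t"] \<kappa> t by simp
    also have "\<dots> \<le> C * (\<kappa> * (1 + t)) powr D"
      using c \<kappa> t D by (intro mult_left_mono powr_mono2) (auto simp: algebra_simps)
    also have "\<dots> = \<kappa> powr D * (C / c') * (c' * (1 + t) powr D)"
      using \<kappa> t c' by (simp add: powr_mult)
    also have "\<dots> \<le> \<kappa> powr D * K * vol t"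
      using bounds[OF t] c c' by (intro mult_mono mult_left_mono) (auto simp: K_def)
    finally show ?thesis by (simp add: mult_ac)
  qed
  moreover have "1 \<le> K" by (simp add: K_def)
  ultimately show ?thesis using that D c growth by blast
qed

lemma ln_Suc_le_double:
  assumes n: "n \<ge> 2"
  shows "ln (real n + 1) \<le> 2 * ln (real n)"
proof -
  have "2 * real n \<le> real n * real n" using n by (intro mult_right_mono) auto
  then have "real n + 1 \<le> (real n)\<^sup>2" using n unfolding power2_eq_square by linarith
  then have "ln (real n + 1) \<le> ln ((real n)\<^sup>2)" by (subst ln_le_cancel_iff) (use n in auto)
  then show ?thesis using n by (simp add: ln_realpow)
qed

text \<open>For large \<open>n\<close> both functions are explicit; on the remaining initial segment both lie between
  positive constants, by monotonicity.\<close>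

lemma scale_comparable_rate:
  assumes r: "sqrt_t_log_t_scale r"
  obtains a b where "0 < a" "0 < b"
    "\<And>n. n \<ge> 1 \<Longrightarrow> a * rate n \<le> r (real n) \<and> r (real n) \<le> b * rate n"
proof -
  have sm: "strict_mono_on {0<..} r" and bij: "bij_betw r {0<..} {0<..}"
    using r by (auto simp: sqrt_t_log_t_scale_def scale_function_def)
  have mono: "r x \<le> r y" if "0 < x" "x \<le> y" for x y
    using strict_mono_onD[OF sm, of x y] that by (cases "x = y") auto
  have pos: "0 < r x" if "0 < x" for x using bij that by (auto simp: bij_betw_def)
  obtain T where T: "\<And>t. t \<ge> T \<Longrightarrow> r t = sqrt (t * ln t)"
    using r by (auto simp: sqrt_t_log_t_scale_def eventually_at_top_linorder)
  define N where "N = max 2 (nat \<lceil>T\<rceil>)"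
  have N: "2 \<le> N" "T \<le> real N" unfolding N_def by linarith+
  define a b where "a = min (1 / 2) (r 1 / real N)" and "b = max 1 (2 * r (real N))"
  have "a * rate n \<le> r (real n) \<and> r (real n) \<le> b * rate n" if n: "n \<ge> 1" for n
  proof (cases "n \<ge> N")
    case True
    have n2: "2 \<le> n" using True N by simp
    have rn: "r (real n) = sqrt (real n * ln (real n))" using T True N by simp
    have "0 \<le> ln (real n)" using n2 by simp
    then have "ln (real n + 1) \<le> 4 * ln (real n)" using ln_Suc_le_double[OF n2] by linarith
    then have "real n * ln (real n + 1) \<le> real n * (4 * ln (real n))" by (rule mult_left_mono) simp
    then have "real n * ln (real n + 1) \<le> 4 * (real n * ln (real n))" by simp
    then have "rate n \<le> sqrt (4 * (real n * ln (real n)))"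
      unfolding rate_def by (rule real_sqrt_le_mono)
    also have "\<dots> = 2 * r (real n)" unfolding rn by (simp add: real_sqrt_mult)
    finally have "rate n \<le> 2 * r (real n)" .
    moreover have "a * rate n \<le> 1 / 2 * rate n"
      unfolding a_def by (intro mult_right_mono min.cobounded1 rate_nonneg)
    moreover have "r (real n) \<le> rate n"
      unfolding rn rate_def using n2 by (intro real_sqrt_le_mono mult_left_mono) auto
    moreover have "1 * rate n \<le> b * rate n"
      unfolding b_def using rate_nonneg by (intro mult_right_mono) auto
    ultimately show ?thesis by linarith
  next
    case False
    have "a * rate n \<le> r 1 / real N * real N"
      using False rate_le[of n] rate_nonneg pos[of 1] by (intro mult_mono) (auto simp: a_def)
    also have "\<dots> = r 1" using N by simp
    also have "\<dots> \<le> r (real n)" using n by (intro mono) auto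
    finally have lower: "a * rate n \<le> r (real n)" .
    have "r (real n) \<le> r (real N)" using n False by (intro mono) auto
    also have "\<dots> = 2 * r (real N) * (1 / 2)" by simp
    also have "\<dots> \<le> b * rate n"
      using rate_ge[OF n] pos[of "real N"] N by (intro mult_mono) (auto simp: b_def)
    finally show ?thesis using lower by blast
  qed
  moreover have "0 < a" "0 < b" using pos[of 1] N by (auto simp: a_def b_def)
  ultimately show ?thesis using that by blast
qed

context critical_walk
begin

text \<open>The volume at radius \<open>R(n)\<close> is comparable with \<open>R(n)\<^sup>D\<close>, and replacing \<open>log (n + 1)\<close> by \<open>log n\<close> costs a
  factor of at most 2 inside the power when \<open>n \<ge> 2\<close>.\<close>

lemma return_prob_comparable:
  assumes growth: "0 < c" "c \<le> C"
    "\<And>t. 1 \<le> t \<Longrightarrow> c * t powr D \<le> vol t \<and> vol t \<le> C * t powr D"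
  shows "comparable_on {2..} (\<lambda>n::nat. p n \<one>) (\<lambda>n. (real n * ln (real n)) powr (- D / 2))"
proof -
  obtain C1 where C1: "C1 > 0" "\<And>m g. m \<ge> 1 \<Longrightarrow> g \<in> carrier G \<Longrightarrow> p m g * vol (rate m) \<le> C1"
    using p_upper by blast
  obtain c1 where c1: "c1 > 0" "\<And>m. m \<ge> 1 \<Longrightarrow> c1 \<le> p m \<one> * vol (rate m)"
    using return_lower by blast
  define L U where "L = c1 / (C * 2 powr (D / 2))" and "U = C1 / c"
  have bounds: "L * (real n * ln (real n)) powr (- D / 2) \<le> p n \<one> \<and>
      p n \<one> \<le> U * (real n * ln (real n)) powr (- D / 2)" if n: "n \<ge> 2" for n :: nat
  proof -
    define x y where "x = real n * ln (real n)" and "y = real n * ln (real n + 1)"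
    have x: "0 < x" using n by (simp add: x_def)
    have xy: "x \<le> y" unfolding x_def y_def using n by (intro mult_left_mono) auto
    have "real n * ln (real n + 1) \<le> real n * (2 * ln (real n))"
      by (intro mult_left_mono ln_Suc_le_double n) simp
    then have yx: "y \<le> 2 * x" by (simp add: x_def y_def)
    have "1 / 2 \<le> ln (real n + 1)" using ln_Suc_bounds n by simp
    then have "2 * (1 / 2) \<le> y" unfolding y_def using n by (intro mult_mono) auto
    then have rate1: "1 \<le> rate n" by (simp add: rate_def y_def)
    have "rate n powr D = y powr (D / 2)"
      using x xy unfolding rate_def y_def[symmetric] by (simp add: powr_half_sqrt[symmetric] powr_powr)
    then have v: "c * y powr (D / 2) \<le> vol (rate n)" "vol (rate n) \<le> C * y powr (D / 2)"
      using growth(3)[OF rate1] by auto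
    have xp: "0 < x powr (D / 2)" "x powr (- D / 2) = 1 / x powr (D / 2)"
      using x by (auto simp: powr_minus_divide)
    have "c * x powr (D / 2) \<le> c * y powr (D / 2)"
      using growth x xy D_nonneg by (intro mult_left_mono powr_mono2) auto
    with v have vl: "c * x powr (D / 2) \<le> vol (rate n)" by linarith
    have "y powr (D / 2) \<le> (2 * x) powr (D / 2)" using x xy yx D_nonneg by (intro powr_mono2) auto
    also have "\<dots> = 2 powr (D / 2) * x powr (D / 2)" using x by (simp add: powr_mult)
    finally have "C * y powr (D / 2) \<le> C * (2 powr (D / 2) * x powr (D / 2))"
      using growth by (intro mult_left_mono) auto
    with v have vu: "vol (rate n) \<le> C * 2 powr (D / 2) * x powr (D / 2)" by simp
    have "p n \<one> * (c * x powr (D / 2)) \<le> p n \<one> * vol (rate n)"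
      using vl p_bounds by (intro mult_left_mono) auto
    also have "\<dots> \<le> C1" using C1(2)[of n \<one>] n by simp
    finally have up: "p n \<one> \<le> U * (1 / x powr (D / 2))"
      using xp growth by (simp add: U_def field_simps)
    have "c1 \<le> p n \<one> * vol (rate n)" using c1(2)[of n] n by simp
    also have "\<dots> \<le> p n \<one> * (C * 2 powr (D / 2) * x powr (D / 2))"
      using vu p_bounds by (intro mult_left_mono) auto
    finally have "L * (1 / x powr (D / 2)) \<le> p n \<one>"
      using xp growth by (simp add: L_def field_simps)
    with up show ?thesis unfolding x_def[symmetric] xp(2) by blast
  qed
  have "0 < L" using c1 growth by (simp add: L_def)
  moreover have "L \<le> U"
  proof -
    define z where "z = (2 * ln 2 :: real) powr (- D / 2)"
    have "0 < z" by (simp add: z_def)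
    moreover have "L * z \<le> p 2 \<one>" "p 2 \<one> \<le> U * z" using bounds[of 2] unfolding z_def by auto
    then have "L * z \<le> U * z" by (rule order.trans)
    ultimately show ?thesis by (simp only: mult_le_cancel_right_pos)
  qed
  ultimately show ?thesis unfolding comparable_on_def using bounds by (intro exI[of _ L] exI[of _ U]) auto
qed

text \<open>The condition on \<open>n\<close> and \<open>\<tau>\<close>, taken with \<open>\<gamma>\<^sub>1 = 1\<close>, says that \<open>r(n) \<le> \<tau> \<le> r(2n)\<close>. Thus \<open>\<tau>\<close> is
  comparable with \<open>R(n)\<close>, since \<open>r\<close> and \<open>R\<close> are comparable at positive integers.\<close>

lemma strongly_controlled_critical:
  assumes r: "sqrt_t_log_t_scale r"
  shows "strongly_controlled G (word_norm G S) r \<nu>"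
proof -
  have scale: "scale_function r" using r by (simp add: sqrt_t_log_t_scale_def)
  then have sm: "strict_mono_on {0<..} r" and bij: "bij_betw r {0<..} {0<..}"
    by (auto simp: scale_function_def)
  have mono: "r x \<le> r y" if "0 < x" "x \<le> y" for x y
    using strict_mono_onD[OF sm, of x y] that by (cases "x = y") auto
  have pos: "0 < r x" if "0 < x" for x using bij that by (auto simp: bij_betw_def)
  obtain a b where ab: "0 < a" "0 < b"
    and cmp: "\<And>n. n \<ge> 1 \<Longrightarrow> a * rate n \<le> r (real n) \<and> r (real n) \<le> b * rate n"
    using scale_comparable_rate[OF r] by blast
  have to_rate: "r (real n) \<le> b * rate n" and from_rate: "rate n \<le> 1 / a * r (real n)" if "n \<ge> 1" for n
    using cmp[OF that] ab by (auto simp: field_simps)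
  have rate2: "rate (2 * n) \<le> 2 * rate n" for n using rate_mult[of 2 n] by simp
  obtain C1 where C1: "C1 > 0" "\<And>m g. m \<ge> 1 \<Longrightarrow> g \<in> carrier G \<Longrightarrow> p m g * vol (rate m) \<le> C1"
    using p_upper by blast
  define Q1 where "Q1 = K * (max 1 b) powr D"
  define Q2 where "Q2 = K * (max 1 (2 / a)) powr D"
  have Q: "0 < Q1" "0 < Q2" unfolding Q1_def Q2_def by (rule doubling_const_pos)+
  have vol1: "vol (r (real n)) \<le> Q1 * vol (rate (2 * n))" if n: "n \<ge> 1" for n
  proof -
    have "b * rate n \<le> b * rate (2 * n)" using ab by (intro mult_left_mono rate_mono) auto
    then have "r (real n) \<le> b * rate (2 * n)" using to_rate[OF n] by linarith
    then show ?thesis unfolding Q1_def using ab n pos[of "real n"] rate_nonneg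
      by (intro vol_scale) (auto simp: less_imp_le)
  qed
  have vol2: "vol (rate (2 * n)) \<le> Q2 * vol (r (real n))" if n: "n \<ge> 1" for n
  proof -
    have "rate (2 * n) \<le> 2 / a * r (real n)"
      using from_rate[OF n] rate2[of n] by simp
    then show ?thesis unfolding Q2_def using ab n pos[of "real n"] rate_nonneg
      by (intro vol_scale) (auto simp: less_imp_le)
  qed
  have vr: "0 < vol (r (real n))" if "n \<ge> 1" for n
    using vol_pos[of "r (real n)"] pos[of "real n"] that by simp
  have on_diag: "p (2 * n) g \<le> (C1 * Q1) * inverse (vol (r (real n)))"
    if n: "n \<ge> 1" and g: "g \<in> carrier G" for n g
  proof -
    have "p (2 * n) g * vol (r (real n)) \<le> p (2 * n) g * (Q1 * vol (rate (2 * n)))"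
      using vol1[OF n] p_bounds by (intro mult_left_mono) auto
    also have "\<dots> = Q1 * (p (2 * n) g * vol (rate (2 * n)))" by simp
    also have "\<dots> \<le> Q1 * C1" using C1(2)[of "2 * n" g] n g Q by (intro mult_left_mono) auto
    finally show ?thesis using vr[OF n] by (simp add: field_simps)
  qed
  have off_diag: "\<exists>c>0. \<forall>n\<ge>1. \<forall>g\<in>carrier G. real (len g) \<le> \<kappa> * r (real n) \<longrightarrow>
      c * inverse (vol (r (real n))) \<le> p (2 * n) g" if \<kappa>: "\<kappa> > 0" for \<kappa>
  proof -
    obtain c where c: "c > 0" "\<And>m g. m \<ge> 1 \<Longrightarrow> g \<in> carrier G \<Longrightarrow>
        real (len g) \<le> \<kappa> * b * rate m \<Longrightarrow> c \<le> p m g * vol (rate m)"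
      using p_lower[of "\<kappa> * b"] \<kappa> ab by auto
    have "c / Q2 * inverse (vol (r (real n))) \<le> p (2 * n) g"
      if n: "n \<ge> 1" and g: "g \<in> carrier G" "real (len g) \<le> \<kappa> * r (real n)" for n g
    proof -
      have "\<kappa> * r (real n) \<le> \<kappa> * (b * rate n)" using to_rate[OF n] \<kappa> by (intro mult_left_mono) auto
      also have "\<dots> \<le> \<kappa> * (b * rate (2 * n))"
        using \<kappa> ab by (intro mult_left_mono rate_mono) auto
      finally have "c \<le> p (2 * n) g * vol (rate (2 * n))"
        using c(2)[of "2 * n" g] n g by (simp add: mult.assoc)
      also have "\<dots> \<le> p (2 * n) g * (Q2 * vol (r (real n)))"
        using vol2[OF n] p_bounds by (intro mult_left_mono) auto
      finally show ?thesis using vr[OF n] Q by (simp add: field_simps)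
    qed
    moreover have "c / Q2 > 0" using c Q by simp
    ultimately show ?thesis by blast
  qed
  obtain c where c: "c > 0" "\<And>m g. m \<ge> 1 \<Longrightarrow> g \<in> carrier G \<Longrightarrow>
      real (len g) \<le> 4 * b * rate m \<Longrightarrow> c \<le> p m g * vol (rate m)"
    using p_lower[of "4 * b"] ab by auto
  define Q3 where "Q3 = K * (max 1 (1 / a)) powr D"
  have Q3: "0 < Q3" unfolding Q3_def by (rule doubling_const_pos)
  define \<epsilon> where "\<epsilon> = c / Q3 / 2"
  have \<epsilon>: "\<epsilon> > 0" using c Q3 by (simp add: \<epsilon>_def)
  obtain A where A: "A > 0"
    "\<And>n. n \<ge> 1 \<Longrightarrow> \<exists>R. real R \<le> A * rate n \<and> 1 - \<epsilon> \<le> stay_prob n (\<lambda>_. ball R) \<one>"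
    using confinement[OF \<epsilon>] by blast
  define \<gamma> where "\<gamma> = 1 + A / a"
  have control: "\<epsilon> \<le> (INF x \<in> {x \<in> carrier G. word_norm G S x \<le> \<tau>}.
      measure paths {\<xi> \<in> space paths. (SUP k\<in>{0..n}. word_norm G S (walk G x \<xi> k)) \<le> \<gamma> * \<tau> \<and>
        word_norm G S (walk G x \<xi> n) \<le> \<tau>})"
    if \<tau>: "0 < \<tau>" and n: "the_inv_into {0<..} r \<tau> / 2 \<le> real n" "real n \<le> the_inv_into {0<..} r \<tau>"
    for n :: nat and \<tau> :: real
  proof -
    let ?t = "the_inv_into {0<..} r \<tau>"
    have t: "0 < ?t" "r ?t = \<tau>"
      using \<tau> bij the_inv_into_into[of r "{0<..}" \<tau> "{0<..}"] f_the_inv_into_f_bij_betw[OF bij, of \<tau>]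
      by (auto simp: bij_betw_def)
    have n1: "n \<ge> 1" using n t by (cases n) auto
    have \<tau>1: "r (real n) \<le> \<tau>" using mono[of "real n" ?t] n n1 t by simp
    have \<tau>2: "\<tau> \<le> 2 * b * rate n"
    proof -
      have "\<tau> \<le> r (real (2 * n))" using mono[of ?t "real (2 * n)"] n t by simp
      also have "\<dots> \<le> b * rate (2 * n)" using n1 by (intro to_rate) auto
      also have "\<dots> \<le> b * (2 * rate n)" using ab rate2 by (intro mult_left_mono) auto
      finally show ?thesis by simp
    qed
    have \<tau>3: "rate n \<le> 1 / a * \<tau>"
    proof -
      have "1 / a * r (real n) \<le> 1 / a * \<tau>" using ab \<tau>1 by (intro mult_left_mono) auto
      then show ?thesis using from_rate[OF n1] by linarith
    qed
    have v: "0 < vol (rate n)" by (rule vol_pos[OF rate_nonneg])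
    obtain R where R: "real R \<le> A * rate n" "1 - \<epsilon> \<le> stay_prob n (\<lambda>_. ball R) \<one>"
      using A(2)[OF n1] by blast
    have "A * rate n \<le> A * (1 / a * \<tau>)" using A(1) \<tau>3 by (intro mult_left_mono) auto
    then have R': "\<tau> + real R \<le> \<gamma> * \<tau>" using R(1) by (simp add: \<gamma>_def algebra_simps)
    show ?thesis
    proof (rule cINF_greatest)
      show "{x \<in> carrier G. word_norm G S x \<le> \<tau>} \<noteq> {}" using \<tau> by (auto intro!: exI[of _ \<one>])
    next
      fix x assume "x \<in> {x \<in> carrier G. word_norm G S x \<le> \<tau>}"
      then have x: "x \<in> carrier G" "real (len x) \<le> \<tau>" by auto
      let ?F = "ball (nat \<lfloor>\<tau>\<rfloor>)"
      have "vol (rate n) \<le> Q3 * vol \<tau>"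
        unfolding Q3_def using ab \<tau> \<tau>3 rate_nonneg by (intro vol_scale) auto
      then have "2 * \<epsilon> \<le> vol \<tau> * (c / vol (rate n))"
        using Q3 v c by (simp add: \<epsilon>_def field_simps)
      also have "\<dots> = (\<Sum>y\<in>?F. c / vol (rate n))" using \<tau> by (simp add: vol_eq_card_ball)
      also have "\<dots> \<le> (\<Sum>y\<in>?F. p n (inv x \<otimes> y))"
      proof (rule sum_mono)
        fix y assume "y \<in> ?F"
        then have y: "y \<in> carrier G" "real (len y) \<le> \<tau>"
          using \<tau> by (auto simp: ball_def le_nat_iff le_floor_iff)
        have "real (len (inv x \<otimes> y)) \<le> 4 * b * rate n"
          using len_mult[of "inv x" y] x y \<tau>2 by simp
        then have "c \<le> p n (inv x \<otimes> y) * vol (rate n)" using c(2)[OF n1] x y by simp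
        then show "c / vol (rate n) \<le> p n (inv x \<otimes> y)" using v by (simp add: pos_divide_le_eq)
      qed
      finally have "\<epsilon> \<le> (\<Sum>y\<in>?F. p n (inv x \<otimes> y)) + stay_prob n (\<lambda>_. ball R) \<one> - 1"
        using R(2) by linarith
      also have "\<dots> \<le> measure paths {\<xi> \<in> space paths.
          (SUP k\<in>{0..n}. word_norm G S (walk G x \<xi> k)) \<le> \<gamma> * \<tau> \<and> word_norm G S (walk G x \<xi> n) \<le> \<tau>}"
        by (rule controlled_event_ge[OF x R'])
      finally show "\<epsilon> \<le> measure paths {\<xi> \<in> space paths.
          (SUP k\<in>{0..n}. word_norm G S (walk G x \<xi> k)) \<le> \<gamma> * \<tau> \<and> word_norm G S (walk G x \<xi> n) \<le> \<tau>}" .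
    qed
  qed
  have part1: "\<exists>C>0. \<forall>\<kappa>>0. \<exists>c>0. \<forall>n\<ge>1. \<forall>g\<in>carrier G. word_norm G S g \<le> \<kappa> * r (real n) \<longrightarrow>
        c * inverse (vol (r (real n))) \<le> p (2 * n) g \<and> p (2 * n) g \<le> C * inverse (vol (r (real n)))"
  proof (rule exI[of _ "C1 * Q1"], intro conjI allI impI)
    show "0 < C1 * Q1" using C1 Q by simp
    fix \<kappa> :: real assume "0 < \<kappa>"
    from off_diag[OF this] on_diag
    show "\<exists>c>0. \<forall>n\<ge>1. \<forall>g\<in>carrier G. word_norm G S g \<le> \<kappa> * r (real n) \<longrightarrow>
        c * inverse (vol (r (real n))) \<le> p (2 * n) g \<and>
        p (2 * n) g \<le> C1 * Q1 * inverse (vol (r (real n)))"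
      by meson
  qed
  have \<gamma>: "1 \<le> \<gamma>" using A(1) ab by (simp add: \<gamma>_def)
  have part2: "\<exists>\<epsilon> \<gamma>\<^sub>1 \<gamma>\<^sub>2. 0 < \<epsilon> \<and> 0 < \<gamma>\<^sub>1 \<and> 1 \<le> \<gamma>\<^sub>2 \<and>
      (let \<rho> = the_inv_into {0<..} r in
       \<forall>(n::nat) (\<tau>::real). 0 < \<tau> \<and> \<rho> (\<tau> / \<gamma>\<^sub>1) / 2 \<le> real n \<and> real n \<le> \<rho> (\<tau> / \<gamma>\<^sub>1) \<longrightarrow>
         (INF x \<in> {x \<in> carrier G. word_norm G S x \<le> \<tau>}.
            measure paths {\<xi> \<in> space paths.
              (SUP k\<in>{0..n}. word_norm G S (walk G x \<xi> k)) \<le> \<gamma>\<^sub>2 * \<tau> \<and> word_norm G S (walk G x \<xi> n) \<le> \<tau>})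
         \<ge> \<epsilon>)"
    unfolding Let_def
  proof (rule exI[of _ \<epsilon>], rule exI[of _ 1], rule exI[of _ \<gamma>], intro conjI allI impI)
    fix n :: nat and \<tau> :: real
    assume "0 < \<tau> \<and> the_inv_into {0<..} r (\<tau> / 1) / 2 \<le> real n \<and> real n \<le> the_inv_into {0<..} r (\<tau> / 1)"
    then show "\<epsilon> \<le> (INF x \<in> {x \<in> carrier G. word_norm G S x \<le> \<tau>}.
        measure paths {\<xi> \<in> space paths.
          (SUP k\<in>{0..n}. word_norm G S (walk G x \<xi> k)) \<le> \<gamma> * \<tau> \<and> word_norm G S (walk G x \<xi> n) \<le> \<tau>})"
      using control by simp
  qed (use \<epsilon> \<gamma> in auto)
  show ?thesis
    unfolding strongly_controlled_def by (intro conjI group_norm_len scale symmetric part1 part2)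
qed

end

theorem theorem5p5:
  fixes G :: "('a, 'b) monoid_scheme" and S :: "'a list" and D :: real and \<nu>\<^sub>2 :: "'a pmf"
  assumes "group G"
    and "set S \<subseteq> carrier G" and "generate G (set S) = carrier G"
    and "polynomial_growth G S D"
    and "symmetric_measure G \<nu>\<^sub>2"
    and "comparable_on (carrier G) (pmf \<nu>\<^sub>2)
           (\<lambda>g. inverse ((1 + word_norm G S g)\<^sup>2 * volume G (word_norm G S) (word_norm G S g)))"
  shows "comparable_on {2..} (\<lambda>n::nat. pmf (conv_power G \<nu>\<^sub>2 n) \<one>\<^bsub>G\<^esub>)
           (\<lambda>n. (real n * ln (real n)) powr (- D / 2)) \<and>
         (\<forall>r. sqrt_t_log_t_scale r \<longrightarrow> strongly_controlled G (word_norm G S) r \<nu>\<^sub>2)"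
proof -
  have wm: "word_metric G S"
    by (intro word_metric.intro word_metric_axioms.intro assms)
  obtain K c C where K: "0 \<le> D" "1 \<le> K" "0 < c" "c \<le> C"
    and doubling: "\<And>\<kappa> t. 1 \<le> \<kappa> \<Longrightarrow> 0 \<le> t \<Longrightarrow>
      volume G (word_norm G S) (\<kappa> * t) \<le> K * \<kappa> powr D * volume G (word_norm G S) t"
    and growth: "\<And>t. 1 \<le> t \<Longrightarrow>
      c * t powr D \<le> volume G (word_norm G S) t \<and> volume G (word_norm G S) t \<le> C * t powr D"
    using polynomial_growth_doubling[OF wm assms(4)] by metis
  obtain a b where ab: "0 < a" "a \<le> b" and step: "\<And>g. g \<in> carrier G \<Longrightarrow>
      a * inverse ((1 + word_norm G S g)\<^sup>2 * volume G (word_norm G S) (word_norm G S g)) \<le> pmf \<nu>\<^sub>2 g \<and>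
      pmf \<nu>\<^sub>2 g \<le> b * inverse ((1 + word_norm G S g)\<^sup>2 * volume G (word_norm G S) (word_norm G S g))"
    using assms(6) unfolding comparable_on_def by auto
  interpret word_metric G S by fact
  interpret critical_walk G S \<nu>\<^sub>2 D K a b
    by unfold_locales (use assms(5) K doubling ab step in \<open>auto simp: divide_inverse\<close>)
  show ?thesis
    using return_prob_comparable[OF K(3,4) growth] strongly_controlled_critical by blast
qed

end
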